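(* For every state $\rho^{AB}$ on a finite-dimensional bipartite Hilbert space $\mathcal{H}_A\otimes\mathcal{H}_B$, the squashed entanglement is lower bounded by the distillable entanglement: $$E_D(\rho^{AB})\le E_{sq}(\rho^{AB}).$$
   Context: All Hilbert spaces are finite dimensional. For a state $\rho$ on a tensor product of systems, $\rho^X$ denotes its reduced state on the subsystem $X$, and $S(X)=S(\rho^X)=-\operatorname{Tr}\rho^X\log\rho^X$ is the von Neumann entropy ($\log$ to base 2). For a tripartite state $\rho^{ABE}$ the quantum conditional mutual information is $I(A;B|E)=S(AE)+S(BE)-S(ABE)-S(E)$. The squashed entanglement of a state $\rho^{AB}$ on $\mathcal{H}_A\otimes\mathcal{H}_B$ is $$E_{sq}(\rho^{AB})=\inf\left\{\tfrac12 I(A;B|E)\;:\;\rho^{ABE}\text{ a state on }\mathcal{H}_A\otimes\mathcal{H}_B\otimes\mathcal{H}_E\text{ with }\operatorname{Tr}_E\rho^{ABE}=\rho^{AB}\right\},$$ where the infimum is over all extensions $\rho^{ABE}$, with $\mathcal{H}_E$ of arbitrary (a priori unbounded) finite dimension. An LOCC operation with respect to the cut between parties $A$ and $B$ is a completely positive trace-preserving map obtained by finitely many rounds, in each of which one party applies to its own system a quantum instrument (a finite family of completely positive maps, possibly changing that party's Hilbert space, whose sum is trace preserving) and communicates the outcome to the other party, where the instrument used may depend on all earlier outcomes; at the end the outcome record may be discarded. The distillable entanglement $E_D(\rho^{AB})$ is the asymptotic rate at which maximal entanglement can be obtained from copies of $\rho^{AB}$ by LOCC: it is the supremum of $\limsup_{n\to\infty}\frac1n\log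 s_n$ over all sequences of positive integers $s_n$ and LOCC operations $\Lambda_n$ (mapping states on $\mathcal{H}_A^{\otimes n}\otimes\mathcal{H}_B^{\otimes n}$ to states on $\mathbb{C}^{s_n}\otimes\mathbb{C}^{s_n}$) such that $\|\Lambda_n((\rho^{AB})^{\otimes n})-|s_n\rangle\langle s_n|\|_1\to 0$, where $|s\rangle=\frac{1}{\sqrt s}\sum_{i=1}^s|i\rangle\otimes|i\rangle$ is a maximally entangled state of Schmidt rank $s$ and $\|\cdot\|_1$ is the trace norm. *)

theory Defs
  imports "Jordan_Normal_Form.Schur_Decomposition" "HOL-Library.Extended_Real"
begin

text \<open>
  A Hilbert space of dimension \<open>d\<close> is the space of vectors of length \<open>d\<close>, and operators on it are
  \<open>d \<times> d\<close> matrices. Tensor products use the lexicographic product basis: in the tensor product of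
  spaces of dimensions \<open>d1\<close> and \<open>d2\<close>, the basis vector \<open>i1 \<otimes> i2\<close> has index \<open>i1 * d2 + i2\<close>. This
  convention is strictly associative.
\<close>

definition mtrace :: "complex mat \<Rightarrow> complex" where
  "mtrace X = (\<Sum>i<dim_row X. X $$ (i, i))"

definition psd :: "nat \<Rightarrow> complex mat \<Rightarrow> bool" where
  "psd d X \<longleftrightarrow> X \<in> carrier_mat d d \<and> (\<forall>v\<in>carrier_vec d. (X *\<^sub>v v) \<bullet>c v \<ge> 0)"

definition density_operator :: "nat \<Rightarrow> complex mat \<Rightarrow> bool" where
  "density_operator d \<rho> \<longleftrightarrow> psd d \<rho> \<and> mtrace \<rho> = 1"


section \<open>Functions of Hermitian matrices, entropy and trace norm\<close>

definition spectral_decomposition :: "complex mat \<Rightarrow> complex mat \<Rightarrow> (nat \<Rightarrow> real) \<Rightarrow> bool" where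
  "spectral_decomposition X U e \<longleftrightarrow> (let d = dim_row X in
     U \<in> carrier_mat d d \<and> U * mat_adjoint U = 1\<^sub>m d \<and> mat_adjoint U * U = 1\<^sub>m d \<and>
     X = U * mat_diag d (\<lambda>i. complex_of_real (e i)) * mat_adjoint U)"

text \<open>The matrix \<open>f(X)\<close> for Hermitian \<open>X\<close>; it does not depend on the chosen decomposition.\<close>

definition hermitian_fun :: "(real \<Rightarrow> real) \<Rightarrow> complex mat \<Rightarrow> complex mat" where
  "hermitian_fun f X =
     (let (U, e) = (SOME (U, e). spectral_decomposition X U e)
      in U * mat_diag (dim_row X) (\<lambda>i. complex_of_real (f (e i))) * mat_adjoint U)"

text \<open>Since \<open>log 2 0 = 0\<close> in HOL, zero eigenvalues contribute \<open>0\<close>, which is the usual convention.\<close>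

definition entropy :: "complex mat \<Rightarrow> real" where
  "entropy \<rho> = - Re (mtrace (\<rho> * hermitian_fun (log 2) \<rho>))"

definition trace_norm :: "complex mat \<Rightarrow> real" where
  "trace_norm X = Re (mtrace (hermitian_fun sqrt (mat_adjoint X * X)))"


section \<open>Partial trace and squashed entanglement\<close>

text \<open>
  \<open>ptrace a d c\<close> traces out the middle factor of a tensor product of spaces of dimensions \<open>a\<close>, \<open>d\<close>,
  \<open>c\<close>. Taking \<open>a = 1\<close> or \<open>c = 1\<close> traces out the first or the last factor.
\<close>

definition ptrace :: "nat \<Rightarrow> nat \<Rightarrow> nat \<Rightarrow> complex mat \<Rightarrow> complex mat" where
  "ptrace a d c X = mat (a * c) (a * c) (\<lambda>(i, j).
     \<Sum>k<d. X $$ ((i div c * d + k) * c + i mod c, (j div c * d + k) * c + j mod c))"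

text \<open>\<open>I(A;B|E)\<close> for a state on a tripartite system of dimensions \<open>dA\<close>, \<open>dB\<close>, \<open>dE\<close>.\<close>

definition cond_mutual_info :: "nat \<Rightarrow> nat \<Rightarrow> nat \<Rightarrow> complex mat \<Rightarrow> real" where
  "cond_mutual_info dA dB dE \<rho> =
     entropy (ptrace dA dB dE \<rho>) + entropy (ptrace 1 dA (dB * dE) \<rho>)
       - entropy \<rho> - entropy (ptrace 1 (dA * dB) dE \<rho>)"

definition squashed_entanglement :: "nat \<Rightarrow> nat \<Rightarrow> complex mat \<Rightarrow> ereal" where
  "squashed_entanglement dA dB \<rho> =
     Inf {ereal (1 / 2 * cond_mutual_info dA dB dE \<sigma>) | dE \<sigma>.
            density_operator (dA * dB * dE) \<sigma> \<and> ptrace (dA * dB) dE 1 \<sigma> = \<rho>}"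


section \<open>Completely positive maps and instruments\<close>

text \<open>
  \<open>local_map a d c d' \<Phi>\<close> is \<open>id \<otimes> \<Phi> \<otimes> id\<close>, where \<open>\<Phi>\<close> maps operators on a \<open>d\<close>-dimensional space to
  operators on a \<open>d'\<close>-dimensional one and the identities act on operators on spaces of dimensions
  \<open>a\<close> and \<open>c\<close>: \<open>\<Phi>\<close> is applied to each \<open>d \<times> d\<close> block obtained by fixing the first and third
  components of both the row and the column index.
\<close>

definition local_map ::
  "nat \<Rightarrow> nat \<Rightarrow> nat \<Rightarrow> nat \<Rightarrow> (complex mat \<Rightarrow> complex mat) \<Rightarrow> complex mat \<Rightarrow> complex mat" where
  "local_map a d c d' \<Phi> X = mat (a * d' * c) (a * d' * c) (\<lambda>(i, j).
     \<Phi> (mat d d (\<lambda>(k, l).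
          X $$ ((i div c div d' * d + k) * c + i mod c, (j div c div d' * d + l) * c + j mod c)))
       $$ (i div c mod d', j div c mod d'))"

definition linear_mat_map :: "nat \<Rightarrow> nat \<Rightarrow> (complex mat \<Rightarrow> complex mat) \<Rightarrow> bool" where
  "linear_mat_map d d' \<Phi> \<longleftrightarrow>
     (\<forall>X\<in>carrier_mat d d. \<Phi> X \<in> carrier_mat d' d') \<and>
     (\<forall>X\<in>carrier_mat d d. \<forall>Y\<in>carrier_mat d d. \<Phi> (X + Y) = \<Phi> X + \<Phi> Y) \<and>
     (\<forall>c. \<forall>X\<in>carrier_mat d d. \<Phi> (c \<cdot>\<^sub>m X) = c \<cdot>\<^sub>m \<Phi> X)"

definition completely_positive :: "nat \<Rightarrow> nat \<Rightarrow> (complex mat \<Rightarrow> complex mat) \<Rightarrow> bool" where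
  "completely_positive d d' \<Phi> \<longleftrightarrow>
     linear_mat_map d d' \<Phi> \<and>
     (\<forall>k X. psd (k * d) X \<longrightarrow> psd (k * d') (local_map k d 1 d' \<Phi> X))"

definition instrument ::
  "nat \<Rightarrow> nat \<Rightarrow> nat \<Rightarrow> (nat \<Rightarrow> complex mat \<Rightarrow> complex mat) \<Rightarrow> bool" where
  "instrument d d' m \<Phi> \<longleftrightarrow>
     (\<forall>i<m. completely_positive d d' (\<Phi> i)) \<and>
     (\<forall>X\<in>carrier_mat d d. (\<Sum>i<m. mtrace (\<Phi> i X)) = mtrace X)"


section \<open>LOCC operations\<close>

definition mat_sum :: "nat \<Rightarrow> nat \<Rightarrow> (nat \<Rightarrow> complex mat) \<Rightarrow> complex mat" where
  "mat_sum d m M = mat d d (\<lambda>(r, s). \<Sum>i<m. M i $$ (r, s))"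

text \<open>
  \<open>locc a b a' b' \<Lambda>\<close>: the map \<open>\<Lambda>\<close>, from operators on a bipartite system of dimensions \<open>a\<close>, \<open>b\<close> to
  operators on one of dimensions \<open>a'\<close>, \<open>b'\<close>, is implemented by a finite LOCC protocol. A protocol
  either stops, or one party applies an instrument and, on outcome \<open>i\<close> (known to both parties),
  the protocol continues with \<open>\<Lambda> i\<close>; hence everything that follows may depend on all earlier
  outcomes. Summing over \<open>i\<close> discards the outcome record. A party that wants to keep the record
  can write it into its own system in a final local step.
\<close>

inductive locc :: "nat \<Rightarrow> nat \<Rightarrow> nat \<Rightarrow> nat \<Rightarrow> (complex mat \<Rightarrow> complex mat) \<Rightarrow> bool" where
  stop: "locc a b a b (\<lambda>X. X)"
| step_A: "instrument a a1 m \<Phi> \<Longrightarrow> (\<And>i. i < m \<Longrightarrow> locc a1 b a' b' (\<Lambda> i)) \<Longrightarrow>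
     locc a b a' b' (\<lambda>X. mat_sum (a' * b') m (\<lambda>i. \<Lambda> i (local_map 1 a b a1 (\<Phi> i) X)))"
| step_B: "instrument b b1 m \<Phi> \<Longrightarrow> (\<And>i. i < m \<Longrightarrow> locc a b1 a' b' (\<Lambda> i)) \<Longrightarrow>
     locc a b a' b' (\<lambda>X. mat_sum (a' * b') m (\<lambda>i. \<Lambda> i (local_map a b 1 b1 (\<Phi> i) X)))"


section \<open>Distillable entanglement\<close>

text \<open>
  The tensor product of \<open>\<rho>\<close> on a bipartite system of dimensions \<open>a1\<close>, \<open>b1\<close> with \<open>\<sigma>\<close> on one of
  dimensions \<open>a2\<close>, \<open>b2\<close>, with the factors reordered from \<open>A1 B1 A2 B2\<close> to \<open>(A1 A2) (B1 B2)\<close>.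
  A basis index of the latter is \<open>i = (iA1 * a2 + iA2) * (b1 * b2) + (iB1 * b2 + iB2)\<close>.
\<close>

definition bip_tensor ::
  "nat \<Rightarrow> nat \<Rightarrow> nat \<Rightarrow> nat \<Rightarrow> complex mat \<Rightarrow> complex mat \<Rightarrow> complex mat" where
  "bip_tensor a1 b1 a2 b2 \<rho> \<sigma> =
     (let fst_ix = (\<lambda>i. i div (b1 * b2) div a2 * b1 + i mod (b1 * b2) div b2);
          snd_ix = (\<lambda>i. i div (b1 * b2) mod a2 * b2 + i mod (b1 * b2) mod b2)
      in mat (a1 * a2 * (b1 * b2)) (a1 * a2 * (b1 * b2))
           (\<lambda>(i, j). \<rho> $$ (fst_ix i, fst_ix j) * \<sigma> $$ (snd_ix i, snd_ix j)))"

text \<open>\<open>n\<close> copies of \<open>\<rho>\<close>, as an operator on a bipartite system of dimensions \<open>a ^ n\<close>, \<open>b ^ n\<close>.\<close>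

primrec copies :: "nat \<Rightarrow> nat \<Rightarrow> complex mat \<Rightarrow> nat \<Rightarrow> complex mat" where
  "copies a b \<rho> 0 = 1\<^sub>m 1"
| "copies a b \<rho> (Suc n) = bip_tensor a b (a ^ n) (b ^ n) \<rho> (copies a b \<rho> n)"

definition max_entangled_vec :: "nat \<Rightarrow> complex vec" where
  "max_entangled_vec s =
     vec (s * s) (\<lambda>i. if i div s = i mod s then complex_of_real (1 / sqrt (real s)) else 0)"

definition rank_one :: "complex vec \<Rightarrow> complex mat" where
  "rank_one v = mat (dim_vec v) (dim_vec v) (\<lambda>(i, j). v $ i * cnj (v $ j))"

definition distillable_entanglement :: "nat \<Rightarrow> nat \<Rightarrow> complex mat \<Rightarrow> ereal" where
  "distillable_entanglement dA dB \<rho> =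
     Sup {limsup (\<lambda>n. ereal (log 2 (real (s n)) / real n)) | s \<Lambda>.
            (\<forall>n\<ge>1. s n \<ge> 1 \<and> locc (dA ^ n) (dB ^ n) (s n) (s n) (\<Lambda> n)) \<and>
            (\<lambda>n. trace_norm (\<Lambda> n (copies dA dB \<rho> n) - rank_one (max_entangled_vec (s n))))
              \<longlonglongrightarrow> 0}"

end

theory Submission
  imports Defs "HOL-Library.Nat_Bijection"
begin

text \<open>
  For \<open>0 < t < 1\<close> the supremum over \<open>X\<close> of
  \<open>2 Re Tr X\<^sup>*(\<rho> - \<sigma>) - (1 - t) Tr X\<^sup>*\<rho>X - t Tr X\<sigma>X\<^sup>*\<close> is, in eigenbases of \<open>\<rho>\<close> and \<open>\<sigma>\<close> with eigenvalues
  \<open>p\<close> and \<open>q\<close>, the sum of the numbers \<open>(p - q)\<^sup>2 / ((1 - t) p + t q)\<close> weighted by squared overlaps. Since \<open>t\<close> times such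
  a number integrates over \<open>[0, 1]\<close> to \<open>p ln p - p ln q - p + q\<close>, every inequality between these suprema that holds for
  all \<open>t\<close> is inherited by relative entropies. The functional being linear in \<open>(\<rho>, \<sigma>)\<close>, this yields joint convexity and
  monotonicity under pinching, hence that the conditional entropy \<open>S(A|B)\<close> is concave and that strong subadditivity holds.

  Working with unnormalised operators, for which \<open>I(A;B|E)\<close> is homogeneous, an instrument of one party with one
  Kraus operator per outcome does not increase the sum of \<open>I(A;B|E)\<close> over the outcomes. If \<open>E\<close> keeps the outcome record,
  an extension of the input of an LOCC protocol becomes an extension of its output with no larger \<open>I(A;B|E)\<close>; on \<open>n\<close> copies
  \<open>I(A;B|E)\<close> is \<open>n\<close> times the one for a single copy. Finally, strong subadditivity and weak monotonicity give
  \<open>I(A;B|E) \<ge> 2 (S(B) - S(AB))\<close> for every extension, and testing the variational expression with a multiple of the projection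
  onto a maximally entangled vector of rank \<open>s\<close> gives \<open>S(B) - S(AB) \<ge> (2 F - 1) ln s - 1\<close> for a state of overlap \<open>F\<close> with it.
  The dimension of \<open>E\<close> enters nowhere.
\<close>

section \<open>Operators over finite index sets\<close>

text \<open>The obstacle is that \<open>E\<close> is unbounded twice over: the infimum ranges over
  all finite dimensions, and the outcome record written into \<open>E\<close> is as long as the
  protocol makes it. An estimate that loses a multiple of the logarithm of the dimension of
  \<open>E\<close> is therefore useless. Hence closeness to a maximally entangled state is exploited
  only for the coherent information S(B) - S(AB) of the output, which involves no \<open>E\<close>
  and at a maximally entangled state equals half of I(A;B|E), so that nothing is lost in the limit.
  The denominators \<open>(1 - t) p + t q\<close> arise because multiplication by one operator from
  the left and by the other from the right commute: in mixed eigenbases the functional splits into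
  scalar problems 2 Re (conj z c w) - d |z|^2 with maximum |w|^2 c^2 / d. A supremum of functions
  linear in the pair of operators is convex, and restricting the trial operators to block diagonal
  ones can only lower it; these two facts take the place of operator convexity of the logarithm.
  Working without normalisation avoids dividing by outcome probabilities, which may vanish.\<close>

text \<open>
  Operators are given by their entries over a finite index set of arbitrary type, so that tensor products and
  direct sums of spaces are products and disjoint sums of index sets. In \<open>diag_on I \<rho> K p v\<close> the
  orthonormal eigenvectors \<open>v k\<close> need not span the whole space; the rest of it belongs to the eigenvalue \<open>0\<close>.
\<close>

definition orthonormal_on :: "'a set \<Rightarrow> 'k set \<Rightarrow> ('k \<Rightarrow> 'a \<Rightarrow> complex) \<Rightarrow> bool" where
  "orthonormal_on I K v \<longleftrightarrow> (\<forall>k\<in>K. \<forall>l\<in>K. (\<Sum>i\<in>I. cnj (v k i) * v l i) = of_bool (k = l))"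

definition complete_on :: "'a set \<Rightarrow> 'k set \<Rightarrow> ('k \<Rightarrow> 'a \<Rightarrow> complex) \<Rightarrow> bool" where
  "complete_on I K v \<longleftrightarrow> (\<forall>i\<in>I. \<forall>j\<in>I. (\<Sum>k\<in>K. v k i * cnj (v k j)) = of_bool (i = j))"

definition diag_on ::
  "'a set \<Rightarrow> ('a \<Rightarrow> 'a \<Rightarrow> complex) \<Rightarrow> 'k set \<Rightarrow> ('k \<Rightarrow> real) \<Rightarrow> ('k \<Rightarrow> 'a \<Rightarrow> complex) \<Rightarrow> bool" where
  "diag_on I \<rho> K p v \<longleftrightarrow>
     orthonormal_on I K v \<and> (\<forall>i\<in>I. \<forall>j\<in>I. \<rho> i j = (\<Sum>k\<in>K. complex_of_real (p k) * v k i * cnj (v k j)))"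

definition hermitian_on :: "'a set \<Rightarrow> ('a \<Rightarrow> 'a \<Rightarrow> complex) \<Rightarrow> bool" where
  "hermitian_on I \<rho> \<longleftrightarrow> (\<forall>i\<in>I. \<forall>j\<in>I. \<rho> j i = cnj (\<rho> i j))"

lemma hermitian_onD: "hermitian_on I \<rho> \<Longrightarrow> i \<in> I \<Longrightarrow> j \<in> I \<Longrightarrow> cnj (\<rho> i j) = \<rho> j i"
  unfolding hermitian_on_def by (metis complex_cnj_cnj)

lemma sum_of_bool_left:
  fixes f :: "'a \<Rightarrow> 'b::comm_semiring_1"
  assumes "finite A" "a \<in> A"
  shows "(\<Sum>x\<in>A. of_bool (x = a) * f x) = f a"
proof -
  have "(\<Sum>x\<in>A. of_bool (x = a) * f x) = (\<Sum>x\<in>A. if x = a then f x else 0)"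
    by (intro sum.cong) auto
  with assms show ?thesis by simp
qed

lemma sum_of_bool_left':
  fixes f :: "'a \<Rightarrow> 'b::comm_semiring_1"
  assumes "finite A" "a \<in> A"
  shows "(\<Sum>x\<in>A. of_bool (a = x) * f x) = f a"
  using sum_of_bool_left[OF assms, of f] by (simp add: eq_commute[of a])

lemma sum_of_bool_right:
  fixes f :: "'a \<Rightarrow> 'b::comm_semiring_1"
  assumes "finite A" "a \<in> A"
  shows "(\<Sum>x\<in>A. f x * of_bool (x = a)) = f a"
  using sum_of_bool_left[OF assms, of f] by (simp add: mult.commute)

lemma sum_of_bool_right':
  fixes f :: "'a \<Rightarrow> 'b::comm_semiring_1"
  assumes "finite A" "a \<in> A"
  shows "(\<Sum>x\<in>A. f x * of_bool (a = x)) = f a"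
  using sum_of_bool_left'[OF assms, of f] by (simp add: mult.commute)

lemma orthonormal_onD:
  "orthonormal_on I K v \<Longrightarrow> k \<in> K \<Longrightarrow> l \<in> K \<Longrightarrow> (\<Sum>i\<in>I. cnj (v k i) * v l i) = of_bool (k = l)"
  by (simp add: orthonormal_on_def)

lemma complete_onD:
  "complete_on I K v \<Longrightarrow> i \<in> I \<Longrightarrow> j \<in> I \<Longrightarrow> (\<Sum>k\<in>K. v k i * cnj (v k j)) = of_bool (i = j)"
  by (simp add: complete_on_def)

lemma diag_onD:
  "diag_on I \<rho> K p v \<Longrightarrow> i \<in> I \<Longrightarrow> j \<in> I \<Longrightarrow>
     \<rho> i j = (\<Sum>k\<in>K. complex_of_real (p k) * v k i * cnj (v k j))"
  by (simp add: diag_on_def)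

lemma orthonormal_on_sum:
  assumes "orthonormal_on I K v" "finite K" "k \<in> K"
  shows "(\<Sum>i\<in>I. cnj (v k i) * (\<Sum>l\<in>K. c l * v l i)) = c k"
proof -
  have "(\<Sum>i\<in>I. cnj (v k i) * (\<Sum>l\<in>K. c l * v l i))
      = (\<Sum>l\<in>K. c l * (\<Sum>i\<in>I. cnj (v k i) * v l i))"
    by (subst (2) sum_distrib_left, subst sum_distrib_left, subst sum.swap) (simp add: mult_ac)
  also have "\<dots> = (\<Sum>l\<in>K. c l * of_bool (k = l))"
    using assms by (intro sum.cong) (auto simp: orthonormal_onD)
  finally show ?thesis using assms by (simp add: sum_of_bool_right')
qed

lemma diag_on_eigenvector:
  assumes "diag_on I \<rho> K p v" "finite K" "k \<in> K" "i \<in> I"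
  shows "(\<Sum>j\<in>I. \<rho> i j * v k j) = complex_of_real (p k) * v k i"
proof -
  have o: "orthonormal_on I K v" using assms by (simp add: diag_on_def)
  have "(\<Sum>j\<in>I. \<rho> i j * v k j) = (\<Sum>j\<in>I. (\<Sum>l\<in>K. complex_of_real (p l) * v l i * cnj (v l j)) * v k j)"
    using assms by (intro sum.cong) (auto simp: diag_onD)
  also have "\<dots> = (\<Sum>l\<in>K. complex_of_real (p l) * v l i * (\<Sum>j\<in>I. cnj (v l j) * v k j))"
    by (subst sum_distrib_left, subst sum_distrib_right, subst sum.swap) (simp add: mult_ac)
  also have "\<dots> = (\<Sum>l\<in>K. complex_of_real (p l) * v l i * of_bool (l = k))"
    using assms o by (intro sum.cong) (auto simp: orthonormal_onD)
  finally show ?thesis using assms by (simp add: sum_of_bool_right)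
qed

text \<open>Completeness is essential here: outside the span of the eigenvectors
  \<open>\<rho>\<close> could act arbitrarily. It enters by inserting a resolution of the identity
  to the right of \<open>\<rho>\<close>.\<close>

lemma diag_onI_eigenvectors:
  assumes "orthonormal_on I K v" "complete_on I K v" "finite I"
    and ev: "\<And>k i. k \<in> K \<Longrightarrow> i \<in> I \<Longrightarrow> (\<Sum>j\<in>I. \<rho> i j * v k j) = complex_of_real (p k) * v k i"
  shows "diag_on I \<rho> K p v"
  unfolding diag_on_def
proof (intro conjI ballI assms(1))
  fix i j assume i: "i \<in> I" and j: "j \<in> I"
  have "\<rho> i j = (\<Sum>m\<in>I. \<rho> i m * of_bool (m = j))"
    using assms j by (simp add: sum_of_bool_right)
  also have "\<dots> = (\<Sum>m\<in>I. \<rho> i m * (\<Sum>k\<in>K. v k m * cnj (v k j)))"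
    using assms j by (intro sum.cong) (auto simp: complete_onD)
  also have "\<dots> = (\<Sum>k\<in>K. (\<Sum>m\<in>I. \<rho> i m * v k m) * cnj (v k j))"
    by (subst sum_distrib_left, subst sum_distrib_right, subst sum.swap) (simp add: mult_ac)
  also have "\<dots> = (\<Sum>k\<in>K. complex_of_real (p k) * v k i * cnj (v k j))"
    using ev i by simp
  finally show "\<rho> i j = \<dots>" .
qed

lemma complete_on_expand:
  assumes "complete_on I K v" "finite I" "i \<in> I"
  shows "u i = (\<Sum>k\<in>K. (\<Sum>j\<in>I. cnj (v k j) * u j) * v k i)"
proof -
  have "u i = (\<Sum>j\<in>I. of_bool (i = j) * u j)"
    using assms by (simp add: sum_of_bool_left')
  also have "\<dots> = (\<Sum>j\<in>I. (\<Sum>k\<in>K. v k i * cnj (v k j)) * u j)"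
    using assms by (intro sum.cong) (auto simp: complete_onD)
  also have "\<dots> = (\<Sum>k\<in>K. (\<Sum>j\<in>I. cnj (v k j) * u j) * v k i)"
    by (subst (1 2) sum_distrib_right, subst sum.swap) (simp add: mult_ac)
  finally show ?thesis .
qed

lemma complete_on_parseval:
  assumes "complete_on I K v" "finite I"
  shows "(\<Sum>k\<in>K. cnj (\<Sum>i\<in>I. cnj (v k i) * u i) * (\<Sum>i\<in>I. cnj (v k i) * w i)) = (\<Sum>i\<in>I. cnj (u i) * w i)"
proof -
  have "(\<Sum>i\<in>I. cnj (u i) * w i)
      = (\<Sum>i\<in>I. cnj (u i) * (\<Sum>k\<in>K. (\<Sum>j\<in>I. cnj (v k j) * w j) * v k i))"
    by (intro sum.cong refl arg_cong[of _ _ "\<lambda>x. _ * x"] complete_on_expand[OF assms])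
  also have "\<dots> = (\<Sum>k\<in>K. (\<Sum>i\<in>I. v k i * cnj (u i)) * (\<Sum>j\<in>I. cnj (v k j) * w j))"
    by (subst sum_distrib_left, subst (2) sum_distrib_right, subst sum.swap) (simp add: mult_ac)
  finally show ?thesis by (simp add: cnj_sum)
qed

subsection \<open>The spectral theorem\<close>

text \<open>For square matrices a one-sided inverse is two-sided; as many orthonormal vectors as
  dimensions therefore span the space.\<close>

lemma orthonormal_on_nat_complete:
  assumes "orthonormal_on {..<n::nat} {..<n} v"
  shows "complete_on {..<n} {..<n} v"
proof -
  define A where "A = mat n n (\<lambda>(k, i). cnj (v k i))"
  define B where "B = mat n n (\<lambda>(i, k). v k i)"
  have A: "A \<in> carrier_mat n n" and B: "B \<in> carrier_mat n n" by (auto simp: A_def B_def)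
  have "A * B = 1\<^sub>m n"
    using assms by (intro eq_matI) (auto simp: A_def B_def scalar_prod_def orthonormal_on_def atLeast0LessThan)
  then have "B * A = 1\<^sub>m n" using mat_mult_left_right_inverse[OF A B] by simp
  then have "(B * A) $$ (i, j) = of_bool (i = j)" if "i < n" "j < n" for i j using that by simp
  then show ?thesis
    by (auto simp: A_def B_def scalar_prod_def complete_on_def atLeast0LessThan)
qed

lemma exists_eigenvector:
  fixes \<rho> :: "nat \<Rightarrow> nat \<Rightarrow> complex"
  assumes "n > 0"
  obtains v e where "v \<in> carrier_vec n" "v \<noteq> 0\<^sub>v n"
    "\<And>i. i < n \<Longrightarrow> (\<Sum>j<n. \<rho> i j * v $ j) = e * v $ i"
proof -
  define A where "A = mat n n (\<lambda>(i, j). \<rho> i j)"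
  have A: "A \<in> carrier_mat n n" by (simp add: A_def)
  obtain es where es: "char_poly A = (\<Prod>a\<leftarrow>es. [:- a, 1:])" "length es = n"
    using char_poly_factorized[OF A] by blast
  with assms obtain e es' where "es = e # es'" by (cases es) auto
  then have "eigenvalue A e"
    unfolding eigenvalue_root_char_poly[OF A] es(1) by simp
  then obtain v where v: "v \<in> carrier_vec n" "v \<noteq> 0\<^sub>v n" "A *\<^sub>v v = e \<cdot>\<^sub>v v"
    using A unfolding eigenvalue_def eigenvector_def by auto
  have "(\<Sum>j<n. \<rho> i j * v $ j) = e * v $ i" if "i < n" for i
  proof -
    have "(A *\<^sub>v v) $ i = (\<Sum>j<n. \<rho> i j * v $ j)"
      using that v(1) by (simp add: A_def scalar_prod_def atLeast0LessThan)
    with v that show ?thesis by simp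
  qed
  with v that show thesis by blast
qed

text \<open>Gram-Schmidt keeps the first vector of its input, so the basis starts with a multiple of
  \<open>v\<close>. Its output is orthogonal but not normalised, whence the division by
  \<open>N\<close>.\<close>

lemma exists_orthonormal_extension:
  fixes v :: "complex vec"
  assumes v: "v \<in> carrier_vec n" "v \<noteq> 0\<^sub>v n"
  obtains e c where "orthonormal_on {..<n} {..<n} e" "\<And>i. i < n \<Longrightarrow> e 0 i = c * v $ i"
proof -
  interpret cof_vec_space n "TYPE(complex)" .
  define b where "b = basis_completion v"
  define ws where "ws = gram_schmidt n b"
  have n: "n \<noteq> 0" using v by auto
  from basis_completion[OF v, folded b_def]
  have dist_b: "distinct b" and indep: "\<not> lin_dep (set b)" and b: "set b \<subseteq> carrier_vec n"
    and hdb: "hd b = v" and len_b: "length b = n" by auto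
  from hdb len_b n obtain vs where bv: "b = v # vs" by (cases b, auto)
  from gram_schmidt_result[OF b dist_b indep refl, folded ws_def]
  have ws: "set ws \<subseteq> carrier_vec n" "corthogonal ws" "length ws = n"
    by (auto simp: len_b)
  from gram_schmidt_hd[OF v(1), of vs, folded bv] have hdws: "hd ws = v" unfolding ws_def .
  have ws0: "ws ! 0 = v" using hdws ws n by (metis hd_conv_nth length_0_conv)
  define N where "N k = complex_of_real (sqrt (\<Sum>i<n. (cmod (ws ! k $ i))\<^sup>2))" for k
  define e where "e k i = ws ! k $ i / N k" for k i
  have wsc: "ws ! k \<in> carrier_vec n" if "k < n" for k using ws that by auto
  have sq: "ws ! k \<bullet>c ws ! k = (N k)\<^sup>2" if "k < n" for k
  proof -
    have "ws ! k \<bullet>c ws ! k = (\<Sum>i<n. complex_of_real ((cmod (ws ! k $ i))\<^sup>2))"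
      using wsc[OF that] by (auto simp: scalar_prod_def atLeast0LessThan complex_norm_square simp del: of_real_power)
    also have "\<dots> = complex_of_real (\<Sum>i<n. (cmod (ws ! k $ i))\<^sup>2)" by simp
    also have "\<dots> = (N k)\<^sup>2" unfolding N_def of_real_power[symmetric] by (simp add: sum_nonneg)
    finally show ?thesis .
  qed
  have N0: "N k \<noteq> 0" if "k < n" for k
    using sq[OF that] corthogonalD[OF ws(2), of k k] ws(3) that by auto
  have cN: "cnj (N k) = N k" for k by (simp add: N_def)
  have "(\<Sum>i<n. cnj (e k i) * e l i) = of_bool (k = l)" if "k < n" "l < n" for k l
  proof -
    have "(\<Sum>i<n. cnj (e k i) * e l i) = (\<Sum>i<n. ws ! l $ i * cnj (ws ! k $ i)) / (N k * N l)"
      by (simp add: e_def cN sum_divide_distrib mult_ac)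
    also have "(\<Sum>i<n. ws ! l $ i * cnj (ws ! k $ i)) = ws ! l \<bullet>c ws ! k"
      using wsc[OF that(1), THEN carrier_vecD] by (simp add: scalar_prod_def atLeast0LessThan)
    also have "\<dots> / (N k * N l) = of_bool (k = l)"
      using corthogonalD[OF ws(2), of l k] ws(3) that sq[of k] N0[of k] by (auto simp: power2_eq_square)
    finally show ?thesis .
  qed
  then have "orthonormal_on {..<n} {..<n} e" by (simp add: orthonormal_on_def)
  moreover have "e 0 i = (1 / N 0) * v $ i" for i by (simp add: e_def ws0)
  ultimately show thesis using that by blast
qed

lemma hermitian_on_form:
  assumes "hermitian_on I \<rho>"
  shows "(\<Sum>i\<in>I. cnj (u i) * (\<Sum>j\<in>I. \<rho> i j * w j)) = cnj (\<Sum>i\<in>I. cnj (w i) * (\<Sum>j\<in>I. \<rho> i j * u j))"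
proof -
  have "cnj (\<Sum>i\<in>I. cnj (w i) * (\<Sum>j\<in>I. \<rho> i j * u j)) = (\<Sum>i\<in>I. \<Sum>j\<in>I. w i * cnj (\<rho> i j) * cnj (u j))"
    by (simp add: cnj_sum sum_distrib_left mult_ac)
  also have "\<dots> = (\<Sum>i\<in>I. \<Sum>j\<in>I. w i * \<rho> j i * cnj (u j))"
    using assms by (intro sum.cong refl) (simp add: hermitian_onD)
  also have "\<dots> = (\<Sum>i\<in>I. cnj (u i) * (\<Sum>j\<in>I. \<rho> i j * w j))"
    by (subst sum.swap) (simp add: sum_distrib_left mult_ac)
  finally show ?thesis by simp
qed

text \<open>Deflation: an eigenvector is completed to an orthonormal basis, hermiticity makes its
  orthogonal complement invariant, and the induction hypothesis diagonalises the compression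
  \<open>\<sigma>\<close> of \<open>\<rho>\<close> to that complement.\<close>

lemma spectral_theorem_nat:
  fixes \<rho> :: "nat \<Rightarrow> nat \<Rightarrow> complex"
  assumes "hermitian_on {..<n} \<rho>"
  shows "\<exists>p v. diag_on {..<n} \<rho> {..<n} p v"
  using assms
proof (induction n arbitrary: \<rho>)
  case 0
  then show ?case by (simp add: diag_on_def orthonormal_on_def)
next
  case (Suc n)
  obtain x z where x: "x \<in> carrier_vec (Suc n)" "x \<noteq> 0\<^sub>v (Suc n)"
    and ev: "\<And>i. i < Suc n \<Longrightarrow> (\<Sum>j<Suc n. \<rho> i j * x $ j) = z * x $ i"
    using exists_eigenvector[of "Suc n" \<rho>] by blast
  obtain e c where e: "orthonormal_on {..<Suc n} {..<Suc n} e" and e0: "\<And>i. i < Suc n \<Longrightarrow> e 0 i = c * x $ i"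
    using exists_orthonormal_extension[OF x] by blast
  have ce: "complete_on {..<Suc n} {..<Suc n} e" by (rule orthonormal_on_nat_complete[OF e])
  define R where "R u i = (\<Sum>j<Suc n. \<rho> i j * u j)" for u i
  define ip :: "(nat \<Rightarrow> complex) \<Rightarrow> (nat \<Rightarrow> complex) \<Rightarrow> complex" where "ip u w = (\<Sum>i<Suc n. cnj (u i) * w i)" for u w
  have herm: "ip u (R w) = cnj (ip w (R u))" for u w
    unfolding ip_def R_def by (rule hermitian_on_form[OF Suc.prems])
  have ipc: "ip u w = cnj (ip w u)" for u w by (simp add: ip_def cnj_sum mult.commute del: sum.lessThan_Suc)
  have ipe: "ip (e k) (e l) = of_bool (k = l)" if "k < Suc n" "l < Suc n" for k l
    using e that unfolding ip_def orthonormal_on_def by blast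
  have Re0: "R (e 0) i = z * e 0 i" if "i < Suc n" for i
  proof -
    have "R (e 0) i = (\<Sum>j<Suc n. c * (\<rho> i j * x $ j))"
      unfolding R_def by (intro sum.cong) (auto simp: e0)
    also have "\<dots> = c * (z * x $ i)" using ev[OF that] by (simp add: sum_distrib_left[symmetric] del: sum.lessThan_Suc)
    finally show ?thesis using that by (simp add: e0)
  qed
  have ip_cong: "ip u w = ip u w'" if "\<And>i. i < Suc n \<Longrightarrow> w i = w' i" for u w w'
    unfolding ip_def using that by (intro sum.cong) auto
  have ip_scale: "ip u (\<lambda>i. a * w i) = a * ip u w" for a u w
    unfolding ip_def by (simp add: sum_distrib_left mult_ac del: sum.lessThan_Suc)
  have ip_sum: "ip u (\<lambda>i. \<Sum>j\<in>S. a j * f j i) = (\<Sum>j\<in>S. a j * ip u (f j))" for u a f and S :: "nat set"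
    unfolding ip_def by (simp add: sum_distrib_left mult_ac del: sum.lessThan_Suc) (rule sum.swap)
  have "z = ip (e 0) (R (e 0))"
    using ip_cong[OF Re0, where u="e 0"] ipe[of 0 0] by (simp add: ip_scale)
  then have "z = cnj z" using herm[of "e 0" "e 0"] by simp
  then have zr: "complex_of_real (Re z) = z" by (simp add: complex_eq_iff)
  define \<sigma> where "\<sigma> k l = ip (e (Suc k)) (R (e (Suc l)))" for k l
  have "hermitian_on {..<n} \<sigma>"
    unfolding hermitian_on_def \<sigma>_def using herm by blast
  from Suc.IH[OF this] obtain q w where w: "diag_on {..<n} \<sigma> {..<n} q w" by blast
  have ow: "orthonormal_on {..<n} {..<n} w" using w by (simp add: diag_on_def)
  define u where "u k i = (\<Sum>j<n. w k j * e (Suc j) i)" for k i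
  define v where "v k = (case k of 0 \<Rightarrow> e 0 | Suc k' \<Rightarrow> u k')" for k
  define p where "p k = (case k of 0 \<Rightarrow> Re z | Suc k' \<Rightarrow> q k')" for k
  have ipu: "ip y (u k) = (\<Sum>j<n. w k j * ip y (e (Suc j)))" for y k
    unfolding u_def by (rule ip_sum)
  have ipeu: "ip (e (Suc j)) (u k) = w k j" if "j < n" for j k
  proof -
    have "ip (e (Suc j)) (u k) = (\<Sum>l<n. w k l * of_bool (l = j))"
      unfolding ipu using that by (intro sum.cong) (auto simp: ipe)
    then show ?thesis using that by (simp add: sum_of_bool_right)
  qed
  have ipe0u: "ip (e 0) (u k) = 0" for k
    unfolding ipu by (intro sum.neutral) (auto simp: ipe)
  have ipuu: "ip (u k) (u l) = of_bool (k = l)" if "k < n" "l < n" for k l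
  proof -
    have "ip (u k) (u l) = (\<Sum>j<n. w l j * cnj (ip (e (Suc j)) (u k)))"
      unfolding ipu[of "u k" l] by (subst ipc) simp
    also have "\<dots> = (\<Sum>j<n. cnj (w k j) * w l j)"
      by (intro sum.cong) (auto simp: ipeu)
    finally show ?thesis using ow that by (simp add: orthonormal_on_def)
  qed
  have ov: "orthonormal_on {..<Suc n} {..<Suc n} v"
    unfolding orthonormal_on_def ip_def[symmetric]
  proof (intro ballI)
    fix k l assume "k \<in> {..<Suc n}" "l \<in> {..<Suc n}"
    then show "ip (v k) (v l) = of_bool (k = l)"
      using ipe[of 0 0] ipe0u ipuu by (cases k; cases l) (auto simp: v_def ipc[of "u _" "e 0"])
  qed
  have Ru: "R (u k) i = complex_of_real (q k) * u k i" if k: "k < n" and i: "i < Suc n" for k i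
  proof -
    have "R (u k) i = (\<Sum>j<Suc n. ip (e j) (R (u k)) * e j i)"
      unfolding ip_def using complete_on_expand[OF ce, of i "R (u k)"] i by simp
    also have "\<dots> = (\<Sum>j<n. ip (e (Suc j)) (R (u k)) * e (Suc j) i)"
    proof -
      \<comment> \<open>Invariance of the complement: moving \<open>R\<close> to the other side of
        the inner product turns it into the eigenvalue of \<open>e 0\<close>, to which
        \<open>u k\<close> is orthogonal.\<close>
      have "ip (e 0) (R (u k)) = cnj (z * ip (u k) (e 0))"
        using herm[of "e 0" "u k"] ip_cong[OF Re0, where u="u k"] by (simp add: ip_scale)
      also have "\<dots> = 0" using ipe0u[of k] by (simp add: ipc[of "u k"])
      finally show ?thesis by (simp add: sum.lessThan_Suc_shift del: sum.lessThan_Suc)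
    qed
    also have "\<dots> = (\<Sum>j<n. (complex_of_real (q k) * w k j) * e (Suc j) i)"
    proof (intro sum.cong refl, rule arg_cong[of _ _ "\<lambda>a. a * _"])
      fix j assume j: "j \<in> {..<n}"
      have "R (u k) = (\<lambda>i. \<Sum>l<n. w k l * R (e (Suc l)) i)"
      proof
        fix i
        have "R (u k) i = (\<Sum>j<Suc n. \<Sum>l<n. w k l * (\<rho> i j * e (Suc l) j))"
          unfolding R_def u_def by (simp add: sum_distrib_left mult_ac del: sum.lessThan_Suc)
        also have "\<dots> = (\<Sum>l<n. w k l * R (e (Suc l)) i)"
          by (subst sum.swap) (simp only: R_def sum_distrib_left)
        finally show "R (u k) i = \<dots>" .
      qed
      then have "ip (e (Suc j)) (R (u k)) = (\<Sum>l<n. w k l * \<sigma> j l)"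
        using ip_sum by (simp add: \<sigma>_def)
      also have "\<dots> = (\<Sum>l<n. \<sigma> j l * w k l)" by (simp add: mult.commute)
      also have "\<dots> = complex_of_real (q k) * w k j"
        using diag_on_eigenvector[OF w, of k j] k j by simp
      finally show "ip (e (Suc j)) (R (u k)) = complex_of_real (q k) * w k j" .
    qed
    also have "\<dots> = complex_of_real (q k) * u k i" by (simp add: u_def sum_distrib_left mult_ac)
    finally show ?thesis .
  qed
  have "(\<Sum>j\<in>{..<Suc n}. \<rho> i j * v k j) = complex_of_real (p k) * v k i"
    if "k \<in> {..<Suc n}" "i \<in> {..<Suc n}" for k i
    using that Re0[of i] Ru[of _ i] zr
    by (cases k) (auto simp: v_def p_def R_def[symmetric] simp del: sum.lessThan_Suc)
  then have "diag_on {..<Suc n} \<rho> {..<Suc n} p v"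
    by (intro diag_onI_eigenvectors[OF ov orthonormal_on_nat_complete[OF ov]]) auto
  then show ?case by blast
qed

lemma spectral_theorem:
  assumes "finite I" "hermitian_on I \<rho>"
  obtains p v where "diag_on I \<rho> I p v" "complete_on I I v"
proof -
  obtain h where h: "bij_betw h {..<card I} I"
    using ex_bij_betw_nat_finite[OF assms(1)] by (auto simp: atLeast0LessThan)
  define g where "g = the_inv_into {..<card I} h"
  have g: "bij_betw g I {..<card I}" unfolding g_def by (rule bij_betw_the_inv_into[OF h])
  have gm: "g i < card I" if "i \<in> I" for i using bij_betwE[OF g] that by auto
  have hm: "h k \<in> I" if "k < card I" for k using bij_betwE[OF h] that by auto
  have hg: "h (g i) = i" if "i \<in> I" for i
    unfolding g_def using h that by (intro f_the_inv_into_f) (auto simp: bij_betw_def)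
  have inj: "g i = g j \<longleftrightarrow> i = j" if "i \<in> I" "j \<in> I" for i j using hg that by metis
  have "hermitian_on {..<card I} (\<lambda>k l. \<rho> (h k) (h l))"
    using assms(2) hm unfolding hermitian_on_def by blast
  then obtain q w where w: "diag_on {..<card I} (\<lambda>k l. \<rho> (h k) (h l)) {..<card I} q w"
    using spectral_theorem_nat by blast
  have ow: "orthonormal_on {..<card I} {..<card I} w" using w by (simp add: diag_on_def)
  note cw = orthonormal_on_nat_complete[OF ow]
  define v where "v k i = w (g k) (g i)" for k i
  have re: "(\<Sum>i\<in>I. f (g i)) = (\<Sum>k<card I. f k)" for f :: "nat \<Rightarrow> complex"
    using sum.reindex_bij_betw[OF g] by simp
  have "complete_on I I v"
    unfolding complete_on_def v_def
  proof (intro ballI)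
    fix i j assume ij: "i \<in> I" "j \<in> I"
    show "(\<Sum>k\<in>I. w (g k) (g i) * cnj (w (g k) (g j))) = of_bool (i = j)"
      using re[of "\<lambda>k. w k (g i) * cnj (w k (g j))"] complete_onD[OF cw, of "g i" "g j"] gm ij inj by auto
  qed
  moreover have "diag_on I \<rho> I (\<lambda>k. q (g k)) v"
    unfolding diag_on_def
  proof (intro conjI ballI)
    show "orthonormal_on I I v"
      unfolding orthonormal_on_def v_def
    proof (intro ballI)
      fix k l assume kl: "k \<in> I" "l \<in> I"
      show "(\<Sum>i\<in>I. cnj (w (g k) (g i)) * w (g l) (g i)) = of_bool (k = l)"
        using re[of "\<lambda>i. cnj (w (g k) i) * w (g l) i"] orthonormal_onD[OF ow, of "g k" "g l"] gm kl inj
        by auto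
    qed
  next
    fix i j assume ij: "i \<in> I" "j \<in> I"
    have "\<rho> i j = \<rho> (h (g i)) (h (g j))" using hg ij by simp
    also have "\<dots> = (\<Sum>k<card I. complex_of_real (q k) * w k (g i) * cnj (w k (g j)))"
      using diag_onD[OF w, of "g i" "g j"] gm ij by auto
    finally show "\<rho> i j = (\<Sum>k\<in>I. complex_of_real (q (g k)) * v k i * cnj (v k j))"
      unfolding v_def using re[of "\<lambda>k. complex_of_real (q k) * w k (g i) * cnj (w k (g j))"] by simp
  qed
  ultimately show thesis using that by blast
qed

section \<open>Positive semidefinite operators and entropy\<close>

lemma diag_on_eigenvector_left:
  assumes "diag_on I \<rho> K p v" "finite K" "k \<in> K" "j \<in> I"
  shows "(\<Sum>i\<in>I. cnj (v k i) * \<rho> i j) = complex_of_real (p k) * cnj (v k j)"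
proof -
  have o: "orthonormal_on I K v" using assms by (simp add: diag_on_def)
  have "(\<Sum>i\<in>I. cnj (v k i) * \<rho> i j) = (\<Sum>i\<in>I. cnj (v k i) * (\<Sum>l\<in>K. (complex_of_real (p l) * cnj (v l j)) * v l i))"
    using assms by (intro sum.cong) (auto simp: diag_onD mult_ac)
  also have "\<dots> = complex_of_real (p k) * cnj (v k j)"
    by (rule orthonormal_on_sum[OF o assms(2,3)])
  finally show ?thesis .
qed

lemma diag_on_form:
  assumes "diag_on I \<rho> K p v"
  shows "(\<Sum>i\<in>I. \<Sum>j\<in>I. cnj (u i) * \<rho> i j * w j)
       = (\<Sum>k\<in>K. complex_of_real (p k) * (cnj (\<Sum>i\<in>I. cnj (v k i) * u i) * (\<Sum>i\<in>I. cnj (v k i) * w i)))"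
proof -
  have "(\<Sum>i\<in>I. \<Sum>j\<in>I. cnj (u i) * \<rho> i j * w j)
      = (\<Sum>i\<in>I. \<Sum>j\<in>I. \<Sum>k\<in>K. complex_of_real (p k) * ((v k i * cnj (u i)) * (cnj (v k j) * w j)))"
    using assms by (intro sum.cong refl) (simp add: diag_onD sum_distrib_left sum_distrib_right mult_ac)
  also have "\<dots> = (\<Sum>k\<in>K. \<Sum>i\<in>I. \<Sum>j\<in>I. complex_of_real (p k) * ((v k i * cnj (u i)) * (cnj (v k j) * w j)))"
    by (subst (2) sum.swap, subst (1) sum.swap, rule refl)
  also have "\<dots> = (\<Sum>k\<in>K. complex_of_real (p k) * ((\<Sum>i\<in>I. v k i * cnj (u i)) * (\<Sum>j\<in>I. cnj (v k j) * w j)))"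
    unfolding sum_product by (simp add: sum_distrib_left)
  finally show ?thesis by (simp add: cnj_sum)
qed

lemma cnj_mult_self: "cnj z * z = complex_of_real ((cmod z)\<^sup>2)"
  by (metis complex_norm_square mult.commute)

lemma diag_on_quadratic_form:
  assumes "diag_on I \<rho> K p v"
  shows "(\<Sum>i\<in>I. \<Sum>j\<in>I. cnj (u i) * \<rho> i j * u j)
       = complex_of_real (\<Sum>k\<in>K. p k * (cmod (\<Sum>i\<in>I. cnj (v k i) * u i))\<^sup>2)"
  unfolding diag_on_form[OF assms] cnj_mult_self by simp

text \<open>Sandwiching \<open>\<rho>\<close> between the two eigenvectors and evaluating to the
  left and to the right gives \<open>p k\<close> and \<open>q l\<close> times the same
  overlap.\<close>

lemma diag_on_overlap:
  assumes v: "diag_on I \<rho> K p v" "finite K" and w: "diag_on I \<rho> L q w" "finite L" and k: "k \<in> K" and l: "l \<in> L"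
  shows "p k = q l \<or> (\<Sum>i\<in>I. cnj (v k i) * w l i) = 0"
proof -
  define W where "W = (\<Sum>i\<in>I. cnj (v k i) * w l i)"
  have "complex_of_real (p k) * W = (\<Sum>j\<in>I. (\<Sum>i\<in>I. cnj (v k i) * \<rho> i j) * w l j)"
    using diag_on_eigenvector_left[OF v k] by (simp add: W_def sum_distrib_left mult_ac)
  also have "\<dots> = (\<Sum>i\<in>I. cnj (v k i) * (\<Sum>j\<in>I. \<rho> i j * w l j))"
    by (simp add: sum_distrib_left sum_distrib_right mult_ac, rule sum.swap)
  also have "\<dots> = complex_of_real (q l) * W"
    using diag_on_eigenvector[OF w l] by (simp add: W_def sum_distrib_left mult_ac)
  finally show ?thesis by (auto simp: W_def)
qed

text \<open>A vector \<open>v k\<close> with nonzero eigenvalue lies in the span of the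
  \<open>w l\<close>, so its squared overlaps with them sum to 1. One with eigenvalue 0 may stick
  out of that span, which \<open>f 0 = 0\<close> makes harmless.\<close>

lemma diag_on_spectral_sum_expand:
  fixes f :: "real \<Rightarrow> real"
  assumes v: "diag_on I \<rho> K p v" "finite K" and w: "diag_on I \<rho> L q w" "finite L" and f: "f 0 = 0"
  shows "(\<Sum>k\<in>K. f (p k)) = (\<Sum>k\<in>K. \<Sum>l\<in>L. f (q l) * (cmod (\<Sum>i\<in>I. cnj (v k i) * w l i))\<^sup>2)"
proof (intro sum.cong refl)
  fix k assume k: "k \<in> K"
  define W where "W l = (\<Sum>i\<in>I. cnj (v k i) * w l i)" for l
  have ov: "orthonormal_on I K v" using v by (simp add: diag_on_def)
  have eq: "p k = q l \<or> W l = 0" if "l \<in> L" for l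
    unfolding W_def by (rule diag_on_overlap[OF v w k that])
  have "complex_of_real (p k) = (\<Sum>j\<in>I. (\<Sum>i\<in>I. cnj (v k i) * \<rho> i j) * v k j)"
    using diag_on_eigenvector_left[OF v k] orthonormal_onD[OF ov k k]
    by (simp add: sum_distrib_left[symmetric] mult.assoc)
  also have "\<dots> = (\<Sum>i\<in>I. \<Sum>j\<in>I. cnj (v k i) * \<rho> i j * v k j)"
    by (subst sum.swap) (simp add: sum_distrib_right)
  also have "\<dots> = complex_of_real (\<Sum>l\<in>L. q l * (cmod (\<Sum>i\<in>I. cnj (w l i) * v k i))\<^sup>2)"
    by (rule diag_on_quadratic_form[OF w(1)])
  also have "(\<Sum>l\<in>L. q l * (cmod (\<Sum>i\<in>I. cnj (w l i) * v k i))\<^sup>2) = (\<Sum>l\<in>L. p k * (cmod (W l))\<^sup>2)"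
  proof (intro sum.cong refl)
    fix l assume l: "l \<in> L"
    have "(\<Sum>i\<in>I. cnj (w l i) * v k i) = cnj (W l)"
      by (simp add: W_def cnj_sum mult.commute)
    then show "q l * (cmod (\<Sum>i\<in>I. cnj (w l i) * v k i))\<^sup>2 = p k * (cmod (W l))\<^sup>2"
      using eq[OF l] by auto
  qed
  finally have "p k = p k * (\<Sum>l\<in>L. (cmod (W l))\<^sup>2)"
    by (simp only: of_real_eq_iff sum_distrib_left)
  then have "p k = 0 \<or> (\<Sum>l\<in>L. (cmod (W l))\<^sup>2) = 1" by simp
  then have "f (p k) = (\<Sum>l\<in>L. f (p k) * (cmod (W l))\<^sup>2)"
    unfolding sum_distrib_left[symmetric] using f by auto
  also have "\<dots> = (\<Sum>l\<in>L. f (q l) * (cmod (W l))\<^sup>2)"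
  proof (intro sum.cong refl)
    fix l assume "l \<in> L"
    from eq[OF this] show "f (p k) * (cmod (W l))\<^sup>2 = f (q l) * (cmod (W l))\<^sup>2" by auto
  qed
  finally show "f (p k) = (\<Sum>l\<in>L. f (q l) * (cmod (\<Sum>i\<in>I. cnj (v k i) * w l i))\<^sup>2)"
    by (simp add: W_def)
qed

text \<open>Both sums equal one double sum over squared overlaps, because
  \<open>f (p k) = f (q l)\<close> wherever the overlap is nonzero. This makes entropy and trace
  norm independent of the chosen decomposition.\<close>

lemma diag_on_spectral_sum_unique:
  fixes f :: "real \<Rightarrow> real"
  assumes v: "diag_on I \<rho> K p v" "finite K" and w: "diag_on I \<rho> L q w" "finite L" and f: "f 0 = 0"
  shows "(\<Sum>k\<in>K. f (p k)) = (\<Sum>l\<in>L. f (q l))"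
proof -
  have sy: "cmod (\<Sum>i\<in>I. cnj (v k i) * w l i) = cmod (\<Sum>i\<in>I. cnj (w l i) * v k i)" for k l
    by (subst complex_mod_cnj[symmetric]) (simp add: cnj_sum mult.commute)
  have "(\<Sum>l\<in>L. f (q l)) = (\<Sum>l\<in>L. \<Sum>k\<in>K. f (p k) * (cmod (\<Sum>i\<in>I. cnj (w l i) * v k i))\<^sup>2)"
    by (rule diag_on_spectral_sum_expand[where f=f, OF w v f])
  also have "\<dots> = (\<Sum>k\<in>K. \<Sum>l\<in>L. f (p k) * (cmod (\<Sum>i\<in>I. cnj (v k i) * w l i))\<^sup>2)"
    by (subst sum.swap) (simp add: sy)
  also have "\<dots> = (\<Sum>k\<in>K. \<Sum>l\<in>L. f (q l) * (cmod (\<Sum>i\<in>I. cnj (v k i) * w l i))\<^sup>2)"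
  proof (intro sum.cong refl)
    fix k l assume k: "k \<in> K" and l: "l \<in> L"
    show "f (p k) * (cmod (\<Sum>i\<in>I. cnj (v k i) * w l i))\<^sup>2 = f (q l) * (cmod (\<Sum>i\<in>I. cnj (v k i) * w l i))\<^sup>2"
      using diag_on_overlap[OF v w k l] by auto
  qed
  also have "\<dots> = (\<Sum>k\<in>K. f (p k))"
    by (rule diag_on_spectral_sum_expand[where f=f, OF v w f, symmetric])
  finally show ?thesis ..
qed

text \<open>The natural logarithm is used here; \<open>entropy\<close> is \<open>ent\<close> divided by \<open>ln 2\<close>.\<close>

definition ent :: "'a set \<Rightarrow> ('a \<Rightarrow> 'a \<Rightarrow> complex) \<Rightarrow> real" where
  "ent I \<rho> = (SOME s. \<exists>(K :: nat set) p v. finite K \<and> diag_on I \<rho> K p v \<and> s = (\<Sum>k\<in>K. - (p k * ln (p k))))"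

text \<open>A constant cannot quantify over types, so \<open>ent\<close> chooses among
  decompositions indexed by \<open>nat\<close>; this lemma brings any other finite index set into
  that form.\<close>

lemma diag_on_reindex_eigenvalues:
  assumes "diag_on I \<rho> K p v" "bij_betw h L K"
  shows "diag_on I \<rho> L (\<lambda>l. p (h l)) (\<lambda>l. v (h l))"
proof -
  have h: "h l \<in> K" if "l \<in> L" for l using bij_betwE[OF assms(2)] that by auto
  have inj: "h k = h l \<longleftrightarrow> k = l" if "k \<in> L" "l \<in> L" for k l
    using assms(2) that by (auto simp: bij_betw_def inj_on_eq_iff)
  show ?thesis
    unfolding diag_on_def orthonormal_on_def
  proof (intro conjI ballI)
    fix k l assume "k \<in> L" "l \<in> L"
    then show "(\<Sum>i\<in>I. cnj (v (h k) i) * v (h l) i) = of_bool (k = l)"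
      using assms(1) h inj by (auto simp: diag_on_def orthonormal_on_def)
  next
    fix i j assume "i \<in> I" "j \<in> I"
    then have "\<rho> i j = (\<Sum>k\<in>K. complex_of_real (p k) * v k i * cnj (v k j))"
      using assms(1) by (simp add: diag_onD)
    also have "\<dots> = (\<Sum>l\<in>L. complex_of_real (p (h l)) * v (h l) i * cnj (v (h l) j))"
      using sum.reindex_bij_betw[OF assms(2), of "\<lambda>k. complex_of_real (p k) * v k i * cnj (v k j)"] by simp
    finally show "\<rho> i j = \<dots>" .
  qed
qed

lemma ent_eq:
  assumes "diag_on I \<rho> K p v" "finite K"
  shows "ent I \<rho> = (\<Sum>k\<in>K. - (p k * ln (p k)))"
  unfolding ent_def
proof (rule some_equality)
  obtain h where h: "bij_betw h {..<card K} K"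
    using ex_bij_betw_nat_finite[OF assms(2)] by (auto simp: atLeast0LessThan)
  have "(\<Sum>k\<in>K. - (p k * ln (p k))) = (\<Sum>l<card K. - (p (h l) * ln (p (h l))))"
    using sum.reindex_bij_betw[OF h, of "\<lambda>k. - (p k * ln (p k))"] by simp
  then show "\<exists>(L :: nat set) q w. finite L \<and> diag_on I \<rho> L q w
      \<and> (\<Sum>k\<in>K. - (p k * ln (p k))) = (\<Sum>k\<in>L. - (q k * ln (q k)))"
    using diag_on_reindex_eigenvalues[OF assms(1) h] by blast
next
  fix s assume "\<exists>(L :: nat set) q w. finite L \<and> diag_on I \<rho> L q w \<and> s = (\<Sum>k\<in>L. - (q k * ln (q k)))"
  then obtain L :: "nat set" and q w where "finite L" "diag_on I \<rho> L q w" "s = (\<Sum>k\<in>L. - (q k * ln (q k)))"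
    by blast
  then show "s = (\<Sum>k\<in>K. - (p k * ln (p k)))"
    using diag_on_spectral_sum_unique[OF _ _ assms, of L q w "\<lambda>x. - (x * ln x)"] by simp
qed

lemma diag_on_cong:
  assumes "\<And>i j. i \<in> I \<Longrightarrow> j \<in> I \<Longrightarrow> \<rho> i j = \<sigma> i j"
  shows "diag_on I \<rho> K p v \<longleftrightarrow> diag_on I \<sigma> K p v"
  using assms by (simp add: diag_on_def)

lemma ent_cong:
  assumes "\<And>i j. i \<in> I \<Longrightarrow> j \<in> I \<Longrightarrow> \<rho> i j = \<sigma> i j"
  shows "ent I \<rho> = ent I \<sigma>"
proof -
  have "diag_on I \<rho> K p v = diag_on I \<sigma> K p v" for K :: "nat set" and p v
    using diag_on_cong[of I \<rho> \<sigma> K p v] assms by blast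
  then show ?thesis by (simp add: ent_def)
qed

text \<open>A Gram decomposition instead of a quadratic form: closure under sums, restriction,
  conjugation and tensor products then amounts to writing down the new vectors. The index type is
  fixed to \<open>nat\<close>, and \<open>psd_onI\<close> accepts any finite index set.\<close>

definition psd_on :: "'a set \<Rightarrow> ('a \<Rightarrow> 'a \<Rightarrow> complex) \<Rightarrow> bool" where
  "psd_on I \<rho> \<longleftrightarrow>
     (\<exists>(K :: nat set) v. finite K \<and> (\<forall>i\<in>I. \<forall>j\<in>I. \<rho> i j = (\<Sum>k\<in>K. v k i * cnj (v k j))))"

lemma psd_onI:
  assumes "finite K" "\<And>i j. i \<in> I \<Longrightarrow> j \<in> I \<Longrightarrow> \<rho> i j = (\<Sum>k\<in>K. v k i * cnj (v k j))"
  shows "psd_on I \<rho>"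
proof -
  obtain h where h: "bij_betw h {..<card K} K"
    using ex_bij_betw_nat_finite[OF assms(1)] by (auto simp: atLeast0LessThan)
  have "\<rho> i j = (\<Sum>k<card K. v (h k) i * cnj (v (h k) j))" if "i \<in> I" "j \<in> I" for i j
    using assms(2)[OF that] sum.reindex_bij_betw[OF h, of "\<lambda>k. v k i * cnj (v k j)"] by simp
  then show ?thesis unfolding psd_on_def by (intro exI[of _ "{..<card K}"] exI[of _ "\<lambda>k. v (h k)"]) auto
qed

lemma psd_onE:
  assumes "psd_on I \<rho>"
  obtains K :: "nat set" and v where "finite K" "\<And>i j. i \<in> I \<Longrightarrow> j \<in> I \<Longrightarrow> \<rho> i j = (\<Sum>k\<in>K. v k i * cnj (v k j))"
  using assms unfolding psd_on_def by blast

lemma psd_on_hermitian: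
  assumes "psd_on I \<rho>"
  shows "hermitian_on I \<rho>"
proof -
  obtain K :: "nat set" and v where "finite K"
    and v: "\<And>i j. i \<in> I \<Longrightarrow> j \<in> I \<Longrightarrow> \<rho> i j = (\<Sum>k\<in>K. v k i * cnj (v k j))"
    using psd_onE[OF assms] by metis
  show ?thesis
    unfolding hermitian_on_def
  proof (intro ballI)
    fix i j assume "i \<in> I" "j \<in> I"
    then show "\<rho> j i = cnj (\<rho> i j)"
      unfolding v[OF \<open>i \<in> I\<close> \<open>j \<in> I\<close>] v[OF \<open>j \<in> I\<close> \<open>i \<in> I\<close>] by (simp add: mult.commute)
  qed
qed

lemma gram_quadratic_form:
  assumes "\<And>i j. i \<in> I \<Longrightarrow> j \<in> I \<Longrightarrow> \<rho> i j = (\<Sum>k\<in>K. v k i * cnj (v k j))"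
  shows "(\<Sum>i\<in>I. \<Sum>j\<in>I. cnj (u i) * \<rho> i j * u j)
       = complex_of_real (\<Sum>k\<in>K. (cmod (\<Sum>i\<in>I. cnj (v k i) * u i))\<^sup>2)"
proof -
  have "(\<Sum>i\<in>I. \<Sum>j\<in>I. cnj (u i) * \<rho> i j * u j)
      = (\<Sum>i\<in>I. \<Sum>j\<in>I. \<Sum>k\<in>K. (v k i * cnj (u i)) * (cnj (v k j) * u j))"
    using assms by (intro sum.cong refl) (simp add: sum_distrib_left sum_distrib_right mult_ac)
  also have "\<dots> = (\<Sum>k\<in>K. \<Sum>i\<in>I. \<Sum>j\<in>I. (v k i * cnj (u i)) * (cnj (v k j) * u j))"
    by (subst (2) sum.swap, subst (1) sum.swap, rule refl)
  also have "\<dots> = (\<Sum>k\<in>K. cnj (\<Sum>i\<in>I. cnj (v k i) * u i) * (\<Sum>j\<in>I. cnj (v k j) * u j))"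
    by (simp add: sum_product cnj_sum)
  finally show ?thesis by (simp only: cnj_mult_self of_real_sum)
qed

lemma psd_on_form_nonneg:
  assumes "psd_on I \<rho>"
  shows "0 \<le> Re (\<Sum>i\<in>I. \<Sum>j\<in>I. cnj (u i) * \<rho> i j * u j)"
proof -
  obtain K :: "nat set" and v where "finite K"
    and v: "\<And>i j. i \<in> I \<Longrightarrow> j \<in> I \<Longrightarrow> \<rho> i j = (\<Sum>k\<in>K. v k i * cnj (v k j))"
    using psd_onE[OF assms] by metis
  have "Re (\<Sum>i\<in>I. \<Sum>j\<in>I. cnj (u i) * \<rho> i j * u j) = (\<Sum>k\<in>K. (cmod (\<Sum>i\<in>I. cnj (v k i) * u i))\<^sup>2)"
    by (subst gram_quadratic_form[where v=v and K=K]) (simp_all add: v)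
  then show ?thesis by (simp only: sum_nonneg zero_le_power2)
qed

lemma psd_on_spectral:
  assumes "finite I" "psd_on I \<rho>"
  obtains p v where "diag_on I \<rho> I p v" "complete_on I I v" "\<And>k. k \<in> I \<Longrightarrow> 0 \<le> p k"
proof -
  obtain p v where v: "diag_on I \<rho> I p v" "complete_on I I v"
    using spectral_theorem[OF assms(1) psd_on_hermitian[OF assms(2)]] by blast
  have o: "orthonormal_on I I v" using v by (simp add: diag_on_def)
  have "0 \<le> p k" if k: "k \<in> I" for k
  proof -
    have "(\<Sum>i\<in>I. \<Sum>j\<in>I. cnj (v k i) * \<rho> i j * v k j) = (\<Sum>i\<in>I. cnj (v k i) * (\<Sum>j\<in>I. \<rho> i j * v k j))"
      by (simp add: sum_distrib_left mult_ac)
    also have "\<dots> = complex_of_real (p k) * (\<Sum>i\<in>I. cnj (v k i) * v k i)"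
      using diag_on_eigenvector[OF v(1) assms(1) k] by (simp add: sum_distrib_left mult_ac)
    also have "\<dots> = complex_of_real (p k)" using orthonormal_onD[OF o k k] by simp
    finally show ?thesis using psd_on_form_nonneg[OF assms(2), of "v k"] by simp
  qed
  with v that show thesis by blast
qed

lemma psd_onI_diag:
  assumes "diag_on I \<rho> K p v" "finite K" "\<And>k. k \<in> K \<Longrightarrow> 0 \<le> p k"
  shows "psd_on I \<rho>"
proof (rule psd_onI[OF assms(2), where v="\<lambda>k i. complex_of_real (sqrt (p k)) * v k i"])
  fix i j assume "i \<in> I" "j \<in> I"
  then have "\<rho> i j = (\<Sum>k\<in>K. complex_of_real (p k) * v k i * cnj (v k j))"
    using assms(1) by (simp add: diag_onD)
  also have "\<dots> = (\<Sum>k\<in>K. (complex_of_real (sqrt (p k)) * v k i) * cnj (complex_of_real (sqrt (p k)) * v k j))"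
  proof (intro sum.cong refl)
    fix k assume "k \<in> K"
    then have "complex_of_real (p k) = complex_of_real (sqrt (p k)) * complex_of_real (sqrt (p k))"
      using assms(3) by (simp flip: of_real_mult)
    then show "complex_of_real (p k) * v k i * cnj (v k j)
      = (complex_of_real (sqrt (p k)) * v k i) * cnj (complex_of_real (sqrt (p k)) * v k j)" by simp
  qed
  finally show "\<rho> i j = \<dots>" .
qed

lemma psd_on_cong:
  assumes "\<And>i j. i \<in> I \<Longrightarrow> j \<in> I \<Longrightarrow> \<rho> i j = \<sigma> i j"
  shows "psd_on I \<rho> \<longleftrightarrow> psd_on I \<sigma>"
  unfolding psd_on_def using assms by simp

lemma psd_on_reindex:
  assumes "psd_on I \<rho>" "\<And>j. j \<in> J \<Longrightarrow> h j \<in> I"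
  shows "psd_on J (\<lambda>x y. \<rho> (h x) (h y))"
proof -
  obtain K :: "nat set" and v where "finite K"
    and v: "\<And>i j. i \<in> I \<Longrightarrow> j \<in> I \<Longrightarrow> \<rho> i j = (\<Sum>k\<in>K. v k i * cnj (v k j))"
    using psd_onE[OF assms(1)] by metis
  then show ?thesis using assms(2) by (intro psd_onI[of K _ _ "\<lambda>k x. v k (h x)"]) auto
qed

lemma psd_on_family:
  fixes I :: "'m \<Rightarrow> 'a set"
  assumes "\<And>m. m \<in> M \<Longrightarrow> psd_on (I m) (\<rho> m)"
  shows "\<exists>f :: 'm \<Rightarrow> nat set \<times> (nat \<Rightarrow> 'a \<Rightarrow> complex). \<forall>m\<in>M. finite (fst (f m)) \<and>
      (\<forall>i\<in>I m. \<forall>j\<in>I m. \<rho> m i j = (\<Sum>k\<in>fst (f m). snd (f m) k i * cnj (snd (f m) k j)))"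
proof -
  define P where "P m Kv \<longleftrightarrow> finite (fst Kv) \<and>
      (\<forall>i\<in>I m. \<forall>j\<in>I m. \<rho> m i j = (\<Sum>k\<in>fst Kv. snd Kv k i * cnj (snd Kv k j)))"
    for m :: 'm and Kv :: "nat set \<times> (nat \<Rightarrow> 'a \<Rightarrow> complex)"
  have "\<forall>m\<in>M. \<exists>Kv. P m Kv"
  proof
    fix m assume "m \<in> M"
    then obtain K :: "nat set" and v where "finite K"
      "\<forall>i\<in>I m. \<forall>j\<in>I m. \<rho> m i j = (\<Sum>k\<in>K. v k i * cnj (v k j))"
      using assms unfolding psd_on_def by blast
    then have "P m (K, v)" by (simp add: P_def)
    then show "\<exists>Kv. P m Kv" ..
  qed
  then show ?thesis unfolding P_def by (rule bchoice)
qed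

lemma psd_on_sum:
  assumes "finite M" "\<And>m. m \<in> M \<Longrightarrow> psd_on I (\<rho> m)"
  shows "psd_on I (\<lambda>i j. \<Sum>m\<in>M. \<rho> m i j)"
proof -
  obtain f :: "_ \<Rightarrow> nat set \<times> (nat \<Rightarrow> _ \<Rightarrow> complex)" where f: "\<forall>m\<in>M. finite (fst (f m)) \<and>
      (\<forall>i\<in>I. \<forall>j\<in>I. \<rho> m i j = (\<Sum>k\<in>fst (f m). snd (f m) k i * cnj (snd (f m) k j)))"
    using psd_on_family[where M=M and I="\<lambda>_. I" and \<rho>=\<rho>, OF assms(2)] by blast
  define K where "K m = fst (f m)" for m
  define v where "v m = snd (f m)" for m
  have K: "\<And>m. m \<in> M \<Longrightarrow> finite (K m)"
    and v: "\<And>m i j. m \<in> M \<Longrightarrow> i \<in> I \<Longrightarrow> j \<in> I \<Longrightarrow> \<rho> m i j = (\<Sum>k\<in>K m. v m k i * cnj (v m k j))"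
    using f unfolding K_def v_def by blast+
  show ?thesis
    by (rule psd_onI[of "Sigma M K" _ _ "\<lambda>(m, k). v m k"])
      (use assms(1) K v in \<open>auto simp: sum.Sigma split_def\<close>)
qed

lemma psd_on_conj:
  assumes "psd_on I \<rho>"
  shows "psd_on J (\<lambda>x y. \<Sum>i\<in>I. \<Sum>j\<in>I. N x i * \<rho> i j * cnj (N y j))"
proof -
  obtain K :: "nat set" and v where K: "finite K"
    and v: "\<And>i j. i \<in> I \<Longrightarrow> j \<in> I \<Longrightarrow> \<rho> i j = (\<Sum>k\<in>K. v k i * cnj (v k j))"
    using psd_onE[OF assms(1)] by metis
  show ?thesis
  proof (rule psd_onI[OF K, of _ _ "\<lambda>k x. \<Sum>i\<in>I. N x i * v k i"])
    fix x y
    have "(\<Sum>i\<in>I. \<Sum>j\<in>I. N x i * \<rho> i j * cnj (N y j))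
        = (\<Sum>i\<in>I. \<Sum>j\<in>I. \<Sum>k\<in>K. (N x i * v k i) * cnj (N y j * v k j))"
      by (intro sum.cong refl) (simp add: v sum_distrib_left sum_distrib_right mult_ac)
    also have "\<dots> = (\<Sum>k\<in>K. \<Sum>i\<in>I. \<Sum>j\<in>I. (N x i * v k i) * cnj (N y j * v k j))"
      by (subst (2) sum.swap, subst (1) sum.swap, rule refl)
    also have "\<dots> = (\<Sum>k\<in>K. (\<Sum>i\<in>I. N x i * v k i) * cnj (\<Sum>i\<in>I. N y i * v k i))"
      by (simp add: sum_product cnj_sum)
    finally show "(\<Sum>i\<in>I. \<Sum>j\<in>I. N x i * \<rho> i j * cnj (N y j)) = \<dots>" .
  qed
qed

definition ptr :: "'a set \<Rightarrow> ('a \<times> 'b \<Rightarrow> 'a \<times> 'b \<Rightarrow> complex) \<Rightarrow> 'b \<Rightarrow> 'b \<Rightarrow> complex" where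
  "ptr I \<rho> = (\<lambda>x y. \<Sum>i\<in>I. \<rho> (i, x) (i, y))"

lemma psd_on_ptr:
  assumes "finite I" "psd_on (I \<times> J) \<rho>"
  shows "psd_on J (ptr I \<rho>)"
proof -
  have "psd_on J (\<lambda>x y. \<rho> (i, x) (i, y))" if "i \<in> I" for i
    using psd_on_reindex[OF assms(2), of J "\<lambda>x. (i, x)"] that by auto
  then show ?thesis
    unfolding ptr_def using psd_on_sum[of I J "\<lambda>i x y. \<rho> (i, x) (i, y)"] assms(1) by blast
qed

definition otr :: "'a set \<Rightarrow> ('a \<Rightarrow> 'a \<Rightarrow> complex) \<Rightarrow> real" where
  "otr I \<rho> = (\<Sum>i\<in>I. Re (\<rho> i i))"

lemma otr_diag:
  assumes "diag_on I \<rho> K p v"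
  shows "otr I \<rho> = (\<Sum>k\<in>K. p k)"
proof -
  have o: "orthonormal_on I K v" using assms by (simp add: diag_on_def)
  have "(\<Sum>i\<in>I. \<rho> i i) = (\<Sum>i\<in>I. \<Sum>k\<in>K. complex_of_real (p k) * (cnj (v k i) * v k i))"
    using assms by (intro sum.cong refl) (simp add: diag_onD mult_ac)
  also have "\<dots> = (\<Sum>k\<in>K. complex_of_real (p k) * (\<Sum>i\<in>I. cnj (v k i) * v k i))"
    by (subst sum.swap) (simp add: sum_distrib_left)
  also have "\<dots> = complex_of_real (\<Sum>k\<in>K. p k)"
    using orthonormal_onD[OF o] by simp
  finally have "Re (\<Sum>i\<in>I. \<rho> i i) = (\<Sum>k\<in>K. p k)" by (metis Re_complex_of_real)
  then show ?thesis by (simp add: otr_def)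
qed

section \<open>Entropy under relabelling, isometries, tensor products, direct sums and
  purification\<close>

lemma ent_reindex:
  assumes "finite I" "psd_on I \<rho>" "bij_betw h J I"
  shows "ent J (\<lambda>x y. \<rho> (h x) (h y)) = ent I \<rho>"
proof -
  obtain p v where v: "diag_on I \<rho> I p v"
    using psd_on_spectral[OF assms(1,2)] by blast
  have h: "h j \<in> I" if "j \<in> J" for j using bij_betwE[OF assms(3)] that by auto
  have "(\<Sum>x\<in>J. cnj (v k (h x)) * v l (h x)) = (\<Sum>i\<in>I. cnj (v k i) * v l i)" for k l
    using sum.reindex_bij_betw[OF assms(3), of "\<lambda>i. cnj (v k i) * v l i"] by simp
  then have "diag_on J (\<lambda>x y. \<rho> (h x) (h y)) I p (\<lambda>k x. v k (h x))"
    using v h by (auto simp: diag_on_def orthonormal_on_def)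
  from ent_eq[OF this] ent_eq[OF v] assms(1) show ?thesis by simp
qed

lemma sum_Times: "(\<Sum>x\<in>A \<times> B. f x) = (\<Sum>a\<in>A. \<Sum>b\<in>B. f (a, b))"
  by (simp add: sum.cartesian_product)

lemma sum_Sigma:
  "finite A \<Longrightarrow> (\<And>a. a \<in> A \<Longrightarrow> finite (B a)) \<Longrightarrow> (\<Sum>x\<in>Sigma A B. f x) = (\<Sum>a\<in>A. \<Sum>b\<in>B a. f (a, b))"
  by (simp add: sum.Sigma)

text \<open>The isometry carries eigenvectors to orthonormal vectors with the same eigenvalues.
  These need not span the larger space, which is why \<open>diag_on\<close> allows incomplete
  eigenbases.\<close>

lemma ent_isometry:
  assumes fin: "finite A" "finite Y" "finite Z" and psd: "psd_on (A \<times> Y) \<rho>"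
    and iso: "\<And>a b. a \<in> A \<Longrightarrow> b \<in> A \<Longrightarrow> (\<Sum>z\<in>Z. cnj (N z a) * N z b) = of_bool (a = b)"
  shows "ent (Z \<times> Y) (\<lambda>x y. \<Sum>a\<in>A. \<Sum>b\<in>A. N (fst x) a * \<rho> (a, snd x) (b, snd y) * cnj (N (fst y) b))
       = ent (A \<times> Y) \<rho>"
proof -
  have fAY: "finite (A \<times> Y)" using fin by simp
  obtain p v where v: "diag_on (A \<times> Y) \<rho> (A \<times> Y) p v"
    using psd_on_spectral[OF fAY psd] by blast
  have o: "orthonormal_on (A \<times> Y) (A \<times> Y) v" using v by (simp add: diag_on_def)
  define w where "w k x = (\<Sum>a\<in>A. N (fst x) a * v k (a, snd x))" for k x
  have "(\<Sum>x\<in>Z \<times> Y. cnj (w k x) * w l x) = (\<Sum>x\<in>A \<times> Y. cnj (v k x) * v l x)" for k l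
  proof -
    have "(\<Sum>x\<in>Z \<times> Y. cnj (w k x) * w l x)
        = (\<Sum>z\<in>Z. \<Sum>y\<in>Y. \<Sum>a\<in>A. \<Sum>b\<in>A. (cnj (N z a) * N z b) * (cnj (v k (a, y)) * v l (b, y)))"
      unfolding sum_Times w_def cnj_sum sum_product by (simp add: mult_ac)
    also have "\<dots> = (\<Sum>y\<in>Y. \<Sum>a\<in>A. \<Sum>b\<in>A. \<Sum>z\<in>Z. (cnj (N z a) * N z b) * (cnj (v k (a, y)) * v l (b, y)))"
      by (subst sum.swap, intro sum.cong refl, subst sum.swap, intro sum.cong refl, rule sum.swap)
    also have "\<dots> = (\<Sum>y\<in>Y. \<Sum>a\<in>A. \<Sum>b\<in>A. of_bool (a = b) * (cnj (v k (a, y)) * v l (b, y)))"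
      by (intro sum.cong refl) (simp add: iso sum_distrib_right[symmetric])
    also have "\<dots> = (\<Sum>y\<in>Y. \<Sum>a\<in>A. cnj (v k (a, y)) * v l (a, y))"
      using fin by (intro sum.cong refl) (simp add: sum_of_bool_left')
    also have "\<dots> = (\<Sum>x\<in>A \<times> Y. cnj (v k x) * v l x)"
      by (subst sum.swap) (simp add: sum_Times)
    finally show ?thesis .
  qed
  moreover have "(\<Sum>a\<in>A. \<Sum>b\<in>A. N (fst x) a * \<rho> (a, snd x) (b, snd y) * cnj (N (fst y) b))
      = (\<Sum>k\<in>A \<times> Y. complex_of_real (p k) * w k x * cnj (w k y))" if "x \<in> Z \<times> Y" "y \<in> Z \<times> Y" for x y
  proof -
    have "(\<Sum>a\<in>A. \<Sum>b\<in>A. N (fst x) a * \<rho> (a, snd x) (b, snd y) * cnj (N (fst y) b))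
        = (\<Sum>a\<in>A. \<Sum>b\<in>A. \<Sum>k\<in>A \<times> Y. complex_of_real (p k) * (N (fst x) a * v k (a, snd x)) * cnj (N (fst y) b * v k (b, snd y)))"
    proof (intro sum.cong refl)
      fix a b assume "a \<in> A" "b \<in> A"
      then have "\<rho> (a, snd x) (b, snd y) = (\<Sum>k\<in>A \<times> Y. complex_of_real (p k) * v k (a, snd x) * cnj (v k (b, snd y)))"
        using that by (intro diag_onD[OF v]) auto
      then show "N (fst x) a * \<rho> (a, snd x) (b, snd y) * cnj (N (fst y) b)
          = (\<Sum>k\<in>A \<times> Y. complex_of_real (p k) * (N (fst x) a * v k (a, snd x)) * cnj (N (fst y) b * v k (b, snd y)))"
        by (simp add: sum_distrib_left sum_distrib_right mult_ac)
    qed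
    also have "\<dots> = (\<Sum>k\<in>A \<times> Y. \<Sum>a\<in>A. \<Sum>b\<in>A. complex_of_real (p k) * (N (fst x) a * v k (a, snd x)) * cnj (N (fst y) b * v k (b, snd y)))"
      by (subst (2) sum.swap, subst (1) sum.swap, rule refl)
    also have "\<dots> = (\<Sum>k\<in>A \<times> Y. complex_of_real (p k) *
        (\<Sum>a\<in>A. \<Sum>b\<in>A. (N (fst x) a * v k (a, snd x)) * cnj (N (fst y) b * v k (b, snd y))))"
      by (simp add: sum_distrib_left mult.assoc)
    also have "\<dots> = (\<Sum>k\<in>A \<times> Y. complex_of_real (p k) * w k x * cnj (w k y))"
      unfolding mult.assoc[of "complex_of_real _"] w_def cnj_sum sum_product ..
    finally show ?thesis .
  qed
  ultimately have "diag_on (Z \<times> Y) (\<lambda>x y. \<Sum>a\<in>A. \<Sum>b\<in>A. N (fst x) a * \<rho> (a, snd x) (b, snd y) * cnj (N (fst y) b))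
      (A \<times> Y) p w"
    using o by (simp add: diag_on_def orthonormal_on_def)
  from ent_eq[OF this fAY] ent_eq[OF v fAY] show ?thesis by simp
qed

lemma psd_on_tensor:
  assumes "psd_on I \<rho>" "psd_on J \<sigma>"
  shows "psd_on (I \<times> J) (\<lambda>x y. \<rho> (fst x) (fst y) * \<sigma> (snd x) (snd y))"
proof -
  obtain K :: "nat set" and v where K: "finite K"
    and v: "\<And>i j. i \<in> I \<Longrightarrow> j \<in> I \<Longrightarrow> \<rho> i j = (\<Sum>k\<in>K. v k i * cnj (v k j))"
    using psd_onE[OF assms(1)] by metis
  obtain L :: "nat set" and w where L: "finite L"
    and w: "\<And>i j. i \<in> J \<Longrightarrow> j \<in> J \<Longrightarrow> \<sigma> i j = (\<Sum>k\<in>L. w k i * cnj (w k j))"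
    using psd_onE[OF assms(2)] by metis
  show ?thesis
    by (rule psd_onI[of "K \<times> L" _ _ "\<lambda>k x. v (fst k) (fst x) * w (snd k) (snd x)"])
      (use K L v w in \<open>auto simp: sum_Times sum_product mult_ac\<close>)
qed

lemma diag_on_tensor:
  assumes v: "diag_on I \<rho> K p v" and w: "diag_on J \<sigma> L q w"
  shows "diag_on (I \<times> J) (\<lambda>x y. \<rho> (fst x) (fst y) * \<sigma> (snd x) (snd y)) (K \<times> L)
      (\<lambda>k. p (fst k) * q (snd k)) (\<lambda>k x. v (fst k) (fst x) * w (snd k) (snd x))"
  unfolding diag_on_def orthonormal_on_def
proof (intro conjI ballI)
  fix k l assume kl: "k \<in> K \<times> L" "l \<in> K \<times> L"
  have "(\<Sum>x\<in>I \<times> J. cnj (v (fst k) (fst x) * w (snd k) (snd x)) * (v (fst l) (fst x) * w (snd l) (snd x)))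
      = (\<Sum>i\<in>I. cnj (v (fst k) i) * v (fst l) i) * (\<Sum>j\<in>J. cnj (w (snd k) j) * w (snd l) j)"
    by (simp add: sum_Times sum_product mult_ac)
  also have "\<dots> = of_bool (fst k = fst l) * of_bool (snd k = snd l)"
    using kl v w by (auto simp: diag_on_def orthonormal_on_def)
  finally show "(\<Sum>x\<in>I \<times> J. cnj (v (fst k) (fst x) * w (snd k) (snd x)) * (v (fst l) (fst x) * w (snd l) (snd x)))
      = of_bool (k = l)" by (auto simp: prod_eq_iff)
next
  fix x y assume "x \<in> I \<times> J" "y \<in> I \<times> J"
  then show "\<rho> (fst x) (fst y) * \<sigma> (snd x) (snd y) = (\<Sum>k\<in>K \<times> L. complex_of_real (p (fst k) * q (snd k)) *
      (v (fst k) (fst x) * w (snd k) (snd x)) * cnj (v (fst k) (fst y) * w (snd k) (snd y)))"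
    by (auto simp: sum_Times diag_onD[OF v] diag_onD[OF w] sum_product mult_ac)
qed

lemma complete_on_tensor:
  assumes "complete_on I K v" "complete_on J L w"
  shows "complete_on (I \<times> J) (K \<times> L) (\<lambda>k x. v (fst k) (fst x) * w (snd k) (snd x))"
  unfolding complete_on_def
proof (intro ballI)
  fix x y assume xy: "x \<in> I \<times> J" "y \<in> I \<times> J"
  have "(\<Sum>k\<in>K \<times> L. v (fst k) (fst x) * w (snd k) (snd x) * cnj (v (fst k) (fst y) * w (snd k) (snd y)))
      = (\<Sum>k\<in>K. v k (fst x) * cnj (v k (fst y))) * (\<Sum>l\<in>L. w l (snd x) * cnj (w l (snd y)))"
    by (simp add: sum_Times sum_product mult_ac)
  also have "\<dots> = of_bool (fst x = fst y) * of_bool (snd x = snd y)"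
    using xy assms by (auto simp: complete_on_def)
  finally show "(\<Sum>k\<in>K \<times> L. v (fst k) (fst x) * w (snd k) (snd x) * cnj (v (fst k) (fst y) * w (snd k) (snd y)))
      = of_bool (x = y)" by (auto simp: prod_eq_iff)
qed

text \<open>The logarithm of a product of eigenvalues splits, and each half is weighted by the sum
  of the other factor's eigenvalues. For unnormalised operators this sum is a trace that stays in
  the formula.\<close>

lemma ent_tensor:
  assumes fin: "finite I" "finite J" and psd: "psd_on I \<rho>" "psd_on J \<sigma>"
  shows "ent (I \<times> J) (\<lambda>x y. \<rho> (fst x) (fst y) * \<sigma> (snd x) (snd y))
       = ent I \<rho> * otr J \<sigma> + otr I \<rho> * ent J \<sigma>"
proof -
  obtain p v where v: "diag_on I \<rho> I p v" and p: "\<And>k. k \<in> I \<Longrightarrow> 0 \<le> p k"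
    using psd_on_spectral[OF fin(1) psd(1)] by blast
  obtain q w where w: "diag_on J \<sigma> J q w" and q: "\<And>k. k \<in> J \<Longrightarrow> 0 \<le> q k"
    using psd_on_spectral[OF fin(2) psd(2)] by blast
  have "ent (I \<times> J) (\<lambda>x y. \<rho> (fst x) (fst y) * \<sigma> (snd x) (snd y))
      = (\<Sum>k\<in>I \<times> J. - (p (fst k) * q (snd k) * ln (p (fst k) * q (snd k))))"
    by (rule ent_eq[OF diag_on_tensor[OF v w]]) (use fin in simp)
  also have "\<dots> = (\<Sum>i\<in>I. \<Sum>j\<in>J. - (p i * ln (p i)) * q j + p i * (- (q j * ln (q j))))"
    unfolding sum_Times
  proof (intro sum.cong refl)
    fix i j assume "i \<in> I" "j \<in> J"
    then consider "p i = 0" | "q j = 0" | "p i > 0" "q j > 0" using p q by (metis less_eq_real_def)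
    then show "- (p (fst (i, j)) * q (snd (i, j)) * ln (p (fst (i, j)) * q (snd (i, j))))
        = - (p i * ln (p i)) * q j + p i * (- (q j * ln (q j)))"
      by cases (auto simp: ln_mult algebra_simps)
  qed
  also have "\<dots> = ent I \<rho> * otr J \<sigma> + otr I \<rho> * ent J \<sigma>"
    by (simp only: ent_eq[OF v fin(1)] ent_eq[OF w fin(2)] otr_diag[OF v] otr_diag[OF w] sum_product sum.distrib)
  finally show ?thesis .
qed
text \<open>\<open>otr\<close> takes real parts, which are multiplicative on diagonal entries
  because those of a hermitian operator are real.\<close>

lemma otr_tensor:
  assumes "finite I" "finite J" "psd_on I \<rho>" "psd_on J \<sigma>"
  shows "otr (I \<times> J) (\<lambda>x y. \<rho> (fst x) (fst y) * \<sigma> (snd x) (snd y)) = otr I \<rho> * otr J \<sigma>"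
proof -
  have "Im (\<rho> i i) = 0" if "i \<in> I" for i
    using hermitian_onD[OF psd_on_hermitian[OF assms(3)] that that] by (simp add: complex_eq_iff)
  then show ?thesis by (simp add: otr_def sum_Times sum_product)
qed

lemma psd_on_direct_sum:
  assumes "finite M" "\<And>m. m \<in> M \<Longrightarrow> psd_on (I m) (\<rho> m)"
  shows "psd_on (Sigma M I) (\<lambda>x y. of_bool (fst x = fst y) * \<rho> (fst x) (snd x) (snd y))"
proof -
  obtain f :: "_ \<Rightarrow> nat set \<times> (nat \<Rightarrow> _ \<Rightarrow> complex)" where f: "\<forall>m\<in>M. finite (fst (f m)) \<and>
      (\<forall>i\<in>I m. \<forall>j\<in>I m. \<rho> m i j = (\<Sum>k\<in>fst (f m). snd (f m) k i * cnj (snd (f m) k j)))"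
    using psd_on_family[where M=M and I="I" and \<rho>=\<rho>, OF assms(2)] by blast
  define K where "K m = fst (f m)" for m
  define v where "v m = snd (f m)" for m
  have K: "\<And>m. m \<in> M \<Longrightarrow> finite (K m)"
    and v: "\<And>m i j. m \<in> M \<Longrightarrow> i \<in> I m \<Longrightarrow> j \<in> I m \<Longrightarrow> \<rho> m i j = (\<Sum>k\<in>K m. v m k i * cnj (v m k j))"
    using f unfolding K_def v_def by blast+
  show ?thesis
  proof (rule psd_onI[of "Sigma M K" _ _ "\<lambda>k x. of_bool (fst k = fst x) * v (fst k) (snd k) (snd x)"])
    show "finite (Sigma M K)" using assms(1) K by auto
    fix x y assume xy: "x \<in> Sigma M I" "y \<in> Sigma M I"
    obtain m i where x: "x = (m, i)" "m \<in> M" "i \<in> I m" using xy by auto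
    obtain m' j where y: "y = (m', j)" "m' \<in> M" "j \<in> I m'" using xy by auto
    have "(\<Sum>k\<in>Sigma M K. of_bool (fst k = fst x) * v (fst k) (snd k) (snd x) *
            cnj (of_bool (fst k = fst y) * v (fst k) (snd k) (snd y)))
        = (\<Sum>a\<in>M. \<Sum>k\<in>K a. of_bool (a = m) * v a k i * cnj (of_bool (a = m') * v a k j))"
      unfolding x(1) y(1) by (subst sum_Sigma) (simp_all add: assms(1) K)
    also have "\<dots> = (\<Sum>a\<in>M. of_bool (a = m) * (\<Sum>k\<in>K a. v a k i * (of_bool (a = m') * cnj (v a k j))))"
      unfolding sum_distrib_left by (intro sum.cong refl) simp
    also have "\<dots> = (\<Sum>k\<in>K m. v m k i * (of_bool (m = m') * cnj (v m k j)))"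
      using x assms(1) by (simp add: sum_of_bool_left)
    also have "\<dots> = of_bool (m = m') * \<rho> m i j"
      using v[of m i j] x y by (cases "m = m'") auto
    finally show "of_bool (fst x = fst y) * \<rho> (fst x) (snd x) (snd y) =
      (\<Sum>k\<in>Sigma M K. of_bool (fst k = fst x) * v (fst k) (snd k) (snd x) *
            cnj (of_bool (fst k = fst y) * v (fst k) (snd k) (snd y)))" by (simp add: x y)
  qed
qed

lemma ent_direct_sum:
  assumes fin: "finite M" "\<And>m. m \<in> M \<Longrightarrow> finite (I m)" and psd: "\<And>m. m \<in> M \<Longrightarrow> psd_on (I m) (\<rho> m)"
  shows "ent (Sigma M I) (\<lambda>x y. of_bool (fst x = fst y) * \<rho> (fst x) (snd x) (snd y)) = (\<Sum>m\<in>M. ent (I m) (\<rho> m))"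
proof -
  have "\<forall>m\<in>M. \<exists>p v. diag_on (I m) (\<rho> m) (I m) p v"
    using psd_on_spectral fin(2) psd by metis
  then obtain p v where v: "\<And>m. m \<in> M \<Longrightarrow> diag_on (I m) (\<rho> m) (I m) (p m) (v m)" by metis
  have fS: "finite (Sigma M I)" using fin by auto
  have "diag_on (Sigma M I) (\<lambda>x y. of_bool (fst x = fst y) * \<rho> (fst x) (snd x) (snd y)) (Sigma M I)
      (\<lambda>k. p (fst k) (snd k)) (\<lambda>k x. of_bool (fst k = fst x) * v (fst k) (snd k) (snd x))"
    unfolding diag_on_def orthonormal_on_def
  proof (intro conjI ballI)
    fix k l assume kl: "k \<in> Sigma M I" "l \<in> Sigma M I"
    obtain m i where x: "k = (m, i)" "m \<in> M" "i \<in> I m" using kl by auto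
    obtain m' j where y: "l = (m', j)" "m' \<in> M" "j \<in> I m'" using kl by auto
    have "(\<Sum>x\<in>Sigma M I. cnj (of_bool (fst k = fst x) * v (fst k) (snd k) (snd x)) *
             (of_bool (fst l = fst x) * v (fst l) (snd l) (snd x)))
        = (\<Sum>a\<in>M. \<Sum>x\<in>I a. cnj (of_bool (m = a) * v m i x) * (of_bool (m' = a) * v m' j x))"
      unfolding x(1) y(1) by (subst sum_Sigma) (simp_all add: fin)
    also have "\<dots> = (\<Sum>a\<in>M. of_bool (m = a) * (\<Sum>x\<in>I a. cnj (v m i x) * (of_bool (m' = a) * v m' j x)))"
      unfolding sum_distrib_left by (intro sum.cong refl) simp
    also have "\<dots> = (\<Sum>x\<in>I m. cnj (v m i x) * (of_bool (m' = m) * v m' j x))"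
      using x fin by (simp add: sum_of_bool_left')
    also have "\<dots> = of_bool (k = l)"
      using v[OF x(2)] x y by (cases "m = m'") (auto simp: diag_on_def orthonormal_on_def)
    finally show "(\<Sum>x\<in>Sigma M I. cnj (of_bool (fst k = fst x) * v (fst k) (snd k) (snd x)) *
             (of_bool (fst l = fst x) * v (fst l) (snd l) (snd x))) = of_bool (k = l)" .
  next
    fix x y assume xy: "x \<in> Sigma M I" "y \<in> Sigma M I"
    obtain m i where x: "x = (m, i)" "m \<in> M" "i \<in> I m" using xy by auto
    obtain m' j where y: "y = (m', j)" "m' \<in> M" "j \<in> I m'" using xy by auto
    have "(\<Sum>k\<in>Sigma M I. complex_of_real (p (fst k) (snd k)) * (of_bool (fst k = fst x) * v (fst k) (snd k) (snd x)) *
            cnj (of_bool (fst k = fst y) * v (fst k) (snd k) (snd y)))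
        = (\<Sum>a\<in>M. \<Sum>k\<in>I a. complex_of_real (p a k) * (of_bool (a = m) * v a k i) * cnj (of_bool (a = m') * v a k j))"
      unfolding x(1) y(1) by (subst sum_Sigma) (simp_all add: fin)
    also have "\<dots> = (\<Sum>a\<in>M. of_bool (a = m) * (\<Sum>k\<in>I a. complex_of_real (p a k) * v a k i * (of_bool (a = m') * cnj (v a k j))))"
      unfolding sum_distrib_left by (intro sum.cong refl) simp
    also have "\<dots> = (\<Sum>k\<in>I m. complex_of_real (p m k) * v m k i * (of_bool (m = m') * cnj (v m k j)))"
      using x fin by (simp add: sum_of_bool_left)
    also have "\<dots> = of_bool (m = m') * \<rho> m i j"
      using diag_onD[OF v[OF x(2)], of i j] x y by (cases "m = m'") auto
    finally show "of_bool (fst x = fst y) * \<rho> (fst x) (snd x) (snd y) =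
      (\<Sum>k\<in>Sigma M I. complex_of_real (p (fst k) (snd k)) * (of_bool (fst k = fst x) * v (fst k) (snd k) (snd x)) *
            cnj (of_bool (fst k = fst y) * v (fst k) (snd k) (snd y)))" by (simp add: x y)
  qed
  then have "ent (Sigma M I) (\<lambda>x y. of_bool (fst x = fst y) * \<rho> (fst x) (snd x) (snd y))
      = (\<Sum>k\<in>Sigma M I. - (p (fst k) (snd k) * ln (p (fst k) (snd k))))"
    using fS by (rule ent_eq)
  also have "\<dots> = (\<Sum>m\<in>M. \<Sum>k\<in>I m. - (p m k * ln (p m k)))"
    using fin by (simp add: sum.Sigma split_def)
  also have "\<dots> = (\<Sum>m\<in>M. ent (I m) (\<rho> m))"
    using ent_eq[OF v fin(2)] by simp
  finally show ?thesis .
qed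

text \<open>Both reduced states of a pure state have the same nonzero spectrum: the Schmidt vectors on \<open>J\<close> are the
  vectors \<open>a k\<close> below, normalised.\<close>

lemma ent_pure:
  fixes \<psi> :: "'a \<times> 'b \<Rightarrow> complex"
  assumes fin: "finite I" "finite J"
  shows "ent I (\<lambda>x y. \<Sum>j\<in>J. \<psi> (x, j) * cnj (\<psi> (y, j))) = ent J (\<lambda>x y. \<Sum>i\<in>I. \<psi> (i, x) * cnj (\<psi> (i, y)))"
proof -
  define \<rho> where "\<rho> x y = (\<Sum>j\<in>J. \<psi> (x, j) * cnj (\<psi> (y, j)))" for x y
  have psd: "psd_on I \<rho>"
    by (rule psd_onI[OF fin(2), where v="\<lambda>j x. \<psi> (x, j)"]) (simp add: \<rho>_def)
  obtain p u where u: "diag_on I \<rho> I p u" and cu: "complete_on I I u" and p: "\<And>k. k \<in> I \<Longrightarrow> 0 \<le> p k"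
    using psd_on_spectral[OF fin(1) psd] by blast
  have ou: "orthonormal_on I I u" using u by (simp add: diag_on_def)
  define a where "a k j = (\<Sum>i\<in>I. cnj (u k i) * \<psi> (i, j))" for k j
  have aa: "(\<Sum>j\<in>J. cnj (a l j) * a k j) = complex_of_real (p k) * of_bool (k = l)" if "k \<in> I" "l \<in> I" for k l
  proof -
    have "(\<Sum>j\<in>J. cnj (a l j) * a k j) = (\<Sum>j\<in>J. \<Sum>i\<in>I. \<Sum>i'\<in>I. u l i * cnj (u k i') * (\<psi> (i', j) * cnj (\<psi> (i, j))))"
      by (simp add: a_def cnj_sum sum_product mult_ac)
    also have "\<dots> = (\<Sum>i\<in>I. \<Sum>i'\<in>I. \<Sum>j\<in>J. u l i * cnj (u k i') * (\<psi> (i', j) * cnj (\<psi> (i, j))))"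
      by (subst sum.swap, intro sum.cong refl, rule sum.swap)
    also have "\<dots> = (\<Sum>i\<in>I. u l i * (\<Sum>i'\<in>I. cnj (u k i') * \<rho> i' i))"
      by (simp add: \<rho>_def sum_distrib_left mult_ac)
    also have "\<dots> = complex_of_real (p k) * (\<Sum>i\<in>I. cnj (u k i) * u l i)"
      using diag_on_eigenvector_left[OF u fin(1) that(1)] by (simp add: sum_distrib_left mult_ac)
    finally show ?thesis using orthonormal_onD[OF ou that] by simp
  qed
  define K where "K = {k\<in>I. p k \<noteq> 0}"
  \<comment> \<open>By \<open>aa\<close> the squared norm of \<open>a k\<close> is
    \<open>p k\<close>. Hence dropping the zero eigenvalues loses no vector, and all those that
    remain can be normalised.\<close>
  have a0: "a k j = 0" if "k \<in> I" "p k = 0" "j \<in> J" for k j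
  proof -
    have "complex_of_real (\<Sum>j\<in>J. (cmod (a k j))\<^sup>2) = 0"
      using aa[OF that(1) that(1)] that(2) by (simp add: cnj_mult_self)
    then have "(\<Sum>j\<in>J. (cmod (a k j))\<^sup>2) = 0" by (simp only: of_real_eq_0_iff)
    then show ?thesis using that(3) fin(2) by (simp add: sum_nonneg_eq_0_iff)
  qed
  have sq: "complex_of_real (sqrt (p k)) * complex_of_real (sqrt (p k)) = complex_of_real (p k)" if "k \<in> I" for k
    using p[OF that] by (simp flip: of_real_mult)
  define w where "w k j = a k j / complex_of_real (sqrt (p k))" for k j
  have "diag_on J (\<lambda>x y. \<Sum>i\<in>I. \<psi> (i, x) * cnj (\<psi> (i, y))) K p w"
    unfolding diag_on_def orthonormal_on_def
  proof (intro conjI ballI)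
    fix k l assume kl: "k \<in> K" "l \<in> K"
    have "(\<Sum>j\<in>J. cnj (w k j) * w l j) = (\<Sum>j\<in>J. cnj (a k j) * a l j) / (complex_of_real (sqrt (p k)) * complex_of_real (sqrt (p l)))"
      by (simp add: w_def sum_divide_distrib)
    also have "\<dots> = of_bool (k = l)"
      using kl aa[of l k] sq[of k] by (auto simp: K_def)
    finally show "(\<Sum>j\<in>J. cnj (w k j) * w l j) = of_bool (k = l)" .
  next
    fix x y assume xy: "x \<in> J" "y \<in> J"
    have "(\<Sum>i\<in>I. \<psi> (i, x) * cnj (\<psi> (i, y))) = (\<Sum>i\<in>I. cnj (\<psi> (i, y)) * \<psi> (i, x))"
      by (simp add: mult.commute)
    also have "\<dots> = (\<Sum>k\<in>I. cnj (a k y) * a k x)"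
      unfolding a_def by (rule complete_on_parseval[OF cu fin(1), symmetric])
    also have "\<dots> = (\<Sum>k\<in>K. cnj (a k y) * a k x)"
      using fin(1) a0 xy by (intro sum.mono_neutral_right) (auto simp: K_def)
    also have "\<dots> = (\<Sum>k\<in>K. complex_of_real (p k) * w k x * cnj (w k y))"
    proof (intro sum.cong refl)
      fix k assume "k \<in> K"
      then show "cnj (a k y) * a k x = complex_of_real (p k) * w k x * cnj (w k y)"
        using sq[of k] by (auto simp: K_def w_def)
    qed
    finally show "(\<Sum>i\<in>I. \<psi> (i, x) * cnj (\<psi> (i, y))) = \<dots>" .
  qed
  then have "ent J (\<lambda>x y. \<Sum>i\<in>I. \<psi> (i, x) * cnj (\<psi> (i, y))) = (\<Sum>k\<in>K. - (p k * ln (p k)))"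
    by (rule ent_eq) (use fin in \<open>simp add: K_def\<close>)
  also have "\<dots> = (\<Sum>k\<in>I. - (p k * ln (p k)))"
    using fin by (intro sum.mono_neutral_left) (auto simp: K_def)
  also have "\<dots> = ent I \<rho>" by (rule ent_eq[OF u fin(1), symmetric])
  finally show ?thesis by (simp add: \<rho>_def[abs_def])
qed

section \<open>Conditional entropy is superadditive and increases under pinching\<close>

subsection \<open>A variational expression\<close>

text \<open>For hermitian \<open>\<rho>\<close> and \<open>\<sigma>\<close> only the first term can
  fail to be real; the real part is what is maximised over \<open>X\<close>.\<close>

definition vfun :: "real \<Rightarrow> 'a set \<Rightarrow> ('a \<Rightarrow> 'a \<Rightarrow> complex) \<Rightarrow> ('a \<Rightarrow> 'a \<Rightarrow> complex) \<Rightarrow> ('a \<Rightarrow> 'a \<Rightarrow> complex) \<Rightarrow> complex" where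
  "vfun t I \<rho> \<sigma> X =
     (\<Sum>i\<in>I. \<Sum>j\<in>I. 2 * (cnj (X i j) * (\<rho> i j - \<sigma> i j)))
     - (1 - complex_of_real t) * (\<Sum>j\<in>I. \<Sum>i\<in>I. \<Sum>i'\<in>I. cnj (X i j) * \<rho> i i' * X i' j)
     - complex_of_real t * (\<Sum>i\<in>I. \<Sum>j\<in>I. \<Sum>j'\<in>I. X i j * \<sigma> j j' * cnj (X i j'))"

text \<open>A chi-square divergence with a mixture in the denominator. For nonnegative eigenvalues
  and 0 < t < 1 the denominator vanishes only if both eigenvalues do, and then HOL's
  \<open>0 / 0 = 0\<close> is the right value.\<close>

definition chi :: "real \<Rightarrow> 'a set \<Rightarrow> ('a \<Rightarrow> real) \<Rightarrow> ('a \<Rightarrow> 'a \<Rightarrow> complex) \<Rightarrow> ('a \<Rightarrow> real) \<Rightarrow> ('a \<Rightarrow> 'a \<Rightarrow> complex) \<Rightarrow> real" where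
  "chi t I p e q f = (\<Sum>k\<in>I. \<Sum>l\<in>I. (cmod (\<Sum>i\<in>I. cnj (e k i) * f l i))\<^sup>2 *
     ((p k - q l)\<^sup>2 / ((1 - t) * p k + t * q l)))"

text \<open>The matrix element of \<open>X\<close> between \<open>e k\<close> and
  \<open>f l\<close>. In these mixed coordinates both quadratic terms of \<open>vfun\<close> are
  diagonal at once.\<close>

definition bicoord :: "'a set \<Rightarrow> ('k \<Rightarrow> 'a \<Rightarrow> complex) \<Rightarrow> ('k \<Rightarrow> 'a \<Rightarrow> complex) \<Rightarrow> ('a \<Rightarrow> 'a \<Rightarrow> complex) \<Rightarrow> 'k \<Rightarrow> 'k \<Rightarrow> complex" where
  "bicoord I e f X k l = (\<Sum>j\<in>I. f l j * (\<Sum>i\<in>I. cnj (e k i) * X i j))"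

lemma bicoord_swap: "bicoord I e f X k l = (\<Sum>i\<in>I. cnj (e k i) * (\<Sum>j\<in>I. X i j * f l j))"
  unfolding bicoord_def sum_distrib_left by (subst sum.swap) (simp add: mult_ac)

lemma complete_on_cnj:
  assumes "complete_on I K f"
  shows "complete_on I K (\<lambda>l j. cnj (f l j))"
  unfolding complete_on_def
proof (intro ballI)
  fix i j assume "i \<in> I" "j \<in> I"
  then show "(\<Sum>k\<in>K. cnj (f k i) * cnj (cnj (f k j))) = of_bool (i = j)"
    using complete_onD[OF assms, of j i] by (simp add: mult.commute eq_commute[of i])
qed

lemma bicoord_parseval:
  assumes "complete_on I K e" "complete_on I K f" "finite I"
  shows "(\<Sum>i\<in>I. \<Sum>j\<in>I. cnj (X i j) * Y i j) = (\<Sum>k\<in>K. \<Sum>l\<in>K. cnj (bicoord I e f X k l) * bicoord I e f Y k l)"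
proof -
  have "(\<Sum>i\<in>I. \<Sum>j\<in>I. cnj (X i j) * Y i j)
      = (\<Sum>j\<in>I. \<Sum>k\<in>K. cnj (\<Sum>i\<in>I. cnj (e k i) * X i j) * (\<Sum>i\<in>I. cnj (e k i) * Y i j))"
    by (subst sum.swap) (simp only: complete_on_parseval[OF assms(1,3)])
  also have "\<dots> = (\<Sum>k\<in>K. \<Sum>j\<in>I. cnj (\<Sum>i\<in>I. cnj (e k i) * X i j) * (\<Sum>i\<in>I. cnj (e k i) * Y i j))"
    by (rule sum.swap)
  also have "\<dots> = (\<Sum>k\<in>K. \<Sum>l\<in>K. cnj (bicoord I e f X k l) * bicoord I e f Y k l)"
    unfolding bicoord_def
    by (intro sum.cong refl)
      (rule complete_on_parseval[OF complete_on_cnj[OF assms(2)] assms(3), symmetric, unfolded complex_cnj_cnj])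
  finally show ?thesis .
qed

text \<open>Left multiplication by \<open>\<rho>\<close> scales the coordinate \<open>(k, l)\<close>
  by \<open>p k\<close>, and right multiplication by \<open>\<sigma>\<close> scales it by
  \<open>q l\<close>. Applied to the identity, whose coordinates are the overlaps, this also gives
  the coordinates of the difference of the operators.\<close>

lemma vfun_eq:
  assumes fin: "finite I"
    and e: "diag_on I \<rho> I p e" "complete_on I I e" and f: "diag_on I \<sigma> I q f" "complete_on I I f"
  shows "vfun t I \<rho> \<sigma> X = (\<Sum>k\<in>I. \<Sum>l\<in>I.
      2 * (cnj (bicoord I e f X k l) * (complex_of_real (p k - q l) * (\<Sum>i\<in>I. cnj (e k i) * f l i)))
      - complex_of_real (((1 - t) * p k + t * q l) * (cmod (bicoord I e f X k l))\<^sup>2))"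
proof -
  let ?Z = "bicoord I e f X"
  have A: "(\<Sum>i\<in>I. \<Sum>j\<in>I. cnj (X i j) * (\<rho> i j - \<sigma> i j))
      = (\<Sum>k\<in>I. \<Sum>l\<in>I. cnj (?Z k l) * (complex_of_real (p k - q l) * (\<Sum>i\<in>I. cnj (e k i) * f l i)))"
    unfolding bicoord_parseval[OF e(2) f(2) fin, of X "\<lambda>i j. \<rho> i j - \<sigma> i j"]
  proof (intro sum.cong refl arg_cong2[of _ _ _ _ "(*)"])
    fix k l assume kl: "k \<in> I" "l \<in> I"
    have "bicoord I e f (\<lambda>i j. \<rho> i j - \<sigma> i j) k l = bicoord I e f \<rho> k l - bicoord I e f \<sigma> k l"
      by (simp add: bicoord_def right_diff_distrib sum_subtractf)
    also have "bicoord I e f \<rho> k l = complex_of_real (p k) * (\<Sum>i\<in>I. cnj (e k i) * f l i)"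
      using diag_on_eigenvector_left[OF e(1) fin kl(1)] by (simp add: bicoord_def sum_distrib_left mult_ac)
    also have "bicoord I e f \<sigma> k l = complex_of_real (q l) * (\<Sum>i\<in>I. cnj (e k i) * f l i)"
      using diag_on_eigenvector[OF f(1) fin kl(2)] by (simp add: bicoord_swap sum_distrib_left mult_ac)
    finally show "bicoord I e f (\<lambda>i j. \<rho> i j - \<sigma> i j) k l = complex_of_real (p k - q l) * (\<Sum>i\<in>I. cnj (e k i) * f l i)"
      by (simp add: left_diff_distrib)
  qed
  have B: "(\<Sum>j\<in>I. \<Sum>i\<in>I. \<Sum>i'\<in>I. cnj (X i j) * \<rho> i i' * X i' j)
      = (\<Sum>k\<in>I. \<Sum>l\<in>I. complex_of_real (p k * (cmod (?Z k l))\<^sup>2))"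
  proof -
    have "(\<Sum>j\<in>I. \<Sum>i\<in>I. \<Sum>i'\<in>I. cnj (X i j) * \<rho> i i' * X i' j)
       = (\<Sum>j\<in>I. \<Sum>k\<in>I. complex_of_real (p k) * (cnj (\<Sum>i\<in>I. cnj (e k i) * X i j) * (\<Sum>i\<in>I. cnj (e k i) * X i j)))"
      by (rule sum.cong[OF refl], rule diag_on_form[OF e(1)])
    also have "\<dots> = (\<Sum>k\<in>I. complex_of_real (p k) * (\<Sum>j\<in>I. cnj (\<Sum>i\<in>I. cnj (e k i) * X i j) * (\<Sum>i\<in>I. cnj (e k i) * X i j)))"
      by (subst sum.swap) (simp only: sum_distrib_left)
    also have "\<dots> = (\<Sum>k\<in>I. complex_of_real (p k) * (\<Sum>l\<in>I. cnj (?Z k l) * ?Z k l))"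
      unfolding bicoord_def
      by (rule sum.cong[OF refl], rule arg_cong[where f="(*) _"])
        (rule complete_on_parseval[OF complete_on_cnj[OF f(2)] fin, symmetric, unfolded complex_cnj_cnj])
    finally show ?thesis by (simp add: cnj_mult_self sum_distrib_left)
  qed
  have C: "(\<Sum>i\<in>I. \<Sum>j\<in>I. \<Sum>j'\<in>I. X i j * \<sigma> j j' * cnj (X i j'))
      = (\<Sum>k\<in>I. \<Sum>l\<in>I. complex_of_real (q l * (cmod (?Z k l))\<^sup>2))"
  proof -
    have b: "(\<Sum>j\<in>I. cnj (f l j) * cnj (X i j)) = cnj (\<Sum>j\<in>I. X i j * f l j)" for i l
      by (simp add: mult.commute)
    have "(\<Sum>i\<in>I. \<Sum>j\<in>I. \<Sum>j'\<in>I. X i j * \<sigma> j j' * cnj (X i j'))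
       = (\<Sum>i\<in>I. \<Sum>l\<in>I. complex_of_real (q l) * (cnj (\<Sum>j\<in>I. X i j * f l j) * (\<Sum>j\<in>I. X i j * f l j)))"
    proof (rule sum.cong[OF refl])
      fix i assume "i \<in> I"
      show "(\<Sum>j\<in>I. \<Sum>j'\<in>I. X i j * \<sigma> j j' * cnj (X i j'))
          = (\<Sum>l\<in>I. complex_of_real (q l) * (cnj (\<Sum>j\<in>I. X i j * f l j) * (\<Sum>j\<in>I. X i j * f l j)))"
        using diag_on_form[OF f(1), of "\<lambda>j. cnj (X i j)" "\<lambda>j. cnj (X i j)"]
        unfolding b complex_cnj_cnj by (simp only: mult.commute)
    qed
    also have "\<dots> = (\<Sum>l\<in>I. complex_of_real (q l) * (\<Sum>i\<in>I. cnj (\<Sum>j\<in>I. X i j * f l j) * (\<Sum>j\<in>I. X i j * f l j)))"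
      by (subst sum.swap) (simp only: sum_distrib_left)
    also have "\<dots> = (\<Sum>l\<in>I. complex_of_real (q l) * (\<Sum>k\<in>I. cnj (?Z k l) * ?Z k l))"
      unfolding bicoord_swap
      by (rule sum.cong[OF refl], rule arg_cong[where f="(*) _"]) (rule complete_on_parseval[OF e(2) fin, symmetric])
    also have "\<dots> = (\<Sum>l\<in>I. \<Sum>k\<in>I. complex_of_real (q l * (cmod (?Z k l))\<^sup>2))"
      by (simp add: cnj_mult_self sum_distrib_left)
    also have "\<dots> = (\<Sum>k\<in>I. \<Sum>l\<in>I. complex_of_real (q l * (cmod (?Z k l))\<^sup>2))"
      by (rule sum.swap)
    finally show ?thesis .
  qed
  show ?thesis
    unfolding vfun_def B C sum_distrib_left[of 2, symmetric] A
    by (simp add: sum_distrib_left sum_subtractf[symmetric] algebra_simps)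
qed

lemma Re_vfun_eq:
  assumes "finite I" "diag_on I \<rho> I p e" "complete_on I I e" "diag_on I \<sigma> I q f" "complete_on I I f"
  shows "Re (vfun t I \<rho> \<sigma> X) = (\<Sum>k\<in>I. \<Sum>l\<in>I.
      2 * Re (cnj (bicoord I e f X k l) * (complex_of_real (p k - q l) * (\<Sum>i\<in>I. cnj (e k i) * f l i)))
      - ((1 - t) * p k + t * q l) * (cmod (bicoord I e f X k l))\<^sup>2)"
  unfolding vfun_eq[OF assms] Re_sum minus_complex.sel Re_complex_of_real
  by (intro sum.cong refl arg_cong2[of _ _ _ _ "(-)"]) simp

text \<open>With \<open>d = 0\<close> the linear term would be unbounded in \<open>z\<close>; the
  second hypothesis makes it vanish as well, so that both sides are 0.\<close>

lemma complete_square_le: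
  assumes "d \<ge> 0" "d = 0 \<Longrightarrow> c = 0"
  shows "2 * Re (cnj z * (complex_of_real c * w)) - d * (cmod z)\<^sup>2 \<le> (cmod w)\<^sup>2 * (c\<^sup>2 / d)"
proof (cases "d = 0")
  case True
  then show ?thesis using assms by simp
next
  case False
  with assms have d: "d > 0" by simp
  have "Re (cnj z * (complex_of_real c * w)) \<le> cmod (cnj z * (complex_of_real c * w))"
    by (rule complex_Re_le_cmod)
  also have "\<dots> = cmod z * (\<bar>c\<bar> * cmod w)" by (simp add: norm_mult)
  finally have "2 * Re (cnj z * (complex_of_real c * w)) - d * (cmod z)\<^sup>2
      \<le> 2 * (cmod z * (\<bar>c\<bar> * cmod w)) - d * (cmod z)\<^sup>2" by simp
  also have "\<dots> \<le> (\<bar>c\<bar> * cmod w)\<^sup>2 / d"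
  proof -
    have "0 \<le> (d * cmod z - \<bar>c\<bar> * cmod w)\<^sup>2" by simp
    then have "d * (2 * (cmod z * (\<bar>c\<bar> * cmod w)) - d * (cmod z)\<^sup>2) \<le> (\<bar>c\<bar> * cmod w)\<^sup>2"
      by (simp add: power2_eq_square algebra_simps)
    then show ?thesis using d by (simp add: pos_le_divide_eq mult.commute)
  qed
  finally show ?thesis by (simp add: power_mult_distrib mult.commute)
qed

lemma complete_square_eq:
  assumes "d = 0 \<Longrightarrow> c = 0" "z = complex_of_real (c / d) * w"
  shows "2 * Re (cnj z * (complex_of_real c * w)) - d * (cmod z)\<^sup>2 = (cmod w)\<^sup>2 * (c\<^sup>2 / d)"
proof -
  have "cnj z * (complex_of_real c * w) = complex_of_real (c / d * c) * (cnj w * w)"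
    by (simp add: assms(2))
  then have "Re (cnj z * (complex_of_real c * w)) = c / d * c * (cmod w)\<^sup>2"
    unfolding cnj_mult_self of_real_mult[symmetric] by simp
  moreover have "(cmod z)\<^sup>2 = (c / d)\<^sup>2 * (cmod w)\<^sup>2"
    by (simp add: assms(2) norm_mult power_mult_distrib norm_divide power_divide)
  ultimately show ?thesis using assms(1)
    by (cases "d = 0") (simp_all add: field_simps power2_eq_square)
qed

lemma convex_comb_eq_0:
  fixes a b t :: real
  assumes "0 < t" "t < 1" "0 \<le> a" "0 \<le> b" "(1 - t) * a + t * b = 0"
  shows "a = 0 \<and> b = 0"
proof -
  have "0 \<le> (1 - t) * a" "0 \<le> t * b" using assms by auto
  with assms(5) have "(1 - t) * a = 0" "t * b = 0" by linarith+
  with assms show ?thesis by simp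
qed

lemma vfun_le_chi:
  assumes fin: "finite I" and t: "0 < t" "t < 1"
    and e: "diag_on I \<rho> I p e" "complete_on I I e" "\<And>k. k \<in> I \<Longrightarrow> 0 \<le> p k"
    and f: "diag_on I \<sigma> I q f" "complete_on I I f" "\<And>k. k \<in> I \<Longrightarrow> 0 \<le> q k"
  shows "Re (vfun t I \<rho> \<sigma> X) \<le> chi t I p e q f"
  unfolding Re_vfun_eq[OF fin e(1,2) f(1,2)] chi_def
proof (intro sum_mono complete_square_le)
  fix k l assume kl: "k \<in> I" "l \<in> I"
  show "0 \<le> (1 - t) * p k + t * q l" using t e(3)[OF kl(1)] f(3)[OF kl(2)] by simp
  show "p k - q l = 0" if "(1 - t) * p k + t * q l = 0"
    using convex_comb_eq_0[OF t e(3)[OF kl(1)] f(3)[OF kl(2)] that] by simp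
qed

text \<open>The witness is the sum of \<open>Z k l\<close> times the outer product of
  \<open>e k\<close> and \<open>f l\<close>. It contains \<open>k\<close> and \<open>l\<close> only
  as bound variables, although they are fixed before it is given.\<close>

lemma exists_bicoord:
  assumes "finite I" "orthonormal_on I I e" "orthonormal_on I I f"
  shows "\<exists>X. \<forall>k\<in>I. \<forall>l\<in>I. bicoord I e f X k l = Z k l"
proof (intro exI ballI)
  fix k l assume kl: "k \<in> I" "l \<in> I"
  define X where "X i j = (\<Sum>k\<in>I. (\<Sum>l\<in>I. Z k l * cnj (f l j)) * e k i)" for i j
  have "bicoord I e f X k l = (\<Sum>j\<in>I. f l j * (\<Sum>l'\<in>I. Z k l' * cnj (f l' j)))"
    unfolding bicoord_def X_def using orthonormal_on_sum[OF assms(2,1) kl(1)] by simp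
  also have "\<dots> = cnj (\<Sum>j\<in>I. cnj (f l j) * (\<Sum>l'\<in>I. cnj (Z k l') * f l' j))"
    by simp
  also have "\<dots> = Z k l" by (subst orthonormal_on_sum[OF assms(3,1) kl(2)]) simp
  finally show "bicoord I e f (\<lambda>i j. (\<Sum>k\<in>I. (\<Sum>l\<in>I. Z k l * cnj (f l j)) * e k i)) k l = Z k l"
    by (simp add: X_def[abs_def])
qed

text \<open>An actual maximiser is more convenient than a supremum: the optimal \<open>X\<close> of
  one problem is used as a trial operator in another.\<close>

lemma chi_attained:
  assumes fin: "finite I" and t: "0 < t" "t < 1"
    and e: "diag_on I \<rho> I p e" "complete_on I I e" "\<And>k. k \<in> I \<Longrightarrow> 0 \<le> p k"
    and f: "diag_on I \<sigma> I q f" "complete_on I I f" "\<And>k. k \<in> I \<Longrightarrow> 0 \<le> q k"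
  shows "\<exists>X. Re (vfun t I \<rho> \<sigma> X) = chi t I p e q f"
proof -
  have oe: "orthonormal_on I I e" and of: "orthonormal_on I I f" using e f by (simp_all add: diag_on_def)
  define Z where "Z k l = complex_of_real ((p k - q l) / ((1 - t) * p k + t * q l)) * (\<Sum>i\<in>I. cnj (e k i) * f l i)" for k l
  obtain X where X: "\<forall>k\<in>I. \<forall>l\<in>I. bicoord I e f X k l = Z k l"
    using exists_bicoord[OF fin oe of, of Z] by blast
  have "Re (vfun t I \<rho> \<sigma> X) = chi t I p e q f"
    unfolding Re_vfun_eq[OF fin e(1,2) f(1,2)] chi_def
  proof (intro sum.cong refl complete_square_eq)
    fix k l assume kl: "k \<in> I" "l \<in> I"
    show "p k - q l = 0" if "(1 - t) * p k + t * q l = 0"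
      using convex_comb_eq_0[OF t e(3)[OF kl(1)] f(3)[OF kl(2)] that] by simp
    show "bicoord I e f X k l = complex_of_real ((p k - q l) / ((1 - t) * p k + t * q l)) * (\<Sum>i\<in>I. cnj (e k i) * f l i)"
      using X kl by (simp add: Z_def)
  qed
  then show ?thesis by blast
qed

subsection \<open>From the quadratic functionals to entropies\<close>

text \<open>Division with remainder gives t (q - p)^2 / (p + t (q - p)) = (q - p) - p (q - p) / (p +
  t (q - p)), and this integrates to the formula below.\<close>

definition hfun :: "real \<Rightarrow> real \<Rightarrow> real \<Rightarrow> real" where
  "hfun p q t = (q - p) * t - p * ln ((1 - t) * p + t * q)"

lemma hfun_deriv:
  assumes "0 < t" "t < 1" "0 \<le> p" "0 \<le> q"
  shows "(hfun p q has_real_derivative t * ((p - q)\<^sup>2 / ((1 - t) * p + t * q))) (at t)"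
proof (cases "p = 0 \<and> q = 0")
  case True
  then have "hfun p q = (\<lambda>_. 0)" by (simp add: hfun_def fun_eq_iff)
  with True show ?thesis by simp
next
  case False
  have "(1 - t) * p + t * q \<noteq> 0" using convex_comb_eq_0[of t p q] assms False by auto
  moreover have "0 \<le> (1 - t) * p + t * q" using assms by simp
  ultimately have d: "0 < (1 - t) * p + t * q" by simp
  have "(hfun p q has_real_derivative (q - p) - p * ((q - p) / ((1 - t) * p + t * q))) (at t)"
    unfolding hfun_def[abs_def] using d
    by (auto intro!: derivative_eq_intros simp: divide_simps)
  moreover have "(q - p) - p * ((q - p) / ((1 - t) * p + t * q)) = t * ((p - q)\<^sup>2 / ((1 - t) * p + t * q))"
    using d by (simp add: field_simps power2_eq_square)
  ultimately show ?thesis by simp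
qed

text \<open>The argument of the logarithm is \<open>p\<close> at \<open>t = 0\<close> and
  \<open>q\<close> at \<open>t = 1\<close>. A zero there is harmless only if the factor
  \<open>p\<close> in front of the logarithm is zero too.\<close>

lemma hfun_continuous:
  assumes "0 \<le> p" "0 \<le> q" "q = 0 \<Longrightarrow> p = 0"
  shows "continuous_on {0..1} (hfun p q)"
proof (cases "p = 0")
  case True
  then have "hfun p q = (\<lambda>t. q * t)" by (simp add: hfun_def fun_eq_iff)
  then show ?thesis by (auto intro!: continuous_intros)
next
  case False
  with assms have "q \<noteq> 0" by blast
  with False assms have pq: "p > 0" "q > 0" by simp_all
  have "(1 - t) * p + t * q \<noteq> 0" if "t \<in> {0..1}" for t
  proof (cases "t = 0")
    case False
    with that pq have "0 < t * q" "0 \<le> (1 - t) * p" by auto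
    then show ?thesis by linarith
  qed (use pq in simp)
  then show ?thesis
    unfolding hfun_def[abs_def] by (auto intro!: continuous_intros)
qed

text \<open>The derivative of \<open>hfun p q\<close> is \<open>t\<close> times the summand of \<open>chi\<close>, and its increment over \<open>[0, 1]\<close> is the
  summand of the relative entropy.\<close>

lemma relative_entropy_le_of_chi_le:
  fixes w p q :: "'a \<Rightarrow> real" and w' p' q' :: "'b \<Rightarrow> real"
  assumes fin: "finite M" "finite N"
    and m: "\<And>x. x \<in> M \<Longrightarrow> 0 \<le> p x \<and> 0 \<le> q x \<and> (q x = 0 \<longrightarrow> p x = 0 \<or> w x = 0)"
    and n: "\<And>x. x \<in> N \<Longrightarrow> 0 \<le> p' x \<and> 0 \<le> q' x \<and> (q' x = 0 \<longrightarrow> p' x = 0 \<or> w' x = 0)"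
    and le: "\<And>t. 0 < t \<Longrightarrow> t < 1 \<Longrightarrow>
        (\<Sum>x\<in>M. w x * ((p x - q x)\<^sup>2 / ((1 - t) * p x + t * q x)))
      \<le> (\<Sum>x\<in>N. w' x * ((p' x - q' x)\<^sup>2 / ((1 - t) * p' x + t * q' x)))"
  shows "(\<Sum>x\<in>M. w x * (p x * ln (p x) - p x * ln (q x) - p x + q x))
       \<le> (\<Sum>x\<in>N. w' x * (p' x * ln (p' x) - p' x * ln (q' x) - p' x + q' x))"
proof -
  define H where "H t = (\<Sum>x\<in>N. w' x * hfun (p' x) (q' x) t) - (\<Sum>x\<in>M. w x * hfun (p x) (q x) t)" for t
  have "H 0 \<le> H 1"
  \<comment> \<open>The hypothesis \<open>le\<close> controls the derivative only in the open
    interval; the endpoints are reached by continuity.\<close>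
  proof (rule DERIV_nonneg_imp_increasing_open[of 0 1])
    fix t :: real assume t: "0 < t" "t < 1"
    have "(H has_real_derivative ((\<Sum>x\<in>N. w' x * (t * ((p' x - q' x)\<^sup>2 / ((1 - t) * p' x + t * q' x))))
        - (\<Sum>x\<in>M. w x * (t * ((p x - q x)\<^sup>2 / ((1 - t) * p x + t * q x)))))) (at t)"
      unfolding H_def[abs_def] using m n t
      by (intro DERIV_diff DERIV_sum DERIV_cmult hfun_deriv) auto
    moreover have "0 \<le> (\<Sum>x\<in>N. w' x * (t * ((p' x - q' x)\<^sup>2 / ((1 - t) * p' x + t * q' x))))
        - (\<Sum>x\<in>M. w x * (t * ((p x - q x)\<^sup>2 / ((1 - t) * p x + t * q x))))"
      using mult_left_mono[OF le[OF t], of t] t by (simp add: sum_distrib_left mult_ac)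
    ultimately show "\<exists>y. (H has_real_derivative y) (at t) \<and> 0 \<le> y" by blast
  next
    \<comment> \<open>A summand with \<open>q' x = 0 < p' x\<close> is discontinuous at 1, but then
      its weight is 0.\<close>
    have "continuous_on {0..1} (\<lambda>t. w' x * hfun (p' x) (q' x) t)" if "x \<in> N" for x
      by (cases "w' x = 0") (use n[OF that] in \<open>auto intro!: continuous_intros hfun_continuous\<close>)
    moreover have "continuous_on {0..1} (\<lambda>t. w x * hfun (p x) (q x) t)" if "x \<in> M" for x
      by (cases "w x = 0") (use m[OF that] in \<open>auto intro!: continuous_intros hfun_continuous\<close>)
    ultimately show "continuous_on {0..1} H"
      unfolding H_def[abs_def] by (intro continuous_on_diff continuous_on_sum) auto
  qed simp
  then have "(\<Sum>x\<in>M. w x * hfun (p x) (q x) 1) - (\<Sum>x\<in>M. w x * hfun (p x) (q x) 0)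
      \<le> (\<Sum>x\<in>N. w' x * hfun (p' x) (q' x) 1) - (\<Sum>x\<in>N. w' x * hfun (p' x) (q' x) 0)"
    unfolding H_def by linarith
  then show ?thesis
    unfolding sum_subtractf[symmetric] right_diff_distrib[symmetric]
    by (simp add: hfun_def algebra_simps)
qed

section \<open>Conditional entropy as a relative entropy\<close>

definition eigval :: "'a set \<Rightarrow> ('a \<Rightarrow> 'a \<Rightarrow> complex) \<Rightarrow> 'a \<Rightarrow> real" where
  "eigval I \<rho> = fst (SOME pv. diag_on I \<rho> I (fst pv) (snd pv) \<and> complete_on I I (snd pv) \<and> (\<forall>k\<in>I. 0 \<le> fst pv k))"

text \<open>The second component of the very choice of which \<open>eigval\<close> takes the first,
  so that values and vectors belong together.\<close>

definition eigvec :: "'a set \<Rightarrow> ('a \<Rightarrow> 'a \<Rightarrow> complex) \<Rightarrow> 'a \<Rightarrow> 'a \<Rightarrow> complex" where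
  "eigvec I \<rho> = snd (SOME pv. diag_on I \<rho> I (fst pv) (snd pv) \<and> complete_on I I (snd pv) \<and> (\<forall>k\<in>I. 0 \<le> fst pv k))"

lemma eig_spectral:
  assumes "finite I" "psd_on I \<rho>"
  shows "diag_on I \<rho> I (eigval I \<rho>) (eigvec I \<rho>)" "complete_on I I (eigvec I \<rho>)" "\<And>k. k \<in> I \<Longrightarrow> 0 \<le> eigval I \<rho> k"
proof -
  obtain p v where "diag_on I \<rho> I p v" "complete_on I I v" "\<And>k. k \<in> I \<Longrightarrow> 0 \<le> p k"
    using psd_on_spectral[OF assms] by blast
  then have "\<exists>pv. diag_on I \<rho> I (fst pv) (snd pv) \<and> complete_on I I (snd pv) \<and> (\<forall>k\<in>I. 0 \<le> fst pv k)"
    by (intro exI[of _ "(p, v)"]) auto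
  from someI_ex[OF this]
  have *: "diag_on I \<rho> I (eigval I \<rho>) (eigvec I \<rho>) \<and> complete_on I I (eigvec I \<rho>) \<and> (\<forall>k\<in>I. 0 \<le> eigval I \<rho> k)"
    unfolding eigval_def eigvec_def .
  then show "diag_on I \<rho> I (eigval I \<rho>) (eigvec I \<rho>)" "complete_on I I (eigvec I \<rho>)" "\<And>k. k \<in> I \<Longrightarrow> 0 \<le> eigval I \<rho> k"
    by auto
qed

text \<open>The conditional entropy of \<open>I\<close> given \<open>J\<close>, in nats and for
  operators of any trace.\<close>

definition cent :: "'a set \<Rightarrow> 'b set \<Rightarrow> ('a \<times> 'b \<Rightarrow> 'a \<times> 'b \<Rightarrow> complex) \<Rightarrow> real" where
  "cent I J \<rho> = ent (I \<times> J) \<rho> - ent J (ptr I \<rho>)"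

text \<open>\<open>cent I J \<rho>\<close> is, up to a constant, minus the relative entropy of \<open>\<rho>\<close> to \<open>cref I J \<rho>\<close>, which is the tensor product
  of the maximally mixed state on \<open>I\<close> with the reduced operator of \<open>\<rho>\<close> on \<open>J\<close>.\<close>

definition cref :: "'a set \<Rightarrow> 'b set \<Rightarrow> ('a \<times> 'b \<Rightarrow> 'a \<times> 'b \<Rightarrow> complex) \<Rightarrow> 'a \<times> 'b \<Rightarrow> 'a \<times> 'b \<Rightarrow> complex" where
  "cref I J \<rho> = (\<lambda>x y. of_bool (fst x = fst y) * ptr I \<rho> (snd x) (snd y) / of_nat (card I))"

definition cref_val :: "'a set \<Rightarrow> 'b set \<Rightarrow> ('a \<times> 'b \<Rightarrow> 'a \<times> 'b \<Rightarrow> complex) \<Rightarrow> 'a \<times> 'b \<Rightarrow> real" where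
  "cref_val I J \<rho> = (\<lambda>x. eigval J (ptr I \<rho>) (snd x) / real (card I))"

text \<open>A product basis instead of an arbitrary eigenbasis of \<open>cref\<close>: fixing its
  \<open>J\<close> component and summing over the \<open>I\<close> component is a partial trace, as
  \<open>cweight_marginal\<close> exploits.\<close>

definition cref_vec :: "'a set \<Rightarrow> 'b set \<Rightarrow> ('a \<times> 'b \<Rightarrow> 'a \<times> 'b \<Rightarrow> complex) \<Rightarrow> 'a \<times> 'b \<Rightarrow> 'a \<times> 'b \<Rightarrow> complex" where
  "cref_vec I J \<rho> = (\<lambda>x y. of_bool (fst x = fst y) * eigvec J (ptr I \<rho>) (snd x) (snd y))"

lemma cref_spectral:
  assumes fin: "finite I" "finite J" and psd: "psd_on (I \<times> J) \<rho>"
  shows "diag_on (I \<times> J) (cref I J \<rho>) (I \<times> J) (cref_val I J \<rho>) (cref_vec I J \<rho>)"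
    "complete_on (I \<times> J) (I \<times> J) (cref_vec I J \<rho>)" "\<And>x. x \<in> I \<times> J \<Longrightarrow> 0 \<le> cref_val I J \<rho> x"
proof -
  note E = eig_spectral[OF fin(2) psd_on_ptr[OF fin(1) psd]]
  have d: "diag_on I (\<lambda>i j. of_bool (i = j) / of_nat (card I)) I (\<lambda>_. 1 / real (card I)) (\<lambda>k i. of_bool (k = i))"
    unfolding diag_on_def orthonormal_on_def
  proof (intro conjI ballI)
    fix k l assume k: "k \<in> I"
    have "(\<Sum>i\<in>I. cnj (of_bool (k = i)) * of_bool (l = i)) = (\<Sum>i\<in>I. of_bool (k = i) * of_bool (l = i))"
      by (intro sum.cong) auto
    also have "\<dots> = of_bool (l = k)" by (rule sum_of_bool_left'[OF fin(1) k])
    finally show "(\<Sum>i\<in>I. cnj (of_bool (k = i)) * of_bool (l = i)) = (of_bool (k = l) :: complex)" by auto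
  next
    fix i j assume i: "i \<in> I"
    have "(\<Sum>k\<in>I. complex_of_real (1 / real (card I)) * of_bool (k = i) * cnj (of_bool (k = j)))
        = (\<Sum>k\<in>I. of_bool (k = i) * (of_bool (k = j) / of_nat (card I)))"
      by (intro sum.cong) auto
    then show "of_bool (i = j) / of_nat (card I) = (\<Sum>k\<in>I. complex_of_real (1 / real (card I)) * of_bool (k = i) * cnj (of_bool (k = j)))"
      using sum_of_bool_left[OF fin(1) i, of "\<lambda>k. of_bool (k = j) / (of_nat (card I) :: complex)"] by simp
  qed
  have c: "complete_on I I (\<lambda>k i. of_bool (k = i))"
    unfolding complete_on_def
  proof (intro ballI)
    fix i j assume i: "i \<in> I"
    have "(\<Sum>k\<in>I. of_bool (k = i) * cnj (of_bool (k = j))) = (\<Sum>k\<in>I. of_bool (k = i) * of_bool (k = j))"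
      by (intro sum.cong) auto
    also have "\<dots> = of_bool (i = j)" by (rule sum_of_bool_left[OF fin(1) i])
    finally show "(\<Sum>k\<in>I. of_bool (k = i) * cnj (of_bool (k = j))) = (of_bool (i = j) :: complex)" .
  qed
  show "complete_on (I \<times> J) (I \<times> J) (cref_vec I J \<rho>)"
    unfolding cref_vec_def by (rule complete_on_tensor[OF c E(2)])
  show "diag_on (I \<times> J) (cref I J \<rho>) (I \<times> J) (cref_val I J \<rho>) (cref_vec I J \<rho>)"
    using diag_on_tensor[OF d E(1)] by (simp add: cref_def cref_val_def cref_vec_def)
  show "0 \<le> cref_val I J \<rho> x" if "x \<in> I \<times> J" for x
    using that E(3)[of "snd x"] by (auto simp: cref_val_def)
qed
definition cweight :: "'a set \<Rightarrow> 'b set \<Rightarrow> ('a \<times> 'b \<Rightarrow> 'a \<times> 'b \<Rightarrow> complex) \<Rightarrow> 'a \<times> 'b \<Rightarrow> 'a \<times> 'b \<Rightarrow> real" where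
  "cweight I J \<rho> k l = (cmod (\<Sum>x\<in>I \<times> J. cnj (eigvec (I \<times> J) \<rho> k x) * cref_vec I J \<rho> l x))\<^sup>2"

definition cchi :: "real \<Rightarrow> 'a set \<Rightarrow> 'b set \<Rightarrow> ('a \<times> 'b \<Rightarrow> 'a \<times> 'b \<Rightarrow> complex) \<Rightarrow> real" where
  "cchi t I J \<rho> = (\<Sum>k\<in>I \<times> J. \<Sum>l\<in>I \<times> J. cweight I J \<rho> k l *
     ((eigval (I \<times> J) \<rho> k - cref_val I J \<rho> l)\<^sup>2 / ((1 - t) * eigval (I \<times> J) \<rho> k + t * cref_val I J \<rho> l)))"

text \<open>The relative entropy of \<open>\<rho>\<close> to \<open>cref I J \<rho>\<close> as a
  classical one over pairs of eigenvectors, in the manner of Nussbaum and Szkola. The linear terms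
  come from integrating the summands of \<open>cchi\<close>; they cancel in the total because both
  operators have the same trace.\<close>

definition creld :: "'a set \<Rightarrow> 'b set \<Rightarrow> ('a \<times> 'b \<Rightarrow> 'a \<times> 'b \<Rightarrow> complex) \<Rightarrow> real" where
  "creld I J \<rho> = (\<Sum>k\<in>I \<times> J. \<Sum>l\<in>I \<times> J. cweight I J \<rho> k l *
     (eigval (I \<times> J) \<rho> k * ln (eigval (I \<times> J) \<rho> k) - eigval (I \<times> J) \<rho> k * ln (cref_val I J \<rho> l)
       - eigval (I \<times> J) \<rho> k + cref_val I J \<rho> l))"

lemma cchi_ge:
  assumes "finite I" "finite J" "psd_on (I \<times> J) \<rho>" "0 < t" "t < 1"
  shows "Re (vfun t (I \<times> J) \<rho> (cref I J \<rho>) X) \<le> cchi t I J \<rho>"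
proof -
  have f: "finite (I \<times> J)" using assms by simp
  show ?thesis
    using vfun_le_chi[OF f assms(4,5) eig_spectral[OF f assms(3)] cref_spectral[OF assms(1-3)]]
    by (simp add: chi_def cchi_def cweight_def)
qed

lemma cchi_attained:
  assumes "finite I" "finite J" "psd_on (I \<times> J) \<rho>" "0 < t" "t < 1"
  shows "\<exists>X. Re (vfun t (I \<times> J) \<rho> (cref I J \<rho>) X) = cchi t I J \<rho>"
proof -
  have f: "finite (I \<times> J)" using assms by simp
  show ?thesis
    using chi_attained[OF f assms(4,5) eig_spectral[OF f assms(3)] cref_spectral[OF assms(1-3)]]
    by (simp add: chi_def cchi_def cweight_def)
qed

lemma cnj_overlap: "cmod (\<Sum>i\<in>I. cnj (u i) * w i) = cmod (\<Sum>i\<in>I. cnj (w i) * u i)"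
  by (subst complex_mod_cnj[symmetric]) (simp add: mult.commute)

lemma complete_on_overlap:
  assumes "complete_on I K v" "finite I" "(\<Sum>i\<in>I. cnj (u i) * u i) = 1"
  shows "(\<Sum>k\<in>K. (cmod (\<Sum>i\<in>I. cnj (v k i) * u i))\<^sup>2) = 1"
proof -
  have "complex_of_real (\<Sum>k\<in>K. (cmod (\<Sum>i\<in>I. cnj (v k i) * u i))\<^sup>2) = complex_of_real 1"
    unfolding of_real_sum cnj_mult_self[symmetric] complete_on_parseval[OF assms(1,2)] assms(3) by simp
  then show ?thesis by (simp only: of_real_eq_iff)
qed

lemma cweight_form:
  assumes fin: "finite I" "finite J" and psd: "psd_on (I \<times> J) \<rho>"
  shows "complex_of_real (\<Sum>k\<in>I \<times> J. eigval (I \<times> J) \<rho> k * cweight I J \<rho> k l)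
    = (\<Sum>x\<in>I \<times> J. \<Sum>y\<in>I \<times> J. cnj (cref_vec I J \<rho> l x) * \<rho> x y * cref_vec I J \<rho> l y)"
proof -
  have f: "finite (I \<times> J)" using fin by simp
  show ?thesis
    unfolding diag_on_quadratic_form[OF eig_spectral(1)[OF f psd]] cweight_def ..
qed

text \<open>The inner sum is the expectation of \<open>\<rho>\<close> in a basis vector of
  \<open>I\<close> tensored with the eigenvector \<open>j\<close> of the reduced operator. Summing
  over \<open>I\<close> traces that factor out and leaves the eigenvalue.\<close>

lemma cweight_marginal:
  assumes fin: "finite I" "finite J" and psd: "psd_on (I \<times> J) \<rho>" and j: "j \<in> J"
  shows "(\<Sum>i\<in>I. \<Sum>k\<in>I \<times> J. eigval (I \<times> J) \<rho> k * cweight I J \<rho> k (i, j)) = eigval J (ptr I \<rho>) j"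
proof -
  let ?v = "eigvec J (ptr I \<rho>)"
  note E = eig_spectral[OF fin(2) psd_on_ptr[OF fin(1) psd]]
  have o: "orthonormal_on J J ?v" using E(1) by (simp add: diag_on_def)
  have in1: "(\<Sum>x\<in>I \<times> J. \<Sum>y\<in>I \<times> J. cnj (cref_vec I J \<rho> (i, j) x) * \<rho> x y * cref_vec I J \<rho> (i, j) y)
      = (\<Sum>a\<in>J. \<Sum>b\<in>J. cnj (?v j a) * \<rho> (i, a) (i, b) * ?v j b)" if i: "i \<in> I" for i
  proof -
    have "(\<Sum>x\<in>I \<times> J. \<Sum>y\<in>I \<times> J. cnj (cref_vec I J \<rho> (i, j) x) * \<rho> x y * cref_vec I J \<rho> (i, j) y)
        = (\<Sum>c\<in>I. of_bool (i = c) * (\<Sum>a\<in>J. \<Sum>d\<in>I. of_bool (i = d) * (\<Sum>b\<in>J. cnj (?v j a) * \<rho> (c, a) (d, b) * ?v j b)))"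
      unfolding sum_Times cref_vec_def sum_distrib_left by (intro sum.cong refl) simp
    also have "\<dots> = (\<Sum>a\<in>J. \<Sum>d\<in>I. of_bool (i = d) * (\<Sum>b\<in>J. cnj (?v j a) * \<rho> (i, a) (d, b) * ?v j b))"
      by (rule sum_of_bool_left'[OF fin(1) i])
    also have "\<dots> = (\<Sum>a\<in>J. \<Sum>b\<in>J. cnj (?v j a) * \<rho> (i, a) (i, b) * ?v j b)"
      by (intro sum.cong refl sum_of_bool_left'[OF fin(1) i])
    finally show ?thesis .
  qed
  have "complex_of_real (\<Sum>i\<in>I. \<Sum>k\<in>I \<times> J. eigval (I \<times> J) \<rho> k * cweight I J \<rho> k (i, j))
      = (\<Sum>i\<in>I. \<Sum>a\<in>J. \<Sum>b\<in>J. cnj (?v j a) * \<rho> (i, a) (i, b) * ?v j b)"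
    unfolding of_real_sum[of _ I] cweight_form[OF fin psd] by (intro sum.cong refl in1)
  also have "\<dots> = (\<Sum>a\<in>J. \<Sum>b\<in>J. \<Sum>i\<in>I. cnj (?v j a) * \<rho> (i, a) (i, b) * ?v j b)"
    by (subst sum.swap, intro sum.cong refl, rule sum.swap)
  also have "\<dots> = (\<Sum>b\<in>J. (\<Sum>a\<in>J. cnj (?v j a) * ptr I \<rho> a b) * ?v j b)"
    by (subst sum.swap) (simp add: ptr_def sum_distrib_left sum_distrib_right)
  also have "\<dots> = complex_of_real (eigval J (ptr I \<rho>) j) * (\<Sum>b\<in>J. cnj (?v j b) * ?v j b)"
    using diag_on_eigenvector_left[OF E(1) fin(2) j] by (simp add: sum_distrib_left mult_ac)
  also have "\<dots> = complex_of_real (eigval J (ptr I \<rho>) j)"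
    using orthonormal_onD[OF o j j] by simp
  finally show ?thesis by (simp only: of_real_eq_iff)
qed

text \<open>The support of \<open>\<rho>\<close> lies in that of its reference, since a vanishing
  sum of nonnegative terms has vanishing terms. This is the side condition on zero eigenvalues in
  \<open>relative_entropy_le_of_chi_le\<close>.\<close>

lemma cweight_support:
  assumes fin: "finite I" "finite J" and psd: "psd_on (I \<times> J) \<rho>"
    and k: "k \<in> I \<times> J" and l: "l \<in> I \<times> J" and z: "cref_val I J \<rho> l = 0"
  shows "eigval (I \<times> J) \<rho> k = 0 \<or> cweight I J \<rho> k l = 0"
proof -
  obtain i j where ij: "l = (i, j)" "i \<in> I" "j \<in> J" using l by auto
  have f: "finite (I \<times> J)" using fin by simp
  have nn: "0 \<le> eigval (I \<times> J) \<rho> k * cweight I J \<rho> k l" if "k \<in> I \<times> J" for k l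
    using eig_spectral(3)[OF f psd that] by (simp add: cweight_def)
  have "card I > 0" using ij fin by (auto simp: card_gt_0_iff)
  then have "(\<Sum>i\<in>I. \<Sum>k\<in>I \<times> J. eigval (I \<times> J) \<rho> k * cweight I J \<rho> k (i, j)) = 0"
    using z ij cweight_marginal[OF fin psd ij(3)] by (simp add: cref_val_def)
  then have "(\<Sum>k\<in>I \<times> J. eigval (I \<times> J) \<rho> k * cweight I J \<rho> k l) = 0"
    using nn ij fin by (subst (asm) sum_nonneg_eq_0_iff) (auto intro!: sum_nonneg)
  then have "eigval (I \<times> J) \<rho> k * cweight I J \<rho> k l = 0"
    using nn k f by (subst (asm) sum_nonneg_eq_0_iff) auto
  then show ?thesis by simp
qed

lemma otr_ptr: "otr J (ptr I \<rho>) = otr (I \<times> J) \<rho>"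
  unfolding otr_def ptr_def sum_Times Re_sum by (rule sum.swap)

text \<open>The squared overlaps are doubly stochastic (\<open>w1\<close>, \<open>w2\<close>), so
  the terms that depend on one eigenvalue only become traces and entropies. The factor
  \<open>1 / card I\<close> in the eigenvalues of the reference produces the logarithm of the
  dimension.\<close>

lemma creld_eq:
  assumes fin: "finite I" "finite J" and psd: "psd_on (I \<times> J) \<rho>" and ne: "I \<noteq> {}"
  shows "creld I J \<rho> = otr (I \<times> J) \<rho> * ln (real (card I)) - cent I J \<rho>"
proof -
  let ?p = "eigval (I \<times> J) \<rho>" and ?q = "cref_val I J \<rho>" and ?w = "cweight I J \<rho>" and ?r = "eigval J (ptr I \<rho>)"
  have f: "finite (I \<times> J)" using fin by simp
  have n0: "real (card I) > 0" using fin ne by (simp add: card_gt_0_iff)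
  note E = eig_spectral[OF f psd]
  note F = cref_spectral[OF fin psd]
  note G = eig_spectral[OF fin(2) psd_on_ptr[OF fin(1) psd]]
  have oE: "orthonormal_on (I \<times> J) (I \<times> J) (eigvec (I \<times> J) \<rho>)" using E(1) by (simp add: diag_on_def)
  have oF: "orthonormal_on (I \<times> J) (I \<times> J) (cref_vec I J \<rho>)" using F(1) by (simp add: diag_on_def)
  have w1: "(\<Sum>l\<in>I \<times> J. ?w k l) = 1" if "k \<in> I \<times> J" for k
    unfolding cweight_def cnj_overlap[where u="eigvec (I \<times> J) \<rho> k"]
    using complete_on_overlap[OF F(2) f] orthonormal_onD[OF oE that that] by simp
  have w2: "(\<Sum>k\<in>I \<times> J. ?w k l) = 1" if "l \<in> I \<times> J" for l
    unfolding cweight_def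
    using complete_on_overlap[OF E(2) f] orthonormal_onD[OF oF that that] by simp
  have "creld I J \<rho> = (\<Sum>k\<in>I \<times> J. (?p k * ln (?p k) - ?p k) * (\<Sum>l\<in>I \<times> J. ?w k l))
      - (\<Sum>k\<in>I \<times> J. \<Sum>l\<in>I \<times> J. ?p k * ?w k l * ln (?q l)) + (\<Sum>k\<in>I \<times> J. \<Sum>l\<in>I \<times> J. ?w k l * ?q l)"
    unfolding creld_def sum_distrib_left sum_subtractf[symmetric] sum.distrib[symmetric]
    by (intro sum.cong refl) (simp add: algebra_simps)
  also have "(\<Sum>k\<in>I \<times> J. (?p k * ln (?p k) - ?p k) * (\<Sum>l\<in>I \<times> J. ?w k l)) = - ent (I \<times> J) \<rho> - otr (I \<times> J) \<rho>"
    using w1 by (simp add: ent_eq[OF E(1) f] otr_diag[OF E(1)] sum_subtractf sum_negf)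
  also have "(\<Sum>k\<in>I \<times> J. \<Sum>l\<in>I \<times> J. ?w k l * ?q l) = (\<Sum>l\<in>I \<times> J. ?q l * (\<Sum>k\<in>I \<times> J. ?w k l))"
    by (subst sum.swap) (simp add: sum_distrib_left mult.commute)
  also have "\<dots> = (\<Sum>i\<in>I. \<Sum>j\<in>J. ?r j / real (card I))"
    using w2 by (simp add: sum_Times cref_val_def)
  also have "\<dots> = otr (I \<times> J) \<rho>"
    using n0 by (simp add: otr_ptr[symmetric] otr_diag[OF G(1)] sum_divide_distrib[symmetric])
  also have "(\<Sum>k\<in>I \<times> J. \<Sum>l\<in>I \<times> J. ?p k * ?w k l * ln (?q l))
      = (\<Sum>j\<in>J. \<Sum>i\<in>I. (\<Sum>k\<in>I \<times> J. ?p k * ?w k (i, j)) * ln (?r j / real (card I)))"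
    by (subst sum.swap, subst sum_Times, subst sum.swap) (simp add: sum_distrib_right cref_val_def)
  also have "\<dots> = (\<Sum>j\<in>J. ?r j * ln (?r j / real (card I)))"
    by (intro sum.cong refl) (simp add: sum_distrib_right[symmetric] cweight_marginal[OF fin psd])
  also have "\<dots> = (\<Sum>j\<in>J. ?r j * ln (?r j) - ?r j * ln (real (card I)))"
  proof (intro sum.cong refl)
    fix j assume "j \<in> J"
    then have "0 \<le> ?r j" by (rule G(3))
    then show "?r j * ln (?r j / real (card I)) = ?r j * ln (?r j) - ?r j * ln (real (card I))"
      using n0 by (cases "?r j = 0") (simp_all add: ln_div algebra_simps)
  qed
  also have "\<dots> = - ent J (ptr I \<rho>) - otr (I \<times> J) \<rho> * ln (real (card I))"
    by (simp add: ent_eq[OF G(1) fin(2)] otr_ptr[symmetric] otr_diag[OF G(1)] sum_subtractf sum_negf sum_distrib_right)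
  finally show ?thesis by (simp add: cent_def)
qed

text \<open>Families with unrelated index types stand on both sides because superadditivity bounds
  one operator by many and pinching bounds many by one; the single operator is indexed by
  \<open>()\<close>.\<close>

lemma creld_sum_le:
  fixes I :: "'m \<Rightarrow> 'a set" and J :: "'m \<Rightarrow> 'b set" and I' :: "'n \<Rightarrow> 'c set" and J' :: "'n \<Rightarrow> 'd set"
  assumes fin: "finite M" "\<And>m. m \<in> M \<Longrightarrow> finite (I m) \<and> finite (J m) \<and> psd_on (I m \<times> J m) (\<rho> m)"
    and fin': "finite N" "\<And>n. n \<in> N \<Longrightarrow> finite (I' n) \<and> finite (J' n) \<and> psd_on (I' n \<times> J' n) (\<rho>' n)"
    and le: "\<And>t. 0 < t \<Longrightarrow> t < 1 \<Longrightarrow> (\<Sum>m\<in>M. cchi t (I m) (J m) (\<rho> m)) \<le> (\<Sum>n\<in>N. cchi t (I' n) (J' n) (\<rho>' n))"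
  shows "(\<Sum>m\<in>M. creld (I m) (J m) (\<rho> m)) \<le> (\<Sum>n\<in>N. creld (I' n) (J' n) (\<rho>' n))"
proof -
  let ?S = "SIGMA m:M. (I m \<times> J m) \<times> (I m \<times> J m)" and ?S' = "SIGMA n:N. (I' n \<times> J' n) \<times> (I' n \<times> J' n)"
  have S: "(\<Sum>x\<in>?S. g x) = (\<Sum>m\<in>M. \<Sum>k\<in>I m \<times> J m. \<Sum>l\<in>I m \<times> J m. g (m, k, l))" for g :: "_ \<Rightarrow> real"
    using fin by (subst sum_Sigma) (auto intro!: sum.cong simp: sum_Times[of _ "I _ \<times> J _"])
  have S': "(\<Sum>x\<in>?S'. g x) = (\<Sum>m\<in>N. \<Sum>k\<in>I' m \<times> J' m. \<Sum>l\<in>I' m \<times> J' m. g (m, k, l))" for g :: "_ \<Rightarrow> real"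
    using fin' by (subst sum_Sigma) (auto intro!: sum.cong simp: sum_Times[of _ "I' _ \<times> J' _"])
  define p where "p = (\<lambda>(m, k, l :: 'a \<times> 'b). eigval (I m \<times> J m) (\<rho> m) k)"
  define q where "q = (\<lambda>(m, k :: 'a \<times> 'b, l). cref_val (I m) (J m) (\<rho> m) l)"
  define w where "w = (\<lambda>(m, k, l). cweight (I m) (J m) (\<rho> m) k l)"
  define p' where "p' = (\<lambda>(m, k, l :: 'c \<times> 'd). eigval (I' m \<times> J' m) (\<rho>' m) k)"
  define q' where "q' = (\<lambda>(m, k :: 'c \<times> 'd, l). cref_val (I' m) (J' m) (\<rho>' m) l)"
  define w' where "w' = (\<lambda>(m, k, l). cweight (I' m) (J' m) (\<rho>' m) k l)"
  have "(\<Sum>x\<in>?S. w x * (p x * ln (p x) - p x * ln (q x) - p x + q x))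
      \<le> (\<Sum>x\<in>?S'. w' x * (p' x * ln (p' x) - p' x * ln (q' x) - p' x + q' x))"
  proof (rule relative_entropy_le_of_chi_le)
    show "finite ?S" using fin by auto
    show "finite ?S'" using fin' by auto
  next
    fix x assume "x \<in> ?S"
    then obtain m k l where x: "x = (m, k, l)" "m \<in> M" "k \<in> I m \<times> J m" "l \<in> I m \<times> J m" by auto
    then have fm: "finite (I m)" "finite (J m)" "psd_on (I m \<times> J m) (\<rho> m)" using fin by auto
    show "0 \<le> p x \<and> 0 \<le> q x \<and> (q x = 0 \<longrightarrow> p x = 0 \<or> w x = 0)"
      unfolding x(1) p_def q_def w_def split_conv
      using eig_spectral(3)[OF _ fm(3) x(3)] cref_spectral(3)[OF fm x(4)] cweight_support[OF fm x(3,4)] fm by auto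
  next
    fix x assume "x \<in> ?S'"
    then obtain m k l where x: "x = (m, k, l)" "m \<in> N" "k \<in> I' m \<times> J' m" "l \<in> I' m \<times> J' m" by auto
    then have fm: "finite (I' m)" "finite (J' m)" "psd_on (I' m \<times> J' m) (\<rho>' m)" using fin' by auto
    show "0 \<le> p' x \<and> 0 \<le> q' x \<and> (q' x = 0 \<longrightarrow> p' x = 0 \<or> w' x = 0)"
      unfolding x(1) p'_def q'_def w'_def split_conv
      using eig_spectral(3)[OF _ fm(3) x(3)] cref_spectral(3)[OF fm x(4)] cweight_support[OF fm x(3,4)] fm by auto
  next
    fix t :: real assume t: "0 < t" "t < 1"
    show "(\<Sum>x\<in>?S. w x * ((p x - q x)\<^sup>2 / ((1 - t) * p x + t * q x)))
      \<le> (\<Sum>x\<in>?S'. w' x * ((p' x - q' x)\<^sup>2 / ((1 - t) * p' x + t * q' x)))"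
      using le[OF t] unfolding S S' by (simp add: cchi_def p_def q_def w_def p'_def q'_def w'_def)
  qed
  then show ?thesis
    unfolding S S' by (simp add: creld_def p_def q_def w_def p'_def q'_def w'_def)
qed

subsection \<open>Superadditivity, pinching and strong subadditivity\<close>

lemma vfun_add:
  "vfun t I (\<lambda>x y. \<rho> x y + \<rho>' x y) (\<lambda>x y. \<sigma> x y + \<sigma>' x y) X = vfun t I \<rho> \<sigma> X + vfun t I \<rho>' \<sigma>' X"
  unfolding vfun_def by (simp add: algebra_simps sum.distrib sum_distrib_left sum_subtractf)

lemma vfun_sum:
  assumes "finite M"
  shows "vfun t I (\<lambda>x y. \<Sum>m\<in>M. \<rho> m x y) (\<lambda>x y. \<Sum>m\<in>M. \<sigma> m x y) X = (\<Sum>m\<in>M. vfun t I (\<rho> m) (\<sigma> m) X)"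
  using assms
proof (induction M rule: finite_induct)
  case empty
  then show ?case by (simp add: vfun_def)
next
  case (insert m M)
  then show ?case by (simp add: vfun_add)
qed

lemma ent_zero: "ent I (\<lambda>_ _. 0) = 0"
proof -
  have "diag_on I (\<lambda>_ _. 0) ({} :: nat set) (\<lambda>_. 0) (\<lambda>_ _. 0)" by (simp add: diag_on_def orthonormal_on_def)
  from ent_eq[OF this] show ?thesis by simp
qed

lemma ent_empty: "ent {} \<rho> = 0"
  using ent_cong[of "{}" \<rho> "\<lambda>_ _. 0"] by (simp add: ent_zero)

lemma cent_empty: "cent {} J \<rho> = 0"
  by (simp add: cent_def ent_empty ent_zero ptr_def)

lemma cent_cong:
  assumes "\<And>x y. x \<in> I \<times> J \<Longrightarrow> y \<in> I \<times> J \<Longrightarrow> \<rho> x y = \<sigma> x y"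
  shows "cent I J \<rho> = cent I J \<sigma>"
proof -
  have "ent J (ptr I \<rho>) = ent J (ptr I \<sigma>)"
    by (rule ent_cong) (auto simp: ptr_def assms intro!: sum.cong)
  then show ?thesis unfolding cent_def using ent_cong[of "I \<times> J" \<rho> \<sigma>] assms by auto
qed

lemma otr_sum: "otr I (\<lambda>x y. \<Sum>m\<in>M. \<rho> m x y) = (\<Sum>m\<in>M. otr I (\<rho> m))"
  unfolding otr_def Re_sum by (rule sum.swap)

text \<open>The optimal \<open>X\<close> for the sum is a feasible \<open>X\<close> for every summand, and \<open>vfun\<close> is linear in the operators.\<close>

lemma cent_superadditive:
  assumes fin: "finite M" "finite I" "finite J" and psd: "\<And>m. m \<in> M \<Longrightarrow> psd_on (I \<times> J) (\<rho> m)"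
  shows "(\<Sum>m\<in>M. cent I J (\<rho> m)) \<le> cent I J (\<lambda>x y. \<Sum>m\<in>M. \<rho> m x y)"
proof (cases "I = {}")
  case True
  then show ?thesis by (simp add: cent_empty)
next
  case False
  let ?\<rho> = "\<lambda>x y. \<Sum>m\<in>M. \<rho> m x y"
  have psd': "psd_on (I \<times> J) ?\<rho>" by (rule psd_on_sum[OF fin(1) psd])
  have "(\<Sum>u\<in>{()}. creld I J ?\<rho>) \<le> (\<Sum>m\<in>M. creld I J (\<rho> m))"
  proof (rule creld_sum_le)
    fix t :: real assume t: "0 < t" "t < 1"
    obtain X where X: "Re (vfun t (I \<times> J) ?\<rho> (cref I J ?\<rho>) X) = cchi t I J ?\<rho>"
      using cchi_attained[OF fin(2,3) psd' t] by blast
    \<comment> \<open>The reference depends linearly on the operator, so the sum of the pairs is the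
      pair of the sums.\<close>
    have "cref I J ?\<rho> = (\<lambda>x y. \<Sum>m\<in>M. cref I J (\<rho> m) x y)"
      unfolding cref_def ptr_def fun_eq_iff
      by (subst sum.swap) (simp add: sum_distrib_left sum_divide_distrib)
    then have "cchi t I J ?\<rho> = (\<Sum>m\<in>M. Re (vfun t (I \<times> J) (\<rho> m) (cref I J (\<rho> m)) X))"
      using X by (simp add: vfun_sum[OF fin(1)])
    also have "\<dots> \<le> (\<Sum>m\<in>M. cchi t I J (\<rho> m))"
      by (intro sum_mono cchi_ge fin psd t)
    finally show "(\<Sum>u\<in>{()}. cchi t I J ?\<rho>) \<le> (\<Sum>m\<in>M. cchi t I J (\<rho> m))" by simp
  qed (use fin psd psd' in auto)
  then show ?thesis
    by (simp add: creld_eq[OF fin(2,3) psd False] creld_eq[OF fin(2,3) psd' False] otr_sum sum_subtractf sum_distrib_right)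
qed

lemma sum_pinch:
  "(\<Sum>x\<in>I \<times> (J \<times> M). g x) = (\<Sum>m\<in>M. \<Sum>y\<in>I \<times> J. g (fst y, (snd y, m)))"
proof -
  have "(\<Sum>x\<in>I \<times> (J \<times> M). g x) = (\<Sum>i\<in>I. \<Sum>m\<in>M. \<Sum>j\<in>J. g (i, (j, m)))"
    unfolding sum_Times by (intro sum.cong refl sum.swap)
  also have "\<dots> = (\<Sum>m\<in>M. \<Sum>y\<in>I \<times> J. g (fst y, (snd y, m)))"
    unfolding sum_Times by (subst sum.swap) simp
  finally show ?thesis .
qed

lemma sum_block:
  fixes g :: "'m \<Rightarrow> 'a \<Rightarrow> 'b :: comm_semiring_1"
  assumes "finite M" "m \<in> M"
  shows "(\<Sum>m'\<in>M. \<Sum>y\<in>S. of_bool (m = m') * g m' y) = (\<Sum>y\<in>S. g m y)"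
  unfolding sum_distrib_left[symmetric] using assms by (rule sum_of_bool_left')

text \<open>A block diagonal \<open>X\<close> meets only the diagonal blocks of the two operators;
  their off-diagonal blocks drop out of all three terms.\<close>

lemma vfun_pinch:
  fixes F :: "'m \<Rightarrow> 'i \<times> 'j \<Rightarrow> 'i \<times> 'j \<Rightarrow> complex"
  assumes fin: "finite M"
  shows "vfun t (I \<times> (J \<times> M)) \<rho> \<sigma> (\<lambda>x y. of_bool (snd (snd x) = snd (snd y)) * F (snd (snd x)) (fst x, fst (snd x)) (fst y, fst (snd y)))
    = (\<Sum>m\<in>M. vfun t (I \<times> J) (\<lambda>x y. \<rho> (fst x, (snd x, m)) (fst y, (snd y, m)))
        (\<lambda>x y. \<sigma> (fst x, (snd x, m)) (fst y, (snd y, m))) (F m))"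
proof -
  let ?X = "\<lambda>x y. of_bool (snd (snd x) = snd (snd y)) * F (snd (snd x)) (fst x, fst (snd x)) (fst y, fst (snd y))"
  let ?e = "\<lambda>m y. (fst y, (snd y, m))"
  let ?S = "I \<times> J"
  have A: "(\<Sum>x\<in>I \<times> (J \<times> M). \<Sum>y\<in>I \<times> (J \<times> M). 2 * (cnj (?X x y) * (\<rho> x y - \<sigma> x y)))
      = (\<Sum>m\<in>M. \<Sum>x\<in>?S. \<Sum>y\<in>?S. 2 * (cnj (F m x y) * (\<rho> (?e m x) (?e m y) - \<sigma> (?e m x) (?e m y))))"
    unfolding sum_pinch
  proof (intro sum.cong refl)
    fix m x assume m: "m \<in> M"
    have "(\<Sum>m'\<in>M. \<Sum>y\<in>?S. 2 * (cnj (?X (?e m x) (?e m' y)) * (\<rho> (?e m x) (?e m' y) - \<sigma> (?e m x) (?e m' y))))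
        = (\<Sum>m'\<in>M. \<Sum>y\<in>?S. of_bool (m = m') * (2 * (cnj (F m x y) * (\<rho> (?e m x) (?e m' y) - \<sigma> (?e m x) (?e m' y)))))"
      by (intro sum.cong refl) (auto simp: of_bool_def)
    also have "\<dots> = (\<Sum>y\<in>?S. 2 * (cnj (F m x y) * (\<rho> (?e m x) (?e m y) - \<sigma> (?e m x) (?e m y))))"
      by (rule sum_block[OF fin m])
    finally show "(\<Sum>m'\<in>M. \<Sum>y\<in>?S. 2 * (cnj (?X (?e m x) (?e m' y)) * (\<rho> (?e m x) (?e m' y) - \<sigma> (?e m x) (?e m' y))))
        = \<dots>" .
  qed
  have B: "(\<Sum>j\<in>I \<times> (J \<times> M). \<Sum>i\<in>I \<times> (J \<times> M). \<Sum>i'\<in>I \<times> (J \<times> M). cnj (?X i j) * \<rho> i i' * ?X i' j)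
      = (\<Sum>m\<in>M. \<Sum>j\<in>?S. \<Sum>i\<in>?S. \<Sum>i'\<in>?S. cnj (F m i j) * \<rho> (?e m i) (?e m i') * F m i' j)"
    unfolding sum_pinch
  proof (intro sum.cong refl)
    fix m j assume m: "m \<in> M"
    have "(\<Sum>m1\<in>M. \<Sum>i\<in>?S. \<Sum>m2\<in>M. \<Sum>i'\<in>?S. cnj (?X (?e m1 i) (?e m j)) * \<rho> (?e m1 i) (?e m2 i') * ?X (?e m2 i') (?e m j))
        = (\<Sum>m1\<in>M. \<Sum>i\<in>?S. of_bool (m = m1) * (\<Sum>m2\<in>M. \<Sum>i'\<in>?S. of_bool (m = m2) *
            (cnj (F m1 i j) * \<rho> (?e m1 i) (?e m2 i') * F m2 i' j)))"
      unfolding sum_distrib_left by (intro sum.cong refl) (auto simp: of_bool_def)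
    also have "\<dots> = (\<Sum>i\<in>?S. \<Sum>m2\<in>M. \<Sum>i'\<in>?S. of_bool (m = m2) *
            (cnj (F m i j) * \<rho> (?e m i) (?e m2 i') * F m2 i' j))"
      by (rule sum_block[OF fin m])
    also have "\<dots> = (\<Sum>i\<in>?S. \<Sum>i'\<in>?S. cnj (F m i j) * \<rho> (?e m i) (?e m i') * F m i' j)"
      by (intro sum.cong refl sum_block[OF fin m])
    finally show "(\<Sum>m1\<in>M. \<Sum>i\<in>?S. \<Sum>m2\<in>M. \<Sum>i'\<in>?S. cnj (?X (?e m1 i) (?e m j)) * \<rho> (?e m1 i) (?e m2 i') * ?X (?e m2 i') (?e m j))
        = \<dots>" .
  qed
  have C: "(\<Sum>i\<in>I \<times> (J \<times> M). \<Sum>j\<in>I \<times> (J \<times> M). \<Sum>j'\<in>I \<times> (J \<times> M). ?X i j * \<sigma> j j' * cnj (?X i j'))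
      = (\<Sum>m\<in>M. \<Sum>i\<in>?S. \<Sum>j\<in>?S. \<Sum>j'\<in>?S. F m i j * \<sigma> (?e m j) (?e m j') * cnj (F m i j'))"
    unfolding sum_pinch
  proof (intro sum.cong refl)
    fix m i assume m: "m \<in> M"
    have "(\<Sum>m1\<in>M. \<Sum>j\<in>?S. \<Sum>m2\<in>M. \<Sum>j'\<in>?S. ?X (?e m i) (?e m1 j) * \<sigma> (?e m1 j) (?e m2 j') * cnj (?X (?e m i) (?e m2 j')))
        = (\<Sum>m1\<in>M. \<Sum>j\<in>?S. of_bool (m = m1) * (\<Sum>m2\<in>M. \<Sum>j'\<in>?S. of_bool (m = m2) *
            (F m1 i j * \<sigma> (?e m1 j) (?e m2 j') * cnj (F m2 i j'))))"
      unfolding sum_distrib_left by (intro sum.cong refl) (auto simp: of_bool_def)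
    also have "\<dots> = (\<Sum>j\<in>?S. \<Sum>m2\<in>M. \<Sum>j'\<in>?S. of_bool (m = m2) *
            (F m i j * \<sigma> (?e m j) (?e m2 j') * cnj (F m2 i j')))"
      by (rule sum_block[OF fin m])
    also have "\<dots> = (\<Sum>j\<in>?S. \<Sum>j'\<in>?S. F m i j * \<sigma> (?e m j) (?e m j') * cnj (F m i j'))"
      by (intro sum.cong refl sum_block[OF fin m])
    finally show "(\<Sum>m1\<in>M. \<Sum>j\<in>?S. \<Sum>m2\<in>M. \<Sum>j'\<in>?S. ?X (?e m i) (?e m1 j) * \<sigma> (?e m1 j) (?e m2 j') * cnj (?X (?e m i) (?e m2 j')))
        = \<dots>" .
  qed
  show ?thesis
    unfolding vfun_def A B C by (simp only: sum_subtractf sum_distrib_left)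
qed

text \<open>Block diagonal \<open>X\<close>, built from the optimal ones of the blocks, are feasible for the whole operator.\<close>

lemma cent_pinching:
  fixes I :: "'i set" and J :: "'j set" and M :: "'m set"
  assumes fin: "finite I" "finite J" "finite M" and psd: "psd_on (I \<times> (J \<times> M)) \<rho>"
  shows "cent I (J \<times> M) \<rho> \<le> (\<Sum>m\<in>M. cent I J (\<lambda>x y. \<rho> (fst x, (snd x, m)) (fst y, (snd y, m))))"
proof (cases "I = {}")
  case True
  then show ?thesis by (simp add: cent_empty)
next
  case False
  define R where "R m = (\<lambda>x y. \<rho> (fst x, (snd x, m)) (fst y, (snd y, m)))" for m
  have psdR: "psd_on (I \<times> J) (R m)" if "m \<in> M" for m
    unfolding R_def using psd_on_reindex[OF psd, of "I \<times> J" "\<lambda>x. (fst x, (snd x, m))"] that by auto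
  have fJM: "finite (J \<times> M)" using fin by simp
  have "(\<Sum>m\<in>M. creld I J (R m)) \<le> (\<Sum>u\<in>{()}. creld I (J \<times> M) \<rho>)"
  proof (rule creld_sum_le)
    fix t :: real assume t: "0 < t" "t < 1"
    have "\<forall>m\<in>M. \<exists>X. Re (vfun t (I \<times> J) (R m) (cref I J (R m)) X) = cchi t I J (R m)"
      using cchi_attained[OF fin(1,2) psdR t] by blast
    from bchoice[OF this] obtain F :: "'m \<Rightarrow> 'i \<times> 'j \<Rightarrow> 'i \<times> 'j \<Rightarrow> complex" where
      F: "\<forall>m\<in>M. Re (vfun t (I \<times> J) (R m) (cref I J (R m)) (F m)) = cchi t I J (R m)" ..
    \<comment> \<open>Taking a diagonal block commutes with forming the reference, so the blocks of
      the reference are the right partners for \<open>R m\<close>.\<close>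
    have cr: "cref I J (R m) = (\<lambda>x y. cref I (J \<times> M) \<rho> (fst x, (snd x, m)) (fst y, (snd y, m)))" for m
      by (simp add: cref_def ptr_def R_def fun_eq_iff)
    have "(\<Sum>m\<in>M. cchi t I J (R m)) = (\<Sum>m\<in>M. Re (vfun t (I \<times> J) (R m) (cref I J (R m)) (F m)))"
      using F by simp
    also have "\<dots> = Re (vfun t (I \<times> (J \<times> M)) \<rho> (cref I (J \<times> M) \<rho>)
        (\<lambda>x y. of_bool (snd (snd x) = snd (snd y)) * F (snd (snd x)) (fst x, fst (snd x)) (fst y, fst (snd y))))"
      unfolding vfun_pinch[OF fin(3)] Re_sum cr by (simp add: R_def)
    also have "\<dots> \<le> cchi t I (J \<times> M) \<rho>"
      by (rule cchi_ge[OF fin(1) fJM psd t])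
    finally show "(\<Sum>m\<in>M. cchi t I J (R m)) \<le> (\<Sum>u\<in>{()}. cchi t I (J \<times> M) \<rho>)" by simp
  qed (use fin psd psdR in auto)
  moreover have "otr (I \<times> (J \<times> M)) \<rho> = (\<Sum>m\<in>M. otr (I \<times> J) (R m))"
    unfolding otr_def sum_pinch R_def ..
  ultimately have "cent I (J \<times> M) \<rho> \<le> (\<Sum>m\<in>M. cent I J (R m))"
    by (simp add: creld_eq[OF fin(1,2) psdR False] creld_eq[OF fin(1) fJM psd False] sum_subtractf sum_distrib_right)
  then show ?thesis by (simp add: R_def)
qed

text \<open>Tracing out \<open>M\<close> is measuring it in its basis and forgetting the outcome:
  pinching is the first step, superadditivity the second, and neither lowers the conditional
  entropy.\<close>

lemma strong_subadditivity:
  assumes fin: "finite I" "finite J" "finite M" and psd: "psd_on (I \<times> (J \<times> M)) \<rho>"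
  shows "cent I (J \<times> M) \<rho> \<le> cent I J (\<lambda>x y. \<Sum>m\<in>M. \<rho> (fst x, (snd x, m)) (fst y, (snd y, m)))"
proof -
  have "psd_on (I \<times> J) (\<lambda>x y. \<rho> (fst x, (snd x, m)) (fst y, (snd y, m)))" if "m \<in> M" for m
    using psd_on_reindex[OF psd, of "I \<times> J" "\<lambda>x. (fst x, (snd x, m))"] that by auto
  then have "(\<Sum>m\<in>M. cent I J (\<lambda>x y. \<rho> (fst x, (snd x, m)) (fst y, (snd y, m))))
      \<le> cent I J (\<lambda>x y. \<Sum>m\<in>M. \<rho> (fst x, (snd x, m)) (fst y, (snd y, m)))"
    by (rule cent_superadditive[OF fin(3,1,2)])
  with cent_pinching[OF assms] show ?thesis by linarith
qed

section \<open>Conditional mutual information\<close>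

text \<open>Systems are nested as \<open>A \<times> (B \<times> E)\<close> and \<open>ptr\<close>
  removes the outermost factor; \<open>swp\<close> brings \<open>B\<close> to the front so that it
  can be traced out or acted upon.\<close>

definition swp :: "('a \<times> ('b \<times> 'e) \<Rightarrow> 'a \<times> ('b \<times> 'e) \<Rightarrow> complex) \<Rightarrow> 'b \<times> ('a \<times> 'e) \<Rightarrow> 'b \<times> ('a \<times> 'e) \<Rightarrow> complex" where
  "swp \<sigma> = (\<lambda>x y. \<sigma> (fst (snd x), (fst x, snd (snd x))) (fst (snd y), (fst y, snd (snd y))))"

definition cmi :: "'a set \<Rightarrow> 'b set \<Rightarrow> 'e set \<Rightarrow> ('a \<times> ('b \<times> 'e) \<Rightarrow> 'a \<times> ('b \<times> 'e) \<Rightarrow> complex) \<Rightarrow> real" where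
  "cmi A B E \<sigma> = ent (A \<times> E) (ptr B (swp \<sigma>)) + ent (B \<times> E) (ptr A \<sigma>) - ent (A \<times> (B \<times> E)) \<sigma> - ent E (ptr B (ptr A \<sigma>))"

lemma bij_betw_swp: "bij_betw (\<lambda>x. (fst (snd x), (fst x, snd (snd x)))) (B \<times> (A \<times> E)) (A \<times> (B \<times> E))"
  by (rule bij_betw_byWitness[where f'="\<lambda>x. (fst (snd x), (fst x, snd (snd x)))"]) auto

lemma psd_on_swp:
  assumes "psd_on (A \<times> (B \<times> E)) \<sigma>"
  shows "psd_on (B \<times> (A \<times> E)) (swp \<sigma>)"
  unfolding swp_def by (rule psd_on_reindex[OF assms, where h="\<lambda>x. (fst (snd x), (fst x, snd (snd x)))"]) auto

lemma ent_swp: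
  assumes "finite A" "finite B" "finite E" "psd_on (A \<times> (B \<times> E)) \<sigma>"
  shows "ent (B \<times> (A \<times> E)) (swp \<sigma>) = ent (A \<times> (B \<times> E)) \<sigma>"
  unfolding swp_def by (rule ent_reindex[OF _ assms(4) bij_betw_swp]) (use assms in simp)

lemma swp_swp: "swp (swp \<sigma>) = \<sigma>"
  by (simp add: swp_def)

lemma ptr_ptr_swp: "ptr A (ptr B (swp \<sigma>)) = ptr B (ptr A \<sigma>)"
  unfolding ptr_def swp_def fun_eq_iff by (simp, subst sum.swap, simp)

lemma cmi_swp:
  assumes "finite A" "finite B" "finite E" "psd_on (A \<times> (B \<times> E)) \<sigma>"
  shows "cmi B A E (swp \<sigma>) = cmi A B E \<sigma>"
  unfolding cmi_def swp_swp ptr_ptr_swp ent_swp[OF assms] by simp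

text \<open>The reading S(B|E) - S(B|AE), in which \<open>A\<close> occurs only as a condition,
  suits operations on \<open>A\<close>. The reading S(A|E) - S(A|BE) of \<open>cmi_eq_A\<close>
  gives the lower bound by the coherent information.\<close>

lemma cmi_eq_B:
  assumes "finite A" "finite B" "finite E" "psd_on (A \<times> (B \<times> E)) \<sigma>"
  shows "cmi A B E \<sigma> = cent B E (ptr A \<sigma>) - cent B (A \<times> E) (swp \<sigma>)"
  unfolding cmi_def cent_def ent_swp[OF assms] by simp

lemma cmi_eq_A: "cmi A B E \<sigma> = cent A E (ptr B (swp \<sigma>)) - cent A (B \<times> E) \<sigma>"
  unfolding cmi_def cent_def ptr_ptr_swp by simp

text \<open>By concavity it suffices to consider pure states, for which both sides are equal.\<close>

lemma weak_monotonicity: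
  assumes fin: "finite A" "finite B" "finite E" and psd: "psd_on (A \<times> (B \<times> E)) \<sigma>"
  shows "- cent A B (\<lambda>x y. \<Sum>e\<in>E. \<sigma> (fst x, (snd x, e)) (fst y, (snd y, e))) \<le> cent A E (ptr B (swp \<sigma>))"
proof -
  obtain K :: "nat set" and v where K: "finite K"
    and v': "\<forall>i\<in>A \<times> (B \<times> E). \<forall>j\<in>A \<times> (B \<times> E). \<sigma> i j = (\<Sum>k\<in>K. v k i * cnj (v k j))"
    using psd unfolding psd_on_def by blast
  have v: "\<sigma> i j = (\<Sum>k\<in>K. v k i * cnj (v k j))" if "i \<in> A \<times> (B \<times> E)" "j \<in> A \<times> (B \<times> E)" for i j
    using v' that by blast
  define P where "P k = (\<lambda>x y. v k x * cnj (v k y))" for k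
  have psdP: "psd_on (A \<times> (B \<times> E)) (P k)" for k
    by (rule psd_onI[of "{k}" _ _ v]) (auto simp: P_def)
  define AE where "AE k = ptr B (swp (P k))" for k
  define AB where "AB k = (\<lambda>x y. \<Sum>e\<in>E. P k (fst x, (snd x, e)) (fst y, (snd y, e)))" for k
  have psdAE: "psd_on (A \<times> E) (AE k)" for k
    unfolding AE_def by (intro psd_on_ptr fin psd_on_swp psdP)
  have psdAB: "psd_on (A \<times> B) (AB k)" for k
  proof -
    have "psd_on (A \<times> B) (\<lambda>x y. P k (fst x, (snd x, e)) (fst y, (snd y, e)))" if "e \<in> E" for e
      using psd_on_reindex[OF psdP, of "A \<times> B" "\<lambda>x. (fst x, (snd x, e))"] that by auto
    then show ?thesis unfolding AB_def by (rule psd_on_sum[OF fin(3)])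
  qed
  \<comment> \<open>For a pure operator the complementary pairs \<open>A E\<close>, \<open>B\<close>
    and \<open>A B\<close>, \<open>E\<close> have equal entropies, so the two conditional entropies
    are opposite.\<close>
  have pure: "cent A E (AE k) + cent A B (AB k) = 0" for k
  proof -
    have "ent (A \<times> E) (\<lambda>x y. \<Sum>b\<in>B. v k (fst x, (b, snd x)) * cnj (v k (fst y, (b, snd y))))
        = ent B (\<lambda>x y. \<Sum>i\<in>A \<times> E. v k (fst i, (x, snd i)) * cnj (v k (fst i, (y, snd i))))"
      using ent_pure[of "A \<times> E" B "\<lambda>z. v k (fst (fst z), (snd z, snd (fst z)))"] fin by simp
    then have 1: "ent (A \<times> E) (AE k) = ent B (ptr A (AB k))"
      by (simp add: AE_def AB_def P_def ptr_def swp_def sum_Times)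
    have "ent (A \<times> B) (\<lambda>x y. \<Sum>e\<in>E. v k (fst x, (snd x, e)) * cnj (v k (fst y, (snd y, e))))
        = ent E (\<lambda>x y. \<Sum>i\<in>A \<times> B. v k (fst i, (snd i, x)) * cnj (v k (fst i, (snd i, y))))"
      using ent_pure[of "A \<times> B" E "\<lambda>z. v k (fst (fst z), (snd (fst z), snd z))"] fin by simp
    then have 2: "ent (A \<times> B) (AB k) = ent E (ptr A (AE k))"
      by (simp add: AE_def AB_def P_def ptr_def swp_def sum_Times)
    show ?thesis unfolding cent_def 1 2 by simp
  qed
  have "(\<Sum>k\<in>K. cent A E (AE k)) \<le> cent A E (\<lambda>x y. \<Sum>k\<in>K. AE k x y)"
    by (rule cent_superadditive[OF K fin(1,3) psdAE])
  also have "\<dots> = cent A E (ptr B (swp \<sigma>))"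
  proof (rule cent_cong)
    fix x y assume xy: "x \<in> A \<times> E" "y \<in> A \<times> E"
    have "(\<Sum>k\<in>K. AE k x y) = (\<Sum>b\<in>B. \<Sum>k\<in>K. v k (fst x, (b, snd x)) * cnj (v k (fst y, (b, snd y))))"
      by (subst sum.swap) (simp add: AE_def P_def ptr_def swp_def)
    also have "\<dots> = (\<Sum>b\<in>B. \<sigma> (fst x, (b, snd x)) (fst y, (b, snd y)))"
      using xy by (intro sum.cong refl v[symmetric]) auto
    finally show "(\<Sum>k\<in>K. AE k x y) = ptr B (swp \<sigma>) x y" by (simp add: ptr_def swp_def)
  qed
  finally have 1: "(\<Sum>k\<in>K. cent A E (AE k)) \<le> cent A E (ptr B (swp \<sigma>))" .
  have "(\<Sum>k\<in>K. cent A B (AB k)) \<le> cent A B (\<lambda>x y. \<Sum>k\<in>K. AB k x y)"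
    by (rule cent_superadditive[OF K fin(1,2) psdAB])
  also have "\<dots> = cent A B (\<lambda>x y. \<Sum>e\<in>E. \<sigma> (fst x, (snd x, e)) (fst y, (snd y, e)))"
  proof (rule cent_cong)
    fix x y assume xy: "x \<in> A \<times> B" "y \<in> A \<times> B"
    have "(\<Sum>k\<in>K. AB k x y) = (\<Sum>e\<in>E. \<Sum>k\<in>K. v k (fst x, (snd x, e)) * cnj (v k (fst y, (snd y, e))))"
      by (subst sum.swap) (simp add: AB_def P_def)
    also have "\<dots> = (\<Sum>e\<in>E. \<sigma> (fst x, (snd x, e)) (fst y, (snd y, e)))"
      using xy by (intro sum.cong refl v[symmetric]) auto
    finally show "(\<Sum>k\<in>K. AB k x y) = (\<Sum>e\<in>E. \<sigma> (fst x, (snd x, e)) (fst y, (snd y, e)))" .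
  qed
  finally have 2: "(\<Sum>k\<in>K. cent A B (AB k)) \<le> cent A B (\<lambda>x y. \<Sum>e\<in>E. \<sigma> (fst x, (snd x, e)) (fst y, (snd y, e)))" .
  have "(\<Sum>k\<in>K. cent A E (AE k)) + (\<Sum>k\<in>K. cent A B (AB k)) = 0"
    unfolding sum.distrib[symmetric] using pure by simp
  with 1 2 show ?thesis by linarith
qed

text \<open>In S(A|E) - S(A|BE), weak monotonicity bounds the first term below by - S(A|B) and
  strong subadditivity bounds S(A|BE) above by S(A|B). What remains depends on the state of
  \<open>A B\<close> alone.\<close>

lemma cmi_ge_coherent_information:
  assumes fin: "finite A" "finite B" "finite E" and psd: "psd_on (A \<times> (B \<times> E)) \<sigma>"
  shows "- 2 * cent A B (\<lambda>x y. \<Sum>e\<in>E. \<sigma> (fst x, (snd x, e)) (fst y, (snd y, e))) \<le> cmi A B E \<sigma>"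
  using weak_monotonicity[OF assms] strong_subadditivity[OF assms] unfolding cmi_eq_A by linarith

section \<open>Local instruments with one Kraus operator per outcome\<close>

definition conj_fst :: "'a set \<Rightarrow> ('z \<Rightarrow> 'a \<Rightarrow> complex) \<Rightarrow> ('a \<times> 'x \<Rightarrow> 'a \<times> 'x \<Rightarrow> complex) \<Rightarrow> 'z \<times> 'x \<Rightarrow> 'z \<times> 'x \<Rightarrow> complex" where
  "conj_fst A N \<rho> = (\<lambda>x y. \<Sum>a\<in>A. \<Sum>b\<in>A. N (fst x) a * \<rho> (a, snd x) (b, snd y) * cnj (N (fst y) b))"

lemma psd_on_conj_fst:
  assumes "finite A" "finite X" "psd_on (A \<times> X) \<rho>"
  shows "psd_on (Z \<times> X) (conj_fst A N \<rho>)"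
proof -
  have *: "psd_on (Z \<times> X) (\<lambda>x y. \<Sum>i\<in>A \<times> X. \<Sum>j\<in>A \<times> X.
      (of_bool (snd x = snd i) * N (fst x) (fst i)) * \<rho> i j * cnj (of_bool (snd y = snd j) * N (fst y) (fst j)))"
    by (rule psd_on_conj[OF assms(3), where N="\<lambda>x i. of_bool (snd x = snd i) * N (fst x) (fst i)"])
  show ?thesis
  proof (rule iffD1[OF psd_on_cong *])
    fix x y assume xy: "x \<in> Z \<times> X" "y \<in> Z \<times> X"
    then have m: "snd x \<in> X" "snd y \<in> X" by auto
    have "(\<Sum>i\<in>A \<times> X. \<Sum>j\<in>A \<times> X.
        (of_bool (snd x = snd i) * N (fst x) (fst i)) * \<rho> i j * cnj (of_bool (snd y = snd j) * N (fst y) (fst j)))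
      = (\<Sum>a\<in>A. \<Sum>c\<in>X. of_bool (snd x = c) * (\<Sum>b\<in>A. \<Sum>d\<in>X. of_bool (snd y = d) *
          (N (fst x) a * \<rho> (a, c) (b, d) * cnj (N (fst y) b))))"
      unfolding sum_Times sum_distrib_left by (intro sum.cong refl) simp
    also have "\<dots> = conj_fst A N \<rho> x y"
      unfolding conj_fst_def sum_of_bool_left'[OF assms(2) m(1)] sum_of_bool_left'[OF assms(2) m(2)] ..
    finally show "(\<Sum>i\<in>A \<times> X. \<Sum>j\<in>A \<times> X.
        (of_bool (snd x = snd i) * N (fst x) (fst i)) * \<rho> i j * cnj (of_bool (snd y = snd j) * N (fst y) (fst j)))
      = conj_fst A N \<rho> x y" .
  qed
qed

lemma ent_conj_fst:
  assumes "finite A" "finite X" "finite Z" "psd_on (A \<times> X) \<rho>"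
    "\<And>a b. a \<in> A \<Longrightarrow> b \<in> A \<Longrightarrow> (\<Sum>z\<in>Z. cnj (N z a) * N z b) = of_bool (a = b)"
  shows "ent (Z \<times> X) (conj_fst A N \<rho>) = ent (A \<times> X) \<rho>"
  unfolding conj_fst_def by (rule ent_isometry[OF assms])

text \<open>No signalling: by cyclicity of the trace over the first system only the total of the
  products N^* N enters, and this is the identity.\<close>

lemma sum_ptr_conj_fst:
  assumes fin: "finite A"
    and N: "\<And>a b. a \<in> A \<Longrightarrow> b \<in> A \<Longrightarrow> (\<Sum>m\<in>M. \<Sum>r\<in>A1. cnj (N m r a) * N m r b) = of_bool (a = b)"
  shows "(\<lambda>x y. \<Sum>m\<in>M. ptr A1 (conj_fst A (N m) \<sigma>) x y) = ptr A \<sigma>"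
proof (intro ext)
  fix x y
  have "(\<Sum>m\<in>M. ptr A1 (conj_fst A (N m) \<sigma>) x y) = (\<Sum>m\<in>M. \<Sum>r\<in>A1. \<Sum>a\<in>A. \<Sum>b\<in>A. (cnj (N m r b) * N m r a) * \<sigma> (a, x) (b, y))"
    by (simp add: ptr_def conj_fst_def mult_ac)
  also have "\<dots> = (\<Sum>m\<in>M. \<Sum>a\<in>A. \<Sum>b\<in>A. \<Sum>r\<in>A1. (cnj (N m r b) * N m r a) * \<sigma> (a, x) (b, y))"
    by (rule sum.cong[OF refl], subst sum.swap, rule sum.cong[OF refl], rule sum.swap)
  also have "\<dots> = (\<Sum>a\<in>A. \<Sum>b\<in>A. \<Sum>m\<in>M. \<Sum>r\<in>A1. (cnj (N m r b) * N m r a) * \<sigma> (a, x) (b, y))"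
    by (subst sum.swap, rule sum.cong[OF refl], rule sum.swap)
  also have "\<dots> = (\<Sum>a\<in>A. \<Sum>b\<in>A. of_bool (b = a) * \<sigma> (a, x) (b, y))"
    unfolding sum_distrib_right[symmetric] by (intro sum.cong refl) (simp add: N)
  also have "\<dots> = ptr A \<sigma> x y"
    unfolding ptr_def using fin by (intro sum.cong refl sum_of_bool_left) auto
  finally show "(\<Sum>m\<in>M. ptr A1 (conj_fst A (N m) \<sigma>) x y) = ptr A \<sigma> x y" .
qed

lemma otr_instrument:
  assumes "finite A"
    and "\<And>a b. a \<in> A \<Longrightarrow> b \<in> A \<Longrightarrow> (\<Sum>m\<in>M. \<Sum>r\<in>A1. cnj (N m r a) * N m r b) = of_bool (a = b)"
  shows "(\<Sum>m\<in>M. otr (A1 \<times> X) (conj_fst A (N m) \<sigma>)) = otr (A \<times> X) \<sigma>"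
  unfolding otr_ptr[symmetric] otr_sum[symmetric] by (rule arg_cong[OF sum_ptr_conj_fst[OF assms]])

text \<open>An instrument with one Kraus operator \<open>N m\<close> per outcome is the isometry with entries \<open>N m r a\<close>, from \<open>A\<close> to
  \<open>A1 \<times> M\<close>, followed by pinching in \<open>M\<close>.\<close>

lemma cmi_instrument_le:
  fixes N :: "'m \<Rightarrow> 'r \<Rightarrow> 'a \<Rightarrow> complex"
  assumes fin: "finite A" "finite B" "finite E" "finite A1" "finite M" and psd: "psd_on (A \<times> (B \<times> E)) \<sigma>"
    and N: "\<And>a b. a \<in> A \<Longrightarrow> b \<in> A \<Longrightarrow> (\<Sum>m\<in>M. \<Sum>r\<in>A1. cnj (N m r a) * N m r b) = of_bool (a = b)"
  shows "(\<Sum>m\<in>M. cmi A1 B E (conj_fst A (N m) \<sigma>)) \<le> cmi A B E \<sigma>"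
proof -
  let ?\<sigma> = "\<lambda>m. conj_fst A (N m) \<sigma>"
  have fBE: "finite (B \<times> E)" using fin by simp
  have psdm: "psd_on (A1 \<times> (B \<times> E)) (?\<sigma> m)" for m
    by (rule psd_on_conj_fst[OF fin(1) fBE psd])
  \<comment> \<open>First term of \<open>cmi_eq_B\<close>: on average the instrument leaves the
    state of \<open>B E\<close> as it was, so superadditivity suffices.\<close>
  have "(\<Sum>m\<in>M. cent B E (ptr A1 (?\<sigma> m))) \<le> cent B E (\<lambda>x y. \<Sum>m\<in>M. ptr A1 (?\<sigma> m) x y)"
    by (rule cent_superadditive[OF fin(5,2,3) psd_on_ptr[OF fin(4) psdm]])
  also have "(\<lambda>x y. \<Sum>m\<in>M. ptr A1 (?\<sigma> m) x y) = ptr A \<sigma>"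
    by (rule sum_ptr_conj_fst[OF fin(1) N])
  finally have 1: "(\<Sum>m\<in>M. cent B E (ptr A1 (?\<sigma> m))) \<le> cent B E (ptr A \<sigma>)" .
  define W where "W z a = N (snd z) (fst z) a" for z a
  let ?Z = "A1 \<times> M"
  have fZ: "finite ?Z" using fin by simp
  have W: "(\<Sum>z\<in>?Z. cnj (W z a) * W z b) = of_bool (a = b)" if "a \<in> A" "b \<in> A" for a b
    unfolding sum_Times W_def using N[OF that] by (subst sum.swap) simp
  define \<tau> where "\<tau> = conj_fst A W \<sigma>"
  have psdt: "psd_on (?Z \<times> (B \<times> E)) \<tau>"
    unfolding \<tau>_def by (rule psd_on_conj_fst[OF fin(1) fBE psd])
  have e1: "ent (?Z \<times> (B \<times> E)) \<tau> = ent (A \<times> (B \<times> E)) \<sigma>"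
    unfolding \<tau>_def by (rule ent_conj_fst[OF fin(1) fBE fZ psd W])
  have psd2: "psd_on (A \<times> E) (ptr B (swp \<sigma>))" by (intro psd_on_ptr psd_on_swp fin psd)
  have "ptr B (swp \<tau>) = conj_fst A W (ptr B (swp \<sigma>))"
  proof (intro ext)
    fix x y
    have "conj_fst A W (ptr B (swp \<sigma>)) x y
        = (\<Sum>a\<in>A. \<Sum>b\<in>A. \<Sum>c\<in>B. W (fst x) a * \<sigma> (a, c, snd x) (b, c, snd y) * cnj (W (fst y) b))"
      by (simp add: conj_fst_def ptr_def swp_def sum_distrib_left sum_distrib_right)
    also have "\<dots> = (\<Sum>c\<in>B. \<Sum>a\<in>A. \<Sum>b\<in>A. W (fst x) a * \<sigma> (a, c, snd x) (b, c, snd y) * cnj (W (fst y) b))"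
      by (subst (2) sum.swap, subst sum.swap, rule refl)
    finally show "ptr B (swp \<tau>) x y = conj_fst A W (ptr B (swp \<sigma>)) x y"
      by (simp add: conj_fst_def ptr_def swp_def \<tau>_def)
  qed
  then have e2: "ent (?Z \<times> E) (ptr B (swp \<tau>)) = ent (A \<times> E) (ptr B (swp \<sigma>))"
    using ent_conj_fst[where N=W and Z="?Z", OF fin(1,3) fZ psd2 W] by simp
  \<comment> \<open>A relabelling that moves the outcome register \<open>M\<close> to the last
    place, where \<open>cent_pinching\<close> acts on it.\<close>
  define g where "g x = ((fst (fst (snd x)), snd (snd x)), (fst x, snd (fst (snd x))))"
    for x :: "'b \<times> (('r \<times> 'c) \<times> 'm)"
  define \<tau>2 where "\<tau>2 = (\<lambda>x y. \<tau> (g x) (g y))"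
  have bg: "bij_betw g (B \<times> ((A1 \<times> E) \<times> M)) (?Z \<times> (B \<times> E))"
    by (rule bij_betw_byWitness[where f'="\<lambda>z. (fst (snd z), ((fst (fst z), snd (snd z)), snd (fst z)))"])
      (auto simp: g_def)
  have psd3: "psd_on (B \<times> ((A1 \<times> E) \<times> M)) \<tau>2"
    unfolding \<tau>2_def by (rule psd_on_reindex[OF psdt]) (use bij_betwE[OF bg] in blast)
  have e3: "ent (B \<times> ((A1 \<times> E) \<times> M)) \<tau>2 = ent (A \<times> (B \<times> E)) \<sigma>"
    unfolding \<tau>2_def e1[symmetric] by (rule ent_reindex[OF _ psdt bg]) (use fin in simp)
  have "ptr B \<tau>2 = (\<lambda>x y. ptr B (swp \<tau>) ((fst (fst x), snd x), snd (fst x)) ((fst (fst y), snd y), snd (fst y)))"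
    by (simp add: \<tau>2_def ptr_def swp_def g_def)
  moreover have "bij_betw (\<lambda>x. ((fst (fst x), snd x), snd (fst x))) ((A1 \<times> E) \<times> M) (?Z \<times> E)"
    by (rule bij_betw_byWitness[where f'="\<lambda>x. ((fst (fst x), snd x), snd (fst x))"]) auto
  moreover have "psd_on (?Z \<times> E) (ptr B (swp \<tau>))" by (intro psd_on_ptr psd_on_swp fin psdt)
  ultimately have e4: "ent ((A1 \<times> E) \<times> M) (ptr B \<tau>2) = ent (A \<times> E) (ptr B (swp \<sigma>))"
    using ent_reindex[of "?Z \<times> E" "ptr B (swp \<tau>)" "\<lambda>x. ((fst (fst x), snd x), snd (fst x))" "(A1 \<times> E) \<times> M"] e2 fin
    by simp
  \<comment> \<open>Second term of \<open>cmi_eq_B\<close>: the isometry changes neither of its two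
    entropies, and pinching \<open>M\<close> can only raise it.\<close>
  have "cent B (A \<times> E) (swp \<sigma>) = cent B ((A1 \<times> E) \<times> M) \<tau>2"
    unfolding cent_def e3 e4 ent_swp[OF fin(1-3) psd] ..
  also have "\<dots> \<le> (\<Sum>m\<in>M. cent B (A1 \<times> E) (\<lambda>x y. \<tau>2 (fst x, (snd x, m)) (fst y, (snd y, m))))"
    by (rule cent_pinching[OF fin(2) _ fin(5) psd3]) (use fin in simp)
  also have "\<dots> = (\<Sum>m\<in>M. cent B (A1 \<times> E) (swp (?\<sigma> m)))"
    by (simp add: \<tau>2_def g_def \<tau>_def conj_fst_def W_def swp_def)
  finally have 2: "cent B (A \<times> E) (swp \<sigma>) \<le> (\<Sum>m\<in>M. cent B (A1 \<times> E) (swp (?\<sigma> m)))" .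
  have "(\<Sum>m\<in>M. cmi A1 B E (?\<sigma> m)) = (\<Sum>m\<in>M. cent B E (ptr A1 (?\<sigma> m))) - (\<Sum>m\<in>M. cent B (A1 \<times> E) (swp (?\<sigma> m)))"
    unfolding cmi_eq_B[OF fin(4,2,3) psdm] by (rule sum_subtractf)
  with 1 2 show ?thesis unfolding cmi_eq_B[OF fin(1-3) psd] by linarith
qed

subsection \<open>Direct sums, tensor products and relabelling\<close>

lemma ent_direct_sum_reindex:
  assumes fin: "finite M" "\<And>m. m \<in> M \<Longrightarrow> finite (I m)" and psd: "\<And>m. m \<in> M \<Longrightarrow> psd_on (I m) (\<rho> m)"
    and h: "bij_betw h S (Sigma M I)"
  shows "ent S (\<lambda>x y. of_bool (fst (h x) = fst (h y)) * \<rho> (fst (h x)) (snd (h x)) (snd (h y))) = (\<Sum>m\<in>M. ent (I m) (\<rho> m))"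
proof -
  have "finite (Sigma M I)" using fin by auto
  from ent_reindex[OF this psd_on_direct_sum[OF fin(1) psd] h] ent_direct_sum[OF fin psd]
  show ?thesis by simp
qed

lemma ent_tensor_reindex:
  assumes fin: "finite I" "finite J" and psd: "psd_on I \<rho>" "psd_on J \<sigma>" and h: "bij_betw h S (I \<times> J)"
  shows "ent S (\<lambda>x y. \<rho> (fst (h x)) (fst (h y)) * \<sigma> (snd (h x)) (snd (h y))) = ent I \<rho> * otr J \<sigma> + otr I \<rho> * ent J \<sigma>"
proof -
  have "finite (I \<times> J)" using fin by auto
  from ent_reindex[OF this psd_on_tensor[OF psd] h] ent_tensor[OF fin psd]
  show ?thesis by simp
qed

text \<open>The extension system carries a classical label \<open>m\<close> beside a part whose
  index set may depend on \<open>m\<close>; coherences between different labels vanish.\<close>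

definition dsum :: "('m \<Rightarrow> 'a \<times> ('b \<times> 'e) \<Rightarrow> 'a \<times> ('b \<times> 'e) \<Rightarrow> complex) \<Rightarrow>
    'a \<times> ('b \<times> ('m \<times> 'e)) \<Rightarrow> 'a \<times> ('b \<times> ('m \<times> 'e)) \<Rightarrow> complex" where
  "dsum \<sigma> = (\<lambda>x y. of_bool (fst (snd (snd x)) = fst (snd (snd y))) *
     \<sigma> (fst (snd (snd x))) (fst x, (fst (snd x), snd (snd (snd x)))) (fst y, (fst (snd y), snd (snd (snd y)))))"

lemma bij_betw_dsum:
  "bij_betw (\<lambda>x. (fst (snd (snd x)), (fst x, (fst (snd x), snd (snd (snd x))))))
     (A \<times> (B \<times> Sigma M E)) (SIGMA m:M. A \<times> (B \<times> E m))"
  by (rule bij_betw_byWitness[where f'="\<lambda>z. (fst (snd z), (fst (snd (snd z)), (fst z, snd (snd (snd z)))))"]) auto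

lemma psd_on_dsum:
  assumes "finite M" "\<And>m. m \<in> M \<Longrightarrow> psd_on (A \<times> (B \<times> E m)) (\<sigma> m)"
  shows "psd_on (A \<times> (B \<times> Sigma M E)) (dsum \<sigma>)"
proof -
  have "psd_on (SIGMA m:M. A \<times> (B \<times> E m)) (\<lambda>x y. of_bool (fst x = fst y) * \<sigma> (fst x) (snd x) (snd y))"
    by (rule psd_on_direct_sum) (use assms in auto)
  from psd_on_reindex[OF this, where J="A \<times> (B \<times> Sigma M E)"
      and h="\<lambda>x. (fst (snd (snd x)), (fst x, (fst (snd x), snd (snd (snd x)))))"]
  show ?thesis by (auto simp: dsum_def)
qed

text \<open>All four entropies in \<open>cmi\<close> involve \<open>E\<close> and hence the label,
  so each is a sum over the labels. With unnormalised blocks no separate entropy of the label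
  distribution appears.\<close>

lemma cmi_dsum:
  assumes fin: "finite M" "finite A" "finite B" "\<And>m. m \<in> M \<Longrightarrow> finite (E m)"
    and psd: "\<And>m. m \<in> M \<Longrightarrow> psd_on (A \<times> (B \<times> E m)) (\<sigma> m)"
  shows "cmi A B (Sigma M E) (dsum \<sigma>) = (\<Sum>m\<in>M. cmi A B (E m) (\<sigma> m))"
proof -
  have "ent (A \<times> Sigma M E) (ptr B (swp (dsum \<sigma>))) = (\<Sum>m\<in>M. ent (A \<times> E m) (ptr B (swp (\<sigma> m))))"
  proof -
    have "bij_betw (\<lambda>x. (fst (snd x), (fst x, snd (snd x)))) (A \<times> Sigma M E) (SIGMA m:M. A \<times> E m)"
      by (rule bij_betw_byWitness[where f'="\<lambda>z. (fst (snd z), (fst z, snd (snd z)))"]) auto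
    from ent_direct_sum_reindex[OF fin(1) _ _ this, of "\<lambda>m. ptr B (swp (\<sigma> m))"] fin psd
    show ?thesis by (simp add: psd_on_ptr psd_on_swp) (simp add: ptr_def swp_def dsum_def sum_distrib_left)
  qed
  moreover have "ent (B \<times> Sigma M E) (ptr A (dsum \<sigma>)) = (\<Sum>m\<in>M. ent (B \<times> E m) (ptr A (\<sigma> m)))"
  proof -
    have "bij_betw (\<lambda>x. (fst (snd x), (fst x, snd (snd x)))) (B \<times> Sigma M E) (SIGMA m:M. B \<times> E m)"
      by (rule bij_betw_byWitness[where f'="\<lambda>z. (fst (snd z), (fst z, snd (snd z)))"]) auto
    from ent_direct_sum_reindex[OF fin(1) _ _ this, of "\<lambda>m. ptr A (\<sigma> m)"] fin psd
    show ?thesis by (simp add: psd_on_ptr) (simp add: ptr_def dsum_def sum_distrib_left)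
  qed
  moreover have "ent (A \<times> (B \<times> Sigma M E)) (dsum \<sigma>) = (\<Sum>m\<in>M. ent (A \<times> (B \<times> E m)) (\<sigma> m))"
    using ent_direct_sum_reindex[OF fin(1) _ psd bij_betw_dsum] fin by (simp add: dsum_def)
  moreover have "ent (Sigma M E) (ptr B (ptr A (dsum \<sigma>))) = (\<Sum>m\<in>M. ent (E m) (ptr B (ptr A (\<sigma> m))))"
  proof -
    have "ent (Sigma M E) (\<lambda>x y. of_bool (fst x = fst y) * ptr B (ptr A (\<sigma> (fst x))) (snd x) (snd y))
        = (\<Sum>m\<in>M. ent (E m) (ptr B (ptr A (\<sigma> m))))"
      by (rule ent_direct_sum[OF fin(1,4)]) (use fin psd in \<open>auto intro!: psd_on_ptr\<close>)
    then show ?thesis by (simp add: ptr_def dsum_def sum_distrib_left)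
  qed
  ultimately show ?thesis unfolding cmi_def by (simp add: sum.distrib sum_subtractf)
qed

lemma otr_dsum:
  assumes "finite M" "finite A" "finite B" "\<And>m. m \<in> M \<Longrightarrow> finite (E m)"
  shows "otr (A \<times> (B \<times> Sigma M E)) (dsum \<sigma>) = (\<Sum>m\<in>M. otr (A \<times> (B \<times> E m)) (\<sigma> m))"
proof -
  have "otr (A \<times> (B \<times> Sigma M E)) (dsum \<sigma>) = (\<Sum>z\<in>(SIGMA m:M. A \<times> (B \<times> E m)). Re (\<sigma> (fst z) (snd z) (snd z)))"
    unfolding otr_def
    using sum.reindex_bij_betw[OF bij_betw_dsum, of "\<lambda>z. Re (\<sigma> (fst z) (snd z) (snd z))" A B M E]
    by (simp add: dsum_def)
  then show ?thesis using assms by (simp add: otr_def sum_Sigma)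
qed

text \<open>Extensions built on disjoint sums and products are moved back to index sets of type
  \<open>nat\<close> with this.\<close>

definition relabel :: "('a \<Rightarrow> 'x) \<Rightarrow> ('b \<Rightarrow> 'y) \<Rightarrow> ('e \<Rightarrow> 'z) \<Rightarrow> ('x \<times> ('y \<times> 'z) \<Rightarrow> 'x \<times> ('y \<times> 'z) \<Rightarrow> complex) \<Rightarrow>
    'a \<times> ('b \<times> 'e) \<Rightarrow> 'a \<times> ('b \<times> 'e) \<Rightarrow> complex" where
  "relabel f g h \<sigma> = (\<lambda>x y. \<sigma> (f (fst x), (g (fst (snd x)), h (snd (snd x)))) (f (fst y), (g (fst (snd y)), h (snd (snd y)))))"

lemma bij_betw_pair:
  assumes "bij_betw f A X" "bij_betw g B Y"
  shows "bij_betw (\<lambda>x. (f (fst x), g (snd x))) (A \<times> B) (X \<times> Y)"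
  using bij_betw_map_prod[OF assms] by (simp add: map_prod_def case_prod_unfold)

lemma psd_on_relabel:
  assumes "bij_betw f A X" "bij_betw g B Y" "bij_betw h E Z" "psd_on (X \<times> (Y \<times> Z)) \<sigma>"
  shows "psd_on (A \<times> (B \<times> E)) (relabel f g h \<sigma>)"
  using psd_on_reindex[OF assms(4), of "A \<times> (B \<times> E)" "\<lambda>x. (f (fst x), (g (fst (snd x)), h (snd (snd x))))"]
    bij_betwE[OF assms(1)] bij_betwE[OF assms(2)] bij_betwE[OF assms(3)]
  by (auto simp: relabel_def)

lemma otr_relabel:
  assumes "bij_betw f A X" "bij_betw g B Y" "bij_betw h E Z"
  shows "otr (A \<times> (B \<times> E)) (relabel f g h \<sigma>) = otr (X \<times> (Y \<times> Z)) \<sigma>"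
  unfolding otr_def
  using sum.reindex_bij_betw[OF bij_betw_pair[OF assms(1) bij_betw_pair[OF assms(2,3)]], of "\<lambda>z. Re (\<sigma> z z)"]
  by (simp add: relabel_def)

lemma cmi_relabel:
  assumes f: "bij_betw f A X" and g: "bij_betw g B Y" and h: "bij_betw h E Z"
    and fin: "finite X" "finite Y" "finite Z" and psd: "psd_on (X \<times> (Y \<times> Z)) \<sigma>"
  shows "cmi A B E (relabel f g h \<sigma>) = cmi X Y Z \<sigma>"
proof -
  have "ptr B (swp (relabel f g h \<sigma>)) = (\<lambda>x y. ptr Y (swp \<sigma>) (f (fst x), h (snd x)) (f (fst y), h (snd y)))"
    unfolding ptr_def swp_def relabel_def fun_eq_iff
    using sum.reindex_bij_betw[OF g] by (auto intro: sum.reindex_bij_betw[OF g])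
  then have 1: "ent (A \<times> E) (ptr B (swp (relabel f g h \<sigma>))) = ent (X \<times> Z) (ptr Y (swp \<sigma>))"
    using ent_reindex[OF _ psd_on_ptr[OF fin(2) psd_on_swp[OF psd]] bij_betw_pair[OF f h]] fin by simp
  have pA: "ptr A (relabel f g h \<sigma>) = (\<lambda>x y. ptr X \<sigma> (g (fst x), h (snd x)) (g (fst y), h (snd y)))"
    unfolding ptr_def relabel_def fun_eq_iff by (auto intro: sum.reindex_bij_betw[OF f])
  then have 2: "ent (B \<times> E) (ptr A (relabel f g h \<sigma>)) = ent (Y \<times> Z) (ptr X \<sigma>)"
    using ent_reindex[OF _ psd_on_ptr[OF fin(1) psd] bij_betw_pair[OF g h]] fin by simp
  have 3: "ent (A \<times> (B \<times> E)) (relabel f g h \<sigma>) = ent (X \<times> (Y \<times> Z)) \<sigma>"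
    using ent_reindex[OF _ psd bij_betw_pair[OF f bij_betw_pair[OF g h]]] fin by (simp add: relabel_def)
  have "ptr B (ptr A (relabel f g h \<sigma>)) = (\<lambda>x y. ptr Y (ptr X \<sigma>) (h x) (h y))"
    unfolding pA by (auto simp: ptr_def fun_eq_iff intro: sum.reindex_bij_betw[OF g])
  then have 4: "ent E (ptr B (ptr A (relabel f g h \<sigma>))) = ent Z (ptr Y (ptr X \<sigma>))"
    using ent_reindex[OF _ psd_on_ptr[OF fin(2) psd_on_ptr[OF fin(1) psd]] h] fin by simp
  show ?thesis unfolding cmi_def 1 2 3 4 ..
qed

definition ten :: "('a \<times> ('b \<times> 'e) \<Rightarrow> 'a \<times> ('b \<times> 'e) \<Rightarrow> complex) \<Rightarrow> ('x \<times> ('y \<times> 'z) \<Rightarrow> 'x \<times> ('y \<times> 'z) \<Rightarrow> complex) \<Rightarrow>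
    ('a \<times> 'x) \<times> (('b \<times> 'y) \<times> ('e \<times> 'z)) \<Rightarrow> ('a \<times> 'x) \<times> (('b \<times> 'y) \<times> ('e \<times> 'z)) \<Rightarrow> complex" where
  "ten \<sigma> \<tau> = (\<lambda>x y. \<sigma> (fst (fst x), (fst (fst (snd x)), fst (snd (snd x)))) (fst (fst y), (fst (fst (snd y)), fst (snd (snd y)))) *
     \<tau> (snd (fst x), (snd (fst (snd x)), snd (snd (snd x)))) (snd (fst y), (snd (fst (snd y)), snd (snd (snd y)))))"

lemma bij_betw_ten:
  "bij_betw (\<lambda>x. ((fst (fst x), (fst (fst (snd x)), fst (snd (snd x)))), (snd (fst x), (snd (fst (snd x)), snd (snd (snd x))))))
     ((A \<times> X) \<times> ((B \<times> Y) \<times> (E \<times> Z))) ((A \<times> (B \<times> E)) \<times> (X \<times> (Y \<times> Z)))"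
  by (rule bij_betw_byWitness[where f'="\<lambda>z. ((fst (fst z), fst (snd z)),
      ((fst (snd (fst z)), fst (snd (snd z))), (snd (snd (fst z)), snd (snd (snd z)))))"]) auto

lemma bij_betw_ten2:
  "bij_betw (\<lambda>x. ((fst (fst x), fst (snd x)), (snd (fst x), snd (snd x)))) ((A \<times> X) \<times> (E \<times> Z)) ((A \<times> E) \<times> (X \<times> Z))"
  by (rule bij_betw_byWitness[where f'="\<lambda>x. ((fst (fst x), fst (snd x)), (snd (fst x), snd (snd x)))"]) auto

lemma psd_on_ten:
  assumes "psd_on (A \<times> (B \<times> E)) \<sigma>" "psd_on (X \<times> (Y \<times> Z)) \<tau>"
  shows "psd_on ((A \<times> X) \<times> ((B \<times> Y) \<times> (E \<times> Z))) (ten \<sigma> \<tau>)"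
  using psd_on_reindex[OF psd_on_tensor[OF assms], of "(A \<times> X) \<times> ((B \<times> Y) \<times> (E \<times> Z))"
      "\<lambda>x. ((fst (fst x), (fst (fst (snd x)), fst (snd (snd x)))), (snd (fst x), (snd (fst (snd x)), snd (snd (snd x)))))"]
  by (auto simp: ten_def)

lemma otr_ten:
  assumes "finite A" "finite B" "finite E" "finite X" "finite Y" "finite Z"
    "psd_on (A \<times> (B \<times> E)) \<sigma>" "psd_on (X \<times> (Y \<times> Z)) \<tau>"
  shows "otr ((A \<times> X) \<times> ((B \<times> Y) \<times> (E \<times> Z))) (ten \<sigma> \<tau>) = otr (A \<times> (B \<times> E)) \<sigma> * otr (X \<times> (Y \<times> Z)) \<tau>"
proof -
  have "otr ((A \<times> X) \<times> ((B \<times> Y) \<times> (E \<times> Z))) (ten \<sigma> \<tau>)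
      = otr ((A \<times> (B \<times> E)) \<times> (X \<times> (Y \<times> Z))) (\<lambda>x y. \<sigma> (fst x) (fst y) * \<tau> (snd x) (snd y))"
    unfolding otr_def
    using sum.reindex_bij_betw[OF bij_betw_ten, of "\<lambda>z. Re (\<sigma> (fst z) (fst z) * \<tau> (snd z) (snd z))" A X B Y E Z]
    by (simp add: ten_def)
  then show ?thesis using otr_tensor[OF _ _ assms(7,8)] assms by simp
qed

text \<open>Partial traces preserve the trace, so all four entropies acquire the same two trace
  factors in \<open>ent_tensor\<close>.\<close>

lemma cmi_ten:
  assumes fin: "finite A" "finite B" "finite E" "finite X" "finite Y" "finite Z"
    and s: "psd_on (A \<times> (B \<times> E)) \<sigma>" and t: "psd_on (X \<times> (Y \<times> Z)) \<tau>"
  shows "cmi (A \<times> X) (B \<times> Y) (E \<times> Z) (ten \<sigma> \<tau>)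
    = cmi A B E \<sigma> * otr (X \<times> (Y \<times> Z)) \<tau> + otr (A \<times> (B \<times> E)) \<sigma> * cmi X Y Z \<tau>"
proof -
  let ?\<sigma> = "otr (A \<times> (B \<times> E)) \<sigma>" and ?\<tau> = "otr (X \<times> (Y \<times> Z)) \<tau>"
  have swo: "otr (A \<times> E) (ptr B (swp \<sigma>)) = ?\<sigma>" "otr (X \<times> Z) (ptr Y (swp \<tau>)) = ?\<tau>"
  proof -
    show "otr (A \<times> E) (ptr B (swp \<sigma>)) = ?\<sigma>"
      unfolding otr_ptr unfolding otr_def using sum.reindex_bij_betw[OF bij_betw_swp, of "\<lambda>z. Re (\<sigma> z z)" B A E] by (simp add: swp_def)
    show "otr (X \<times> Z) (ptr Y (swp \<tau>)) = ?\<tau>"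
      unfolding otr_ptr unfolding otr_def using sum.reindex_bij_betw[OF bij_betw_swp, of "\<lambda>z. Re (\<tau> z z)" Y X Z] by (simp add: swp_def)
  qed
  have p1: "ptr (B \<times> Y) (swp (ten \<sigma> \<tau>)) = (\<lambda>x y. ptr B (swp \<sigma>) (fst (fst x), fst (snd x)) (fst (fst y), fst (snd y)) *
      ptr Y (swp \<tau>) (snd (fst x), snd (snd x)) (snd (fst y), snd (snd y)))"
    unfolding ptr_def swp_def ten_def sum_product sum_Times by simp
  have 1: "ent ((A \<times> X) \<times> (E \<times> Z)) (ptr (B \<times> Y) (swp (ten \<sigma> \<tau>)))
      = ent (A \<times> E) (ptr B (swp \<sigma>)) * ?\<tau> + ?\<sigma> * ent (X \<times> Z) (ptr Y (swp \<tau>))"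
    unfolding p1
    using ent_tensor_reindex[OF _ _ psd_on_ptr[OF fin(2) psd_on_swp[OF s]] psd_on_ptr[OF fin(5) psd_on_swp[OF t]] bij_betw_ten2] fin
    by (simp add: swo)
  have p2: "ptr (A \<times> X) (ten \<sigma> \<tau>) = (\<lambda>x y. ptr A \<sigma> (fst (fst x), fst (snd x)) (fst (fst y), fst (snd y)) *
      ptr X \<tau> (snd (fst x), snd (snd x)) (snd (fst y), snd (snd y)))"
    unfolding ptr_def ten_def sum_product sum_Times by simp
  have 2: "ent ((B \<times> Y) \<times> (E \<times> Z)) (ptr (A \<times> X) (ten \<sigma> \<tau>))
      = ent (B \<times> E) (ptr A \<sigma>) * ?\<tau> + ?\<sigma> * ent (Y \<times> Z) (ptr X \<tau>)"
    unfolding p2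
    using ent_tensor_reindex[OF _ _ psd_on_ptr[OF fin(1) s] psd_on_ptr[OF fin(4) t] bij_betw_ten2] fin
    by (simp add: otr_ptr)
  have 3: "ent ((A \<times> X) \<times> ((B \<times> Y) \<times> (E \<times> Z))) (ten \<sigma> \<tau>) = ent (A \<times> (B \<times> E)) \<sigma> * ?\<tau> + ?\<sigma> * ent (X \<times> (Y \<times> Z)) \<tau>"
    using ent_tensor_reindex[OF _ _ s t bij_betw_ten] fin by (simp add: ten_def)
  have p4: "ptr (B \<times> Y) (ptr (A \<times> X) (ten \<sigma> \<tau>)) = (\<lambda>x y. ptr B (ptr A \<sigma>) (fst x) (fst y) * ptr Y (ptr X \<tau>) (snd x) (snd y))"
    unfolding p2 unfolding ptr_def[of B] ptr_def[of Y] ptr_def[of "B \<times> Y"] sum_product sum_Times by simp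
  have 4: "ent (E \<times> Z) (ptr (B \<times> Y) (ptr (A \<times> X) (ten \<sigma> \<tau>)))
      = ent E (ptr B (ptr A \<sigma>)) * ?\<tau> + ?\<sigma> * ent Z (ptr Y (ptr X \<tau>))"
    unfolding p4
    using ent_tensor[OF fin(3,6) psd_on_ptr[OF fin(2) psd_on_ptr[OF fin(1) s]] psd_on_ptr[OF fin(5) psd_on_ptr[OF fin(4) t]]]
    by (simp add: otr_ptr)
  show ?thesis unfolding cmi_def 1 2 3 4 by (simp add: algebra_simps)
qed

subsection \<open>States close to a maximally entangled one\<close>

lemma vfun_rank_one:
  assumes "(\<Sum>i\<in>I. cnj (\<phi> i) * \<phi> i) = 1"
  shows "vfun t I \<rho> \<sigma> (\<lambda>x y. complex_of_real \<alpha> * \<phi> x * cnj (\<phi> y))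
    = 2 * complex_of_real \<alpha> * ((\<Sum>i\<in>I. \<Sum>j\<in>I. cnj (\<phi> i) * \<rho> i j * \<phi> j) - (\<Sum>i\<in>I. \<Sum>j\<in>I. cnj (\<phi> i) * \<sigma> i j * \<phi> j))
      - complex_of_real (\<alpha>\<^sup>2) * ((1 - complex_of_real t) * (\<Sum>i\<in>I. \<Sum>j\<in>I. cnj (\<phi> i) * \<rho> i j * \<phi> j)
          + complex_of_real t * (\<Sum>i\<in>I. \<Sum>j\<in>I. cnj (\<phi> i) * \<sigma> i j * \<phi> j))"
proof -
  let ?X = "\<lambda>x y. complex_of_real \<alpha> * \<phi> x * cnj (\<phi> y)"
  have A: "(\<Sum>i\<in>I. \<Sum>j\<in>I. 2 * (cnj (?X i j) * (\<rho> i j - \<sigma> i j)))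
      = 2 * complex_of_real \<alpha> * ((\<Sum>i\<in>I. \<Sum>j\<in>I. cnj (\<phi> i) * \<rho> i j * \<phi> j) - (\<Sum>i\<in>I. \<Sum>j\<in>I. cnj (\<phi> i) * \<sigma> i j * \<phi> j))"
    unfolding sum_subtractf[symmetric] sum_distrib_left by (intro sum.cong refl) (simp add: algebra_simps)
  have B: "(\<Sum>j\<in>I. \<Sum>i\<in>I. \<Sum>i'\<in>I. cnj (?X i j) * \<rho> i i' * ?X i' j)
      = complex_of_real (\<alpha>\<^sup>2) * (\<Sum>i\<in>I. \<Sum>j\<in>I. cnj (\<phi> i) * \<rho> i j * \<phi> j)"
  proof -
    have "(\<Sum>j\<in>I. \<Sum>i\<in>I. \<Sum>i'\<in>I. cnj (?X i j) * \<rho> i i' * ?X i' j)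
        = (\<Sum>j\<in>I. (cnj (\<phi> j) * \<phi> j) * (complex_of_real (\<alpha>\<^sup>2) * (\<Sum>i\<in>I. \<Sum>i'\<in>I. cnj (\<phi> i) * \<rho> i i' * \<phi> i')))"
      unfolding sum_distrib_left by (intro sum.cong refl) (simp add: power2_eq_square)
    then show ?thesis unfolding sum_distrib_right[symmetric] assms by simp
  qed
  have C: "(\<Sum>i\<in>I. \<Sum>j\<in>I. \<Sum>j'\<in>I. ?X i j * \<sigma> j j' * cnj (?X i j'))
      = complex_of_real (\<alpha>\<^sup>2) * (\<Sum>i\<in>I. \<Sum>j\<in>I. cnj (\<phi> i) * \<sigma> i j * \<phi> j)"
  proof -
    have "(\<Sum>i\<in>I. \<Sum>j\<in>I. \<Sum>j'\<in>I. ?X i j * \<sigma> j j' * cnj (?X i j'))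
        = (\<Sum>i\<in>I. (cnj (\<phi> i) * \<phi> i) * (complex_of_real (\<alpha>\<^sup>2) * (\<Sum>j\<in>I. \<Sum>j'\<in>I. cnj (\<phi> j) * \<sigma> j j' * \<phi> j')))"
      unfolding sum_distrib_left by (intro sum.cong refl) (simp add: power2_eq_square)
    then show ?thesis unfolding sum_distrib_right[symmetric] assms by simp
  qed
  show ?thesis unfolding vfun_def A B C by (simp add: algebra_simps)
qed

text \<open>Monotonicity under testing for the single vector \<open>\<phi>\<close>: restricting
  \<open>X\<close> to multiples of its projection leaves a scalar quadratic, whose maximum is one
  summand of the classical form with eigenvalues \<open>F\<close> and \<open>G\<close>.\<close>

lemma creld_ge_overlap:
  assumes fin: "finite I" "finite J" and psd: "psd_on (I \<times> J) \<rho>"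
    and \<phi>: "(\<Sum>x\<in>I \<times> J. cnj (\<phi> x) * \<phi> x) = 1"
    and F: "F = Re (\<Sum>x\<in>I \<times> J. \<Sum>y\<in>I \<times> J. cnj (\<phi> x) * \<rho> x y * \<phi> y)" "0 \<le> F"
    and G: "G = Re (\<Sum>x\<in>I \<times> J. \<Sum>y\<in>I \<times> J. cnj (\<phi> x) * cref I J \<rho> x y * \<phi> y)" "0 < G"
  shows "F * ln F - F * ln G - F + G \<le> creld I J \<rho>"
proof -
  have f: "finite (I \<times> J)" using fin by simp
  have "(\<Sum>u\<in>{()}. 1 * (F * ln F - F * ln G - F + G))
    \<le> (\<Sum>x\<in>(I \<times> J) \<times> (I \<times> J). cweight I J \<rho> (fst x) (snd x) *
        (eigval (I \<times> J) \<rho> (fst x) * ln (eigval (I \<times> J) \<rho> (fst x)) - eigval (I \<times> J) \<rho> (fst x) * ln (cref_val I J \<rho> (snd x))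
         - eigval (I \<times> J) \<rho> (fst x) + cref_val I J \<rho> (snd x)))"
  proof (rule relative_entropy_le_of_chi_le)
    fix t :: real assume t: "0 < t" "t < 1"
    define d where "d = (1 - t) * F + t * G"
    have d: "d > 0" unfolding d_def using t F(2) G(2) by (simp add: add_nonneg_pos)
    \<comment> \<open>The maximiser of 2 \<alpha> (F - G) - \<alpha>^2 d.\<close>
    define \<alpha> where "\<alpha> = (F - G) / d"
    have "Re (vfun t (I \<times> J) \<rho> (cref I J \<rho>) (\<lambda>x y. complex_of_real \<alpha> * \<phi> x * cnj (\<phi> y)))
        = 2 * \<alpha> * (F - G) - \<alpha>\<^sup>2 * d"
      unfolding vfun_rank_one[OF \<phi>] F(1) G(1) d_def by simp
    also have "\<dots> = (F - G)\<^sup>2 / d"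
      using d by (simp add: \<alpha>_def field_simps power2_eq_square)
    finally have "(F - G)\<^sup>2 / d \<le> cchi t I J \<rho>"
      using cchi_ge[OF fin psd t, of "\<lambda>x y. complex_of_real \<alpha> * \<phi> x * cnj (\<phi> y)"] by simp
    then show "(\<Sum>u\<in>{()}. 1 * ((F - G)\<^sup>2 / ((1 - t) * F + t * G)))
      \<le> (\<Sum>x\<in>(I \<times> J) \<times> (I \<times> J). cweight I J \<rho> (fst x) (snd x) *
        ((eigval (I \<times> J) \<rho> (fst x) - cref_val I J \<rho> (snd x))\<^sup>2 / ((1 - t) * eigval (I \<times> J) \<rho> (fst x) + t * cref_val I J \<rho> (snd x))))"
      by (simp add: d_def cchi_def sum_Times[of _ "I \<times> J"])
  next
    fix x assume "x \<in> (I \<times> J) \<times> (I \<times> J)"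
    then have x: "fst x \<in> I \<times> J" "snd x \<in> I \<times> J" by auto
    show "0 \<le> eigval (I \<times> J) \<rho> (fst x) \<and> 0 \<le> cref_val I J \<rho> (snd x) \<and>
      (cref_val I J \<rho> (snd x) = 0 \<longrightarrow> eigval (I \<times> J) \<rho> (fst x) = 0 \<or> cweight I J \<rho> (fst x) (snd x) = 0)"
      using eig_spectral(3)[OF f psd x(1)] cref_spectral(3)[OF fin psd x(2)] cweight_support[OF fin psd x] by blast
  qed (use fin F G in auto)
  then show ?thesis by (simp add: creld_def sum_Times[of _ "I \<times> J"])
qed

lemma cnj_inverse_sqrt:
  assumes "1 \<le> (s :: nat)"
  shows "cnj (complex_of_real (1 / sqrt (real s))) * complex_of_real (1 / sqrt (real s)) = 1 / of_nat s"
proof -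
  have "cnj (complex_of_real (1 / sqrt (real s))) * complex_of_real (1 / sqrt (real s))
      = complex_of_real (1 / sqrt (real s) * (1 / sqrt (real s)))" unfolding of_real_mult by simp
  also have "1 / sqrt (real s) * (1 / sqrt (real s)) = 1 / real s" by simp
  finally show ?thesis by simp
qed

lemma max_entangled_form:
  assumes s: "1 \<le> (s :: nat)"
  shows "(\<Sum>x\<in>{..<s} \<times> {..<s}. \<Sum>y\<in>{..<s} \<times> {..<s}. cnj (of_bool (fst x = snd x) * complex_of_real (1 / sqrt (real s))) * \<tau> x y * (of_bool (fst y = snd y) * complex_of_real (1 / sqrt (real s))))
    = (\<Sum>i<s. \<Sum>j<s. \<tau> (i, i) (j, j)) / of_nat s"
proof -
  define c where "c = complex_of_real (1 / sqrt (real s))"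
  have cc: "cnj c * c = 1 / of_nat s" unfolding c_def by (rule cnj_inverse_sqrt[OF s])
  have "(\<Sum>x\<in>{..<s} \<times> {..<s}. \<Sum>y\<in>{..<s} \<times> {..<s}. cnj (of_bool (fst x = snd x) * c) * \<tau> x y * (of_bool (fst y = snd y) * c))
      = (\<Sum>i<s. \<Sum>k<s. of_bool (i = k) * (\<Sum>j<s. \<Sum>l<s. of_bool (j = l) * ((cnj c * c) * \<tau> (i, k) (j, l))))"
    unfolding sum_Times sum_distrib_left by (intro sum.cong refl) (auto simp: of_bool_def)
  also have "\<dots> = (\<Sum>i<s. \<Sum>j<s. (cnj c * c) * \<tau> (i, i) (j, j))"
  proof (rule sum.cong[OF refl])
    fix i assume i: "i \<in> {..<s}"
    have "(\<Sum>k<s. of_bool (i = k) * (\<Sum>j<s. \<Sum>l<s. of_bool (j = l) * ((cnj c * c) * \<tau> (i, k) (j, l))))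
        = (\<Sum>j<s. \<Sum>l<s. of_bool (j = l) * ((cnj c * c) * \<tau> (i, i) (j, l)))"
      by (rule sum_of_bool_left'[OF finite_lessThan i])
    also have "\<dots> = (\<Sum>j<s. (cnj c * c) * \<tau> (i, i) (j, j))"
      by (rule sum.cong[OF refl], rule sum_of_bool_left'[OF finite_lessThan])
    finally show "(\<Sum>k<s. of_bool (i = k) * (\<Sum>j<s. \<Sum>l<s. of_bool (j = l) * ((cnj c * c) * \<tau> (i, k) (j, l))))
        = (\<Sum>j<s. (cnj c * c) * \<tau> (i, i) (j, j))" .
  qed
  finally show ?thesis unfolding c_def[symmetric] by (simp add: cc sum_divide_distrib)
qed

lemma max_entangled_norm:
  assumes s: "1 \<le> (s :: nat)"
  shows "(\<Sum>x\<in>{..<s} \<times> {..<s}. cnj (of_bool (fst x = snd x) * complex_of_real (1 / sqrt (real s))) * (of_bool (fst x = snd x) * complex_of_real (1 / sqrt (real s)))) = 1"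
proof -
  define c where "c = complex_of_real (1 / sqrt (real s))"
  have cc: "cnj c * c = 1 / of_nat s" unfolding c_def by (rule cnj_inverse_sqrt[OF s])
  have s0: "real s > 0" using s by simp
  have "(\<Sum>x\<in>{..<s} \<times> {..<s}. cnj (of_bool (fst x = snd x) * c) * (of_bool (fst x = snd x) * c)) = (\<Sum>i<s. \<Sum>k<s. of_bool (i = k) * (cnj c * c))"
    unfolding sum_Times by (intro sum.cong refl) (auto simp: of_bool_def)
  also have "\<dots> = (\<Sum>i<s. cnj c * c)"
    by (intro sum.cong refl) (simp add: sum_of_bool_left')
  finally show ?thesis unfolding c_def[symmetric] using s0 by (simp add: cc)
qed

text \<open>The reference state has overlap \<open>1 / s\<^sup>2\<close> with the maximally entangled one, whatever \<open>\<rho>\<close> is.\<close>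

lemma cent_le_of_overlap:
  assumes s: "1 \<le> (s :: nat)" and psd: "psd_on ({..<s} \<times> {..<s}) \<rho>" and tr: "otr ({..<s} \<times> {..<s}) \<rho> = 1"
    and F: "F = Re (\<Sum>i<s. \<Sum>j<s. \<rho> (i, i) (j, j)) / real s"
  shows "(2 * F - 1) * ln (real s) - 1 \<le> - cent {..<s} {..<s} \<rho>"
proof -
  let ?A = "{..<s}"
  have s0: "real s > 0" using s by simp
  define \<phi> where "\<phi> x = of_bool (fst x = snd x) * complex_of_real (1 / sqrt (real s))" for x :: "nat \<times> nat"
  note form = max_entangled_form[OF s, folded \<phi>_def]
  note norm = max_entangled_norm[OF s, folded \<phi>_def]
  have F1: "F = Re (\<Sum>x\<in>?A \<times> ?A. \<Sum>y\<in>?A \<times> ?A. cnj (\<phi> x) * \<rho> x y * \<phi> y)"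
    unfolding form F by (simp add: Re_divide_of_nat)
  have F0: "0 \<le> F" unfolding F1 by (rule psd_on_form_nonneg[OF psd])
  have G1: "1 / (real s)\<^sup>2 = Re (\<Sum>x\<in>?A \<times> ?A. \<Sum>y\<in>?A \<times> ?A. cnj (\<phi> x) * cref ?A ?A \<rho> x y * \<phi> y)"
  proof -
    have "(\<Sum>i<s. \<Sum>j<s. cref ?A ?A \<rho> (i, i) (j, j)) = (\<Sum>i<s. \<Sum>j<s. of_bool (i = j) * (ptr ?A \<rho> i j / of_nat s))"
      by (simp add: cref_def)
    also have "\<dots> = (\<Sum>i<s. ptr ?A \<rho> i i) / of_nat s"
      unfolding sum_divide_distrib by (rule sum.cong[OF refl], rule sum_of_bool_left'[OF finite_lessThan])
    finally have "Re (\<Sum>i<s. \<Sum>j<s. cref ?A ?A \<rho> (i, i) (j, j)) = otr ?A (ptr ?A \<rho>) / real s"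
      by (simp add: otr_def Re_divide_of_nat)
    then show ?thesis unfolding form using tr by (simp add: otr_ptr Re_divide_of_nat power2_eq_square)
  qed
  have "F * ln F - F * ln (1 / (real s)\<^sup>2) - F + 1 / (real s)\<^sup>2 \<le> creld ?A ?A \<rho>"
    by (rule creld_ge_overlap[OF _ _ psd norm F1 F0 G1]) (use s0 in auto)
  \<comment> \<open>The overlap term \<open>- F * ln (1 / s\<^sup>2)\<close> contributes 2 F ln s,
    from which this ln s is subtracted: hence the factor 2 F - 1.\<close>
  moreover have "creld ?A ?A \<rho> = ln (real s) - cent ?A ?A \<rho>"
    using creld_eq[OF _ _ psd] s tr by (simp add: lessThan_empty_iff)
  moreover have "ln (1 / (real s)\<^sup>2) = - 2 * ln (real s)"
    using s0 by (simp add: ln_div ln_realpow)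
  \<comment> \<open>The source of the constant 1 in the statement: the minimum of this function,
    attained at F = 1. It disappears on division by the number of copies.\<close>
  moreover have "- 1 \<le> F * ln F - F"
  proof (cases "F = 0")
    case False
    with F0 have "F > 0" by simp
    then have "ln (1 / F) \<le> 1 / F - 1" by (intro ln_le_minus_one) simp
    then have "F * (- ln F) \<le> F * (1 / F - 1)" using \<open>F > 0\<close> by (intro mult_left_mono) (simp_all add: ln_div)
    then show ?thesis using \<open>F > 0\<close> by (simp add: algebra_simps)
  qed simp
  ultimately have "1 / (real s)\<^sup>2 + ((2 * F - 1) * ln (real s) - 1) \<le> - cent ?A ?A \<rho>"
    by (simp add: algebra_simps)
  moreover have "0 \<le> 1 / (real s)\<^sup>2" by simp
  ultimately show ?thesis by linarith
qed

section \<open>Entropies and trace norms of matrices\<close>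

definition mfun :: "complex mat \<Rightarrow> nat \<Rightarrow> nat \<Rightarrow> complex" where
  "mfun X = (\<lambda>i j. X $$ (i, j))"

lemma mat_adjoint_dims [simp]: "dim_row (mat_adjoint A) = dim_col A" "dim_col (mat_adjoint A) = dim_row A"
  by (simp_all add: mat_adjoint_def)

lemma mat_adjoint_index:
  "i < dim_col A \<Longrightarrow> j < dim_row A \<Longrightarrow> mat_adjoint (A :: complex mat) $$ (i, j) = cnj (A $$ (j, i))"
  by (simp add: mat_adjoint_def mat_of_rows_def)

lemma mat_mult_index_sum:
  "A \<in> carrier_mat n m \<Longrightarrow> B \<in> carrier_mat m k \<Longrightarrow> i < n \<Longrightarrow> j < k \<Longrightarrow> (A * B) $$ (i, j) = (\<Sum>l<m. A $$ (i, l) * B $$ (l, j))"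
  by (simp add: scalar_prod_def atLeast0LessThan)

lemma conj_diag_index:
  fixes U :: "complex mat"
  assumes U: "U \<in> carrier_mat d d" and ij: "i < d" "j < d"
  shows "(U * mat_diag d a * mat_adjoint U) $$ (i, j) = (\<Sum>k<d. a k * U $$ (i, k) * cnj (U $$ (j, k)))"
proof -
  have UD: "(U * mat_diag d a) $$ (i, k) = a k * U $$ (i, k)" if "k < d" for k
  proof -
    have "(U * mat_diag d a) $$ (i, k) = (\<Sum>l<d. U $$ (i, l) * mat_diag d a $$ (l, k))"
      by (rule mat_mult_index_sum[OF U _ ij(1) that]) (simp add: mat_diag_def)
    also have "\<dots> = (\<Sum>l<d. of_bool (l = k) * (U $$ (i, l) * a k))"
      using that by (intro sum.cong) (auto simp: mat_diag_def)
    also have "\<dots> = a k * U $$ (i, k)" using that by (subst sum_of_bool_left) auto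
    finally show ?thesis .
  qed
  have aU: "mat_adjoint U \<in> carrier_mat d d" using U by (auto intro: carrier_matI)
  have "(U * mat_diag d a * mat_adjoint U) $$ (i, j) = (\<Sum>k<d. (U * mat_diag d a) $$ (i, k) * mat_adjoint U $$ (k, j))"
    by (rule mat_mult_index_sum[OF _ aU ij]) (use U in \<open>auto simp: mat_diag_def\<close>)
  also have "\<dots> = (\<Sum>k<d. a k * U $$ (i, k) * cnj (U $$ (j, k)))"
    using U ij by (intro sum.cong) (auto simp: UD mat_adjoint_index)
  finally show ?thesis .
qed

lemma spectral_decomposition_iff:
  assumes X: "X \<in> carrier_mat d d" and U: "U \<in> carrier_mat d d"
  shows "spectral_decomposition X U e \<longleftrightarrow>
    diag_on {..<d} (mfun X) {..<d} e (\<lambda>k i. U $$ (i, k)) \<and> complete_on {..<d} {..<d} (\<lambda>k i. U $$ (i, k))"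
proof -
  have aU: "mat_adjoint U \<in> carrier_mat d d" using U by (auto intro: carrier_matI)
  have UU: "(U * mat_adjoint U) $$ (i, j) = (\<Sum>k<d. U $$ (i, k) * cnj (U $$ (j, k)))" if "i < d" "j < d" for i j
    using U that by (subst mat_mult_index_sum[OF U aU]) (auto simp: mat_adjoint_index)
  have UU': "(mat_adjoint U * U) $$ (i, j) = (\<Sum>k<d. cnj (U $$ (k, i)) * U $$ (k, j))" if "i < d" "j < d" for i j
    using U that by (subst mat_mult_index_sum[OF aU U]) (auto simp: mat_adjoint_index)
  have 1: "U * mat_adjoint U = 1\<^sub>m d \<longleftrightarrow> complete_on {..<d} {..<d} (\<lambda>k i. U $$ (i, k))"
  proof
    assume *: "U * mat_adjoint U = 1\<^sub>m d"
    show "complete_on {..<d} {..<d} (\<lambda>k i. U $$ (i, k))"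
      unfolding complete_on_def using UU[symmetric] by (simp add: *)
  next
    assume "complete_on {..<d} {..<d} (\<lambda>k i. U $$ (i, k))"
    then show "U * mat_adjoint U = 1\<^sub>m d"
      using U by (intro eq_matI) (auto simp del: index_mult_mat(1) simp add: UU complete_on_def)
  qed
  have 2: "mat_adjoint U * U = 1\<^sub>m d \<longleftrightarrow> orthonormal_on {..<d} {..<d} (\<lambda>k i. U $$ (i, k))"
  proof
    assume *: "mat_adjoint U * U = 1\<^sub>m d"
    show "orthonormal_on {..<d} {..<d} (\<lambda>k i. U $$ (i, k))"
      unfolding orthonormal_on_def using UU'[symmetric] by (simp add: *)
  next
    assume "orthonormal_on {..<d} {..<d} (\<lambda>k i. U $$ (i, k))"
    then show "mat_adjoint U * U = 1\<^sub>m d"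
      using U by (intro eq_matI) (auto simp del: index_mult_mat(1) simp add: UU' orthonormal_on_def)
  qed
  have 3: "X = U * mat_diag d (\<lambda>i. complex_of_real (e i)) * mat_adjoint U \<longleftrightarrow>
      (\<forall>i<d. \<forall>j<d. X $$ (i, j) = (\<Sum>k<d. complex_of_real (e k) * U $$ (i, k) * cnj (U $$ (j, k))))"
  proof
    assume "X = U * mat_diag d (\<lambda>i. complex_of_real (e i)) * mat_adjoint U"
    then show "\<forall>i<d. \<forall>j<d. X $$ (i, j) = (\<Sum>k<d. complex_of_real (e k) * U $$ (i, k) * cnj (U $$ (j, k)))"
      using conj_diag_index[OF U, of _ _ "\<lambda>i. complex_of_real (e i)"] by simp
  next
    assume "\<forall>i<d. \<forall>j<d. X $$ (i, j) = (\<Sum>k<d. complex_of_real (e k) * U $$ (i, k) * cnj (U $$ (j, k)))"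
    then show "X = U * mat_diag d (\<lambda>i. complex_of_real (e i)) * mat_adjoint U"
      using X U conj_diag_index[OF U, of _ _ "\<lambda>i. complex_of_real (e i)"] by (intro eq_matI) (auto simp del: index_mult_mat(1))
  qed
  have dX: "dim_row X = d" using X by simp
  show ?thesis
    unfolding spectral_decomposition_def Let_def dX diag_on_def using U 1 2 3 by (auto simp: mfun_def)
qed

lemma exists_spectral_decomposition:
  assumes X: "X \<in> carrier_mat d d" and h: "hermitian_on {..<d} (mfun X)"
  shows "\<exists>U e. spectral_decomposition X U e"
proof -
  obtain p v where v: "diag_on {..<d} (mfun X) {..<d} p v" "complete_on {..<d} {..<d} v"
    using spectral_theorem[OF _ h] by auto
  define U where "U = mat d d (\<lambda>(i, k). v k i)"
  have U: "U \<in> carrier_mat d d" and Ui: "i < d \<Longrightarrow> k < d \<Longrightarrow> U $$ (i, k) = v k i" for i k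
    by (simp_all add: U_def)
  have "spectral_decomposition X U p"
    unfolding spectral_decomposition_iff[OF X U]
    using v by (auto simp: diag_on_def complete_on_def orthonormal_on_def Ui)
  then show ?thesis by blast
qed

text \<open>The choice inside \<open>hermitian_fun\<close> does not involve the function, so one
  \<open>U\<close> and one \<open>e\<close> serve every \<open>f\<close>.\<close>

lemma hermitian_fun_spectral:
  assumes X: "X \<in> carrier_mat d d" and h: "hermitian_on {..<d} (mfun X)"
  obtains U e where "U \<in> carrier_mat d d" "diag_on {..<d} (mfun X) {..<d} e (\<lambda>k i. U $$ (i, k))"
    "\<And>f. hermitian_fun f X = U * mat_diag d (\<lambda>i. complex_of_real (f (e i))) * mat_adjoint U"
proof -
  define Ue where "Ue = (SOME (U, e). spectral_decomposition X U e)"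
  have "\<exists>Ue. case Ue of (U, e) \<Rightarrow> spectral_decomposition X U e"
    using exists_spectral_decomposition[OF assms] by auto
  from someI_ex[OF this] have "case Ue of (U, e) \<Rightarrow> spectral_decomposition X U e"
    unfolding Ue_def .
  then obtain U e where Ue: "Ue = (U, e)" "spectral_decomposition X U e" by (cases Ue) auto
  have U: "U \<in> carrier_mat d d" using Ue(2) X by (simp add: spectral_decomposition_def Let_def)
  have "hermitian_fun f X = U * mat_diag d (\<lambda>i. complex_of_real (f (e i))) * mat_adjoint U" for f
    using Ue(1) X unfolding hermitian_fun_def Ue_def[symmetric] by simp
  with U Ue(2) show thesis using that unfolding spectral_decomposition_iff[OF X U] by blast
qed

lemma entropy_eq_ent:
  assumes X: "X \<in> carrier_mat d d" and h: "hermitian_on {..<d} (mfun X)"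
  shows "entropy X = ent {..<d} (mfun X) / ln 2"
proof -
  obtain U e where U: "U \<in> carrier_mat d d" and D: "diag_on {..<d} (mfun X) {..<d} e (\<lambda>k i. U $$ (i, k))"
    and H: "\<And>f. hermitian_fun f X = U * mat_diag d (\<lambda>i. complex_of_real (f (e i))) * mat_adjoint U"
    using hermitian_fun_spectral[OF assms] by blast
  let ?H = "hermitian_fun (log 2) X" and ?l = "\<lambda>k. complex_of_real (log 2 (e k))"
  have Hc: "?H \<in> carrier_mat d d" unfolding H using U by (auto intro!: carrier_matI)
  have o: "orthonormal_on {..<d} {..<d} (\<lambda>k i. U $$ (i, k))" using D by (simp add: diag_on_def)
  have "mtrace (X * ?H) = (\<Sum>i<d. \<Sum>j<d. X $$ (i, j) * ?H $$ (j, i))"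
    unfolding mtrace_def using X Hc by (intro sum.cong) (auto simp del: index_mult_mat(1) simp add: mat_mult_index_sum)
  also have "\<dots> = (\<Sum>i<d. \<Sum>j<d. \<Sum>k<d. X $$ (i, j) * (?l k * U $$ (j, k) * cnj (U $$ (i, k))))"
    unfolding sum_distrib_left[symmetric] H
    by (intro sum.cong refl) (simp add: conj_diag_index[OF U] del: index_mult_mat(1))
  also have "\<dots> = (\<Sum>k<d. \<Sum>i<d. \<Sum>j<d. X $$ (i, j) * (?l k * U $$ (j, k) * cnj (U $$ (i, k))))"
    by (subst (2) sum.swap, subst (1) sum.swap, rule refl)
  also have "\<dots> = (\<Sum>k<d. ?l k * (\<Sum>i<d. cnj (U $$ (i, k)) * (\<Sum>j<d. mfun X i j * U $$ (j, k))))"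
    by (simp add: sum_distrib_left mfun_def mult_ac)
  also have "\<dots> = (\<Sum>k<d. ?l k * (complex_of_real (e k) * (\<Sum>i<d. cnj (U $$ (i, k)) * U $$ (i, k))))"
    by (intro sum.cong refl) (simp add: diag_on_eigenvector[OF D] sum_distrib_left mult_ac)
  also have "\<dots> = (\<Sum>k<d. ?l k * complex_of_real (e k))"
    using orthonormal_onD[OF o] by simp
  finally have "entropy X = - (\<Sum>k<d. log 2 (e k) * e k)"
    by (simp add: entropy_def)
  also have "\<dots> = (\<Sum>k<d. - (e k * ln (e k))) / ln 2"
    by (simp add: log_def sum_negf sum_divide_distrib mult.commute)
  also have "\<dots> = ent {..<d} (mfun X) / ln 2"
    by (simp add: ent_eq[OF D])
  finally show ?thesis .
qed

section \<open>Positive semidefinite matrices as Gram matrices\<close>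

lemma psd_form_nonneg:
  assumes "psd d X"
  shows "0 \<le> (\<Sum>i<d. \<Sum>j<d. cnj (u i) * mfun X i j * u j)"
proof -
  have X: "X \<in> carrier_mat d d" using assms by (simp add: psd_def)
  have "0 \<le> (X *\<^sub>v vec d u) \<bullet>c vec d u" using assms by (auto simp: psd_def)
  also have "(X *\<^sub>v vec d u) \<bullet>c vec d u = (\<Sum>i<d. \<Sum>j<d. cnj (u i) * mfun X i j * u j)"
    using X by (auto simp: scalar_prod_def atLeast0LessThan mfun_def sum_distrib_right sum_distrib_left mult_ac intro!: sum.cong)
  finally show ?thesis .
qed

lemma psdI_form:
  assumes X: "X \<in> carrier_mat d d" and nn: "\<And>u. 0 \<le> (\<Sum>i<d. \<Sum>j<d. cnj (u i) * mfun X i j * u j)"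
  shows "psd d X"
  unfolding psd_def
proof (intro conjI ballI X)
  fix v :: "complex vec" assume v: "v \<in> carrier_vec d"
  have "(X *\<^sub>v v) \<bullet>c v = (\<Sum>i<d. \<Sum>j<d. cnj (v $ i) * mfun X i j * v $ j)"
    using X v by (auto simp: scalar_prod_def atLeast0LessThan mfun_def sum_distrib_right sum_distrib_left mult_ac intro!: sum.cong)
  with nn[of "\<lambda>i. v $ i"] show "0 \<le> (X *\<^sub>v v) \<bullet>c v" by simp
qed

lemma form_two_points:
  fixes a b :: complex
  assumes "finite I" "i \<in> I" "j \<in> I" "i \<noteq> j"
  shows "(\<Sum>k\<in>I. \<Sum>l\<in>I. cnj (of_bool (k = i) * a + of_bool (k = j) * b) * \<rho> k l * (of_bool (l = i) * a + of_bool (l = j) * b))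
    = cnj a * \<rho> i i * a + cnj a * \<rho> i j * b + cnj b * \<rho> j i * a + cnj b * \<rho> j j * b"
proof -
  have "(\<Sum>k\<in>I. \<Sum>l\<in>I. cnj (of_bool (k = i) * a + of_bool (k = j) * b) * \<rho> k l * (of_bool (l = i) * a + of_bool (l = j) * b))
      = (\<Sum>k\<in>I. \<Sum>l\<in>I. of_bool (l = i) * (cnj (of_bool (k = i) * a + of_bool (k = j) * b) * \<rho> k l * a))
      + (\<Sum>k\<in>I. \<Sum>l\<in>I. of_bool (l = j) * (cnj (of_bool (k = i) * a + of_bool (k = j) * b) * \<rho> k l * b))"
    unfolding sum.distrib[symmetric] by (intro sum.cong refl) (simp add: algebra_simps)
  also have "\<dots> = (\<Sum>k\<in>I. cnj (of_bool (k = i) * a + of_bool (k = j) * b) * (\<rho> k i * a + \<rho> k j * b))"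
    unfolding sum_of_bool_left[OF assms(1,2)] sum_of_bool_left[OF assms(1,3)] sum.distrib[symmetric]
    by (intro sum.cong refl) (simp add: algebra_simps)
  also have "\<dots> = (\<Sum>k\<in>I. of_bool (k = i) * (cnj a * (\<rho> k i * a + \<rho> k j * b)))
      + (\<Sum>k\<in>I. of_bool (k = j) * (cnj b * (\<rho> k i * a + \<rho> k j * b)))"
    unfolding sum.distrib[symmetric] by (intro sum.cong refl) (auto simp: of_bool_def algebra_simps)
  also have "\<dots> = cnj a * \<rho> i i * a + cnj a * \<rho> i j * b + cnj b * \<rho> j i * a + cnj b * \<rho> j j * b"
    unfolding sum_of_bool_left[OF assms(1,2)] sum_of_bool_left[OF assms(1,3)] by (simp add: algebra_simps)
  finally show ?thesis .
qed

text \<open>Nonnegativity in the order on complex numbers forces the quadratic form to be real.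
  Testing it on basis vectors, on sums of two of them and on sums with a factor i determines the
  off-diagonal entries by polarisation.\<close>

lemma psd_hermitian:
  assumes "psd d X"
  shows "hermitian_on {..<d} (mfun X)"
  unfolding hermitian_on_def
proof (intro ballI)
  fix i j assume ij: "i \<in> {..<d}" "j \<in> {..<d}"
  let ?r = "mfun X"
  have im0: "Im (\<Sum>k<d. \<Sum>l<d. cnj (u k) * ?r k l * u l) = 0" for u
    using psd_form_nonneg[OF assms, of u] by (simp add: less_eq_complex_def)
  have diag: "Im (?r k k) = 0" if k: "k \<in> {..<d}" for k
  proof -
    have "(\<Sum>m<d. \<Sum>l<d. cnj (of_bool (m = k)) * ?r m l * of_bool (l = k))
        = (\<Sum>m<d. of_bool (m = k) * (\<Sum>l<d. of_bool (l = k) * ?r m l))"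
      unfolding sum_distrib_left by (intro sum.cong refl) (auto simp: of_bool_def)
    also have "\<dots> = ?r k k"
      unfolding sum_of_bool_left[OF finite_lessThan k] ..
    finally show ?thesis using im0[of "\<lambda>m. of_bool (m = k)"] by simp
  qed
  show "?r j i = cnj (?r i j)"
  proof (cases "i = j")
    case True
    with diag[OF ij(1)] show ?thesis by (simp add: complex_eq_iff)
  next
    case False
    note F = form_two_points[OF finite_lessThan ij False, where \<rho>="?r"]
    have "Im (?r i i + ?r i j + ?r j i + ?r j j) = 0"
      using im0[of "\<lambda>k. of_bool (k = i) * 1 + of_bool (k = j) * 1"] unfolding F by simp
    moreover have "Im (?r i i + ?r i j * \<i> - \<i> * ?r j i + ?r j j) = 0"
      using im0[of "\<lambda>k. of_bool (k = i) * 1 + of_bool (k = j) * \<i>"] unfolding F by (simp add: algebra_simps)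
    ultimately show ?thesis using diag[OF ij(1)] diag[OF ij(2)] by (simp add: complex_eq_iff)
  qed
qed

lemma psd_imp_psd_on:
  assumes "psd d X"
  shows "psd_on {..<d} (mfun X)"
proof -
  obtain p v where v: "diag_on {..<d} (mfun X) {..<d} p v" "complete_on {..<d} {..<d} v"
    using spectral_theorem[OF _ psd_hermitian[OF assms]] by auto
  have o: "orthonormal_on {..<d} {..<d} v" using v by (simp add: diag_on_def)
  show ?thesis
  proof (rule psd_onI_diag[OF v(1)])
    fix k assume k: "k \<in> {..<d}"
    have "(\<Sum>i<d. \<Sum>j<d. cnj (v k i) * mfun X i j * v k j) = (\<Sum>i<d. cnj (v k i) * (\<Sum>j<d. mfun X i j * v k j))"
      by (simp add: sum_distrib_left mult_ac)
    also have "\<dots> = complex_of_real (p k) * (\<Sum>i<d. cnj (v k i) * v k i)"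
      using diag_on_eigenvector[OF v(1) _ k] by (simp add: sum_distrib_left mult_ac)
    also have "\<dots> = complex_of_real (p k)" using orthonormal_onD[OF o k k] by simp
    finally show "0 \<le> p k" using psd_form_nonneg[OF assms, of "v k"] by (simp add: less_eq_complex_def)
  qed simp
qed

section \<open>Flattened indices and conditional mutual information of matrices\<close>

lemma entropy_reindex:
  assumes X: "X \<in> carrier_mat n n" and h: "bij_betw h {..<n} S" and S: "finite S" and psd: "psd_on S \<tau>"
    and eq: "\<And>i j. i < n \<Longrightarrow> j < n \<Longrightarrow> X $$ (i, j) = \<tau> (h i) (h j)"
  shows "entropy X = ent S \<tau> / ln 2"
proof -
  have "psd_on {..<n} (\<lambda>i j. \<tau> (h i) (h j))"
    by (rule psd_on_reindex[OF psd]) (use bij_betwE[OF h] in blast)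
  then have "psd_on {..<n} (mfun X)"
    by (subst psd_on_cong[where \<sigma>="\<lambda>i j. \<tau> (h i) (h j)"]) (auto simp: mfun_def eq)
  then have "entropy X = ent {..<n} (mfun X) / ln 2"
    by (intro entropy_eq_ent[OF X] psd_on_hermitian)
  also have "ent {..<n} (mfun X) = ent {..<n} (\<lambda>i j. \<tau> (h i) (h j))"
    by (rule ent_cong) (auto simp: mfun_def eq)
  also have "\<dots> = ent S \<tau>" by (rule ent_reindex[OF S psd h])
  finally show ?thesis .
qed

lemma pair_index_less:
  fixes a b c d :: nat
  assumes "a < c" "b < d"
  shows "a * d + b < c * d"
proof -
  have "a * d + b < (a + 1) * d" using assms by simp
  also have "\<dots> \<le> c * d" using assms by (intro mult_right_mono) auto
  finally show ?thesis .
qed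

lemma div_mod_bounds:
  fixes i a c :: nat
  assumes "i < a * c"
  shows "i div c < a" "i mod c < c"
proof -
  have "c > 0" using assms by (cases c) auto
  then show "i mod c < c" by simp
  show "i div c < a" using assms by (simp add: less_mult_imp_div_less)
qed

lemma bij_betw_div_mod: "bij_betw (\<lambda>i. (i div c, i mod c)) {..<a * c} ({..<a} \<times> {..<c :: nat})"
  by (rule bij_betw_byWitness[where f'="\<lambda>x. fst x * c + snd x"]) (auto simp: pair_index_less div_mod_bounds)

lemma sum_lessThan_mult:
  fixes f :: "nat \<Rightarrow> 'a :: comm_monoid_add"
  shows "(\<Sum>k<a * c. f k) = (\<Sum>x<a. \<Sum>y<c. f (x * c + y))"
  using sum.reindex_bij_betw[OF bij_betw_div_mod, of "\<lambda>x. f (fst x * c + snd x)" c a] by (simp add: sum_Times)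

definition tri :: "nat \<Rightarrow> nat \<Rightarrow> complex mat \<Rightarrow> nat \<times> (nat \<times> nat) \<Rightarrow> nat \<times> (nat \<times> nat) \<Rightarrow> complex" where
  "tri b c X = (\<lambda>x y. X $$ ((fst x * b + fst (snd x)) * c + snd (snd x), (fst y * b + fst (snd y)) * c + snd (snd y)))"

lemma psd_on_tri:
  assumes "psd (a * b * c) X"
  shows "psd_on ({..<a} \<times> ({..<b} \<times> {..<c})) (tri b c X)"
  using psd_on_reindex[OF psd_imp_psd_on[OF assms], of "{..<a} \<times> ({..<b} \<times> {..<c})"
      "\<lambda>x. (fst x * b + fst (snd x)) * c + snd (snd x)"]
  by (auto simp: tri_def mfun_def pair_index_less)

lemma otr_tri:
  assumes "density_operator (a * b * c) X"
  shows "otr ({..<a} \<times> ({..<b} \<times> {..<c})) (tri b c X) = 1"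
proof -
  have "X \<in> carrier_mat (a * b * c) (a * b * c)" "mtrace X = 1"
    using assms by (auto simp: density_operator_def psd_def)
  then have "(\<Sum>i<a * b * c. X $$ (i, i)) = 1" by (simp add: mtrace_def)
  then have "Re (\<Sum>i<a * b * c. X $$ (i, i)) = 1" by simp
  then show ?thesis by (simp add: sum_lessThan_mult otr_def tri_def sum_Times)
qed

lemma cond_mutual_info_eq:
  assumes psd: "psd (a * b * c) X"
  shows "cond_mutual_info a b c X = cmi {..<a} {..<b} {..<c} (tri b c X) / ln 2"
proof -
  let ?A = "{..<a}" and ?B = "{..<b}" and ?C = "{..<c}" and ?t = "tri b c X"
  have X: "X \<in> carrier_mat (a * b * c) (a * b * c)" using psd by (simp add: psd_def)
  note pt = psd_on_tri[OF psd]
  have 1: "entropy (ptrace a b c X) = ent (?A \<times> ?C) (ptr ?B (swp ?t)) / ln 2"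
  proof (rule entropy_reindex[OF _ bij_betw_div_mod])
    show "ptrace a b c X \<in> carrier_mat (a * c) (a * c)" by (simp add: ptrace_def)
    show "psd_on (?A \<times> ?C) (ptr ?B (swp ?t))" by (intro psd_on_ptr psd_on_swp pt) auto
  qed (auto simp: ptrace_def ptr_def swp_def tri_def)
  have 2: "entropy (ptrace 1 a (b * c) X) = ent (?B \<times> ?C) (ptr ?A ?t) / ln 2"
  proof (rule entropy_reindex[OF _ bij_betw_div_mod])
    show "ptrace 1 a (b * c) X \<in> carrier_mat (b * c) (b * c)" by (simp add: ptrace_def)
    show "psd_on (?B \<times> ?C) (ptr ?A ?t)" by (intro psd_on_ptr pt) auto
    fix i j assume ij: "i < b * c" "j < b * c"
    \<comment> \<open>\<open>tri\<close> splits an index into three digits; for the reduced state of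
      \<open>B E\<close> the last two are read as the single digit \<open>m\<close> in base
      \<open>b * c\<close>.\<close>
    have "(k * b + m div c) * c + m mod c = k * (b * c) + m" for k m
      by (simp add: add_mult_distrib add.assoc mult.assoc)
    then show "ptrace 1 a (b * c) X $$ (i, j) = ptr ?A ?t (i div c, i mod c) (j div c, j mod c)"
      using ij by (simp add: ptrace_def ptr_def tri_def)
  qed simp
  have 3: "entropy X = ent (?A \<times> (?B \<times> ?C)) ?t / ln 2"
  proof (rule entropy_reindex[OF X, where h="\<lambda>i. (i div c div b, (i div c mod b, i mod c))"])
    have "i div c div b < a \<and> i div c mod b < b \<and> i mod c < c" if "i < a * b * c" for i
      using div_mod_bounds[of i "a * b" c] div_mod_bounds[of "i div c" a b] that by auto
    then show "bij_betw (\<lambda>i. (i div c div b, i div c mod b, i mod c)) {..<a * b * c} (?A \<times> ?B \<times> ?C)"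
      by (intro bij_betw_byWitness[where f'="\<lambda>x. (fst x * b + fst (snd x)) * c + snd (snd x)"])
        (auto simp: pair_index_less)
  qed (use pt in \<open>auto simp: tri_def\<close>)
  have 4: "entropy (ptrace 1 (a * b) c X) = ent ?C (ptr ?B (ptr ?A ?t)) / ln 2"
  proof (rule entropy_reindex[where h="\<lambda>i. i"])
    show "ptrace 1 (a * b) c X \<in> carrier_mat c c" by (simp add: ptrace_def)
    show "psd_on ?C (ptr ?B (ptr ?A ?t))" by (intro psd_on_ptr pt) auto
    show "bij_betw (\<lambda>i. i) {..<c} ?C" by (simp add: bij_betw_def)
    fix i j assume ij: "i < c" "j < c"
    have "ptrace 1 (a * b) c X $$ (i, j) = (\<Sum>x<a. \<Sum>y<b. X $$ ((x * b + y) * c + i, (x * b + y) * c + j))"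
      using ij by (simp add: ptrace_def sum_lessThan_mult)
    also have "\<dots> = ptr ?B (ptr ?A ?t) i j"
      unfolding ptr_def tri_def by (subst sum.swap) simp
    finally show "ptrace 1 (a * b) c X $$ (i, j) = ptr ?B (ptr ?A ?t) i j" .
  qed simp
  show ?thesis
    unfolding cond_mutual_info_def cmi_def 1 2 3 4 by (simp add: diff_divide_distrib add_divide_distrib)
qed

text \<open>The expectation in a unit vector is an average of eigenvalues with weights at most 1, so
  it cannot fall below minus the sum of their absolute values.\<close>

lemma trace_norm_ge:
  assumes X: "X \<in> carrier_mat d d" and h: "hermitian_on {..<d} (mfun X)" and u: "(\<Sum>i<d. cnj (u i) * u i) = 1"
  shows "- trace_norm X \<le> Re (\<Sum>i<d. \<Sum>j<d. cnj (u i) * mfun X i j * u j)"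
proof -
  obtain p v where v: "diag_on {..<d} (mfun X) {..<d} p v" "complete_on {..<d} {..<d} v"
    using spectral_theorem[OF _ h] by auto
  have o: "orthonormal_on {..<d} {..<d} v" using v by (simp add: diag_on_def)
  define Y where "Y = mat_adjoint X * X"
  have aX: "mat_adjoint X \<in> carrier_mat d d" using X by (auto intro: carrier_matI)
  have Y: "Y \<in> carrier_mat d d" using X aX by (simp add: Y_def)
  have DY: "diag_on {..<d} (mfun Y) {..<d} (\<lambda>k. (p k)\<^sup>2) v"
  proof (rule diag_onI_eigenvectors[OF o v(2)])
    fix k i assume k: "k \<in> {..<d}" and i: "i \<in> {..<d}"
    have Yi: "mfun Y i j = (\<Sum>l<d. mfun X i l * mfun X l j)" if "j < d" for j
    proof -
      have "mfun Y i j = (\<Sum>l<d. mat_adjoint X $$ (i, l) * X $$ (l, j))"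
        unfolding mfun_def Y_def using i that by (intro mat_mult_index_sum[OF aX X]) auto
      also have "\<dots> = (\<Sum>l<d. cnj (mfun X l i) * mfun X l j)"
        using X i by (intro sum.cong) (auto simp: mat_adjoint_index mfun_def)
      also have "\<dots> = (\<Sum>l<d. mfun X i l * mfun X l j)"
        using hermitian_onD[OF h] i by (intro sum.cong) auto
      finally show ?thesis .
    qed
    have "(\<Sum>j<d. mfun Y i j * v k j) = (\<Sum>j<d. \<Sum>l<d. mfun X i l * (mfun X l j * v k j))"
      by (simp add: Yi sum_distrib_right mult.assoc)
    also have "\<dots> = (\<Sum>l<d. mfun X i l * (\<Sum>j<d. mfun X l j * v k j))"
      by (subst sum.swap) (simp add: sum_distrib_left)
    also have "\<dots> = (\<Sum>l<d. mfun X i l * (complex_of_real (p k) * v k l))"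
      using diag_on_eigenvector[OF v(1) _ k] by (intro sum.cong) auto
    also have "\<dots> = complex_of_real (p k) * (\<Sum>l<d. mfun X i l * v k l)"
      by (simp add: sum_distrib_left mult_ac)
    also have "\<dots> = complex_of_real ((p k)\<^sup>2) * v k i"
      using diag_on_eigenvector[OF v(1) _ k i] by (simp add: power2_eq_square)
    finally show "(\<Sum>j\<in>{..<d}. mfun Y i j * v k j) = complex_of_real ((p k)\<^sup>2) * v k i" .
  qed simp
  have hY: "hermitian_on {..<d} (mfun Y)"
    by (rule psd_on_hermitian, rule psd_onI_diag[OF DY]) auto
  obtain U e where U: "U \<in> carrier_mat d d" and D: "diag_on {..<d} (mfun Y) {..<d} e (\<lambda>k i. U $$ (i, k))"
    and H: "\<And>f. hermitian_fun f Y = U * mat_diag d (\<lambda>i. complex_of_real (f (e i))) * mat_adjoint U"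
    using hermitian_fun_spectral[OF Y hY] by blast
  have oU: "orthonormal_on {..<d} {..<d} (\<lambda>k i. U $$ (i, k))" using D by (simp add: diag_on_def)
  have "mtrace (hermitian_fun sqrt Y) = (\<Sum>i<d. \<Sum>k<d. complex_of_real (sqrt (e k)) * (cnj (U $$ (i, k)) * U $$ (i, k)))"
    unfolding mtrace_def H using U
    by (intro sum.cong) (auto simp: conj_diag_index[OF U] mult_ac simp del: index_mult_mat(1))
  also have "\<dots> = (\<Sum>k<d. complex_of_real (sqrt (e k)))"
    by (subst sum.swap) (simp add: sum_distrib_left[symmetric] orthonormal_onD[OF oU])
  finally have "trace_norm X = (\<Sum>k<d. sqrt (e k))"
    by (simp add: trace_norm_def Y_def)
  \<comment> \<open>\<open>hermitian_fun\<close> may have diagonalised X^* X in another basis than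
    \<open>v\<close>; uniqueness of spectral sums makes this irrelevant.\<close>
  also have "\<dots> = (\<Sum>k<d. sqrt ((p k)\<^sup>2))"
    by (rule diag_on_spectral_sum_unique[OF D _ DY]) auto
  finally have T: "trace_norm X = (\<Sum>k<d. \<bar>p k\<bar>)" by simp
  define w where "w k = (cmod (\<Sum>i<d. cnj (v k i) * u i))\<^sup>2" for k
  have "(\<Sum>k<d. w k) = 1" unfolding w_def by (rule complete_on_overlap[OF v(2) _ u]) simp
  then have w1: "w k \<le> 1" if "k < d" for k
    using member_le_sum[of k "{..<d}" w] that by (simp add: w_def)
  have "Re (\<Sum>i<d. \<Sum>j<d. cnj (u i) * mfun X i j * u j) = (\<Sum>k<d. p k * w k)"
    unfolding diag_on_quadratic_form[OF v(1)] w_def by (rule Re_complex_of_real)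
  also have "\<dots> \<ge> (\<Sum>k<d. - \<bar>p k\<bar>)"
  proof (rule sum_mono)
    fix k assume "k \<in> {..<d}"
    then have "\<bar>p k\<bar> * w k \<le> \<bar>p k\<bar> * 1" using w1 by (intro mult_left_mono) auto
    moreover have "- (\<bar>p k\<bar> * w k) \<le> p k * w k"
    proof -
      have "0 \<le> (\<bar>p k\<bar> + p k) * w k" by (intro mult_nonneg_nonneg) (auto simp: w_def)
      then show ?thesis by (simp add: algebra_simps)
    qed
    ultimately show "- \<bar>p k\<bar> \<le> p k * w k" by linarith
  qed
  finally show ?thesis unfolding T by (simp add: sum_negf)
qed

section \<open>Kraus operators\<close>

definition mat_unit :: "nat \<Rightarrow> nat \<Rightarrow> nat \<Rightarrow> complex mat" where
  "mat_unit d p q = mat d d (\<lambda>(k, l). of_bool (k = p \<and> l = q))"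

lemma linear_mat_map_expand:
  assumes lin: "linear_mat_map d d' \<Phi>" and X: "X \<in> carrier_mat d d" and rs: "r < d'" "s < d'"
  shows "\<Phi> X $$ (r, s) = (\<Sum>p<d. \<Sum>q<d. X $$ (p, q) * \<Phi> (mat_unit d p q) $$ (r, s))"
proof -
  define R where "R S = mat d d (\<lambda>(k, l). if (k, l) \<in> S then X $$ (k, l) else 0)" for S :: "(nat \<times> nat) set"
  have Rc: "R S \<in> carrier_mat d d" for S by (simp add: R_def)
  have uc: "mat_unit d p q \<in> carrier_mat d d" for p q by (simp add: mat_unit_def)
  have cl: "\<Phi> Y \<in> carrier_mat d' d'" and add: "\<Phi> (Y + Z) = \<Phi> Y + \<Phi> Z" and smult: "\<Phi> (c \<cdot>\<^sub>m Y) = c \<cdot>\<^sub>m \<Phi> Y"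
    if "Y \<in> carrier_mat d d" "Z \<in> carrier_mat d d" for Y Z c
    using lin that by (auto simp: linear_mat_map_def)
  have "\<Phi> (R S) $$ (r, s) = (\<Sum>x\<in>S. X $$ x * \<Phi> (mat_unit d (fst x) (snd x)) $$ (r, s))"
    if "finite S" "S \<subseteq> {..<d} \<times> {..<d}" for S
    using that
  proof (induction S rule: finite_induct)
    case empty
    \<comment> \<open>Linearity mentions no zero matrix; that it is mapped to zero comes from
      scaling by 0.\<close>
    have "R {} = 0 \<cdot>\<^sub>m R {}" by (intro eq_matI) (auto simp: R_def)
    then have "\<Phi> (R {}) = 0 \<cdot>\<^sub>m \<Phi> (R {})" using smult[OF Rc Rc] by metis
    then have "\<Phi> (R {}) $$ (r, s) = (0 \<cdot>\<^sub>m \<Phi> (R {})) $$ (r, s)" by simp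
    also have "\<dots> = 0" using cl[OF Rc Rc, of "{}"] rs by simp
    finally show ?case by simp
  next
    case (insert x S)
    obtain p q where x: "x = (p, q)" by (cases x)
    have "R (insert x S) = R S + X $$ x \<cdot>\<^sub>m mat_unit d p q"
      using insert.hyps insert.prems by (intro eq_matI) (auto simp: R_def mat_unit_def x)
    then have "\<Phi> (R (insert x S)) = \<Phi> (R S) + X $$ x \<cdot>\<^sub>m \<Phi> (mat_unit d p q)"
      using add[OF Rc, of "X $$ x \<cdot>\<^sub>m mat_unit d p q"] smult[OF uc uc] uc by simp
    then have "\<Phi> (R (insert x S)) $$ (r, s) = \<Phi> (R S) $$ (r, s) + X $$ x * \<Phi> (mat_unit d p q) $$ (r, s)"
      using cl[OF Rc Rc, of S] cl[OF uc uc, of p q] rs by simp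
    then show ?case using insert by (simp add: x)
  qed
  from this[of "{..<d} \<times> {..<d}"]
  have "\<Phi> (R ({..<d} \<times> {..<d})) $$ (r, s) = (\<Sum>p<d. \<Sum>q<d. X $$ (p, q) * \<Phi> (mat_unit d p q) $$ (r, s))"
    by (simp add: sum_Times)
  moreover have "R ({..<d} \<times> {..<d}) = X" using X by (intro eq_matI) (auto simp: R_def)
  ultimately show ?thesis by simp
qed

text \<open>The columns of a square root of the Choi matrix are the Kraus operators.\<close>

lemma completely_positive_kraus:
  assumes cp: "completely_positive d d' \<Phi>"
  shows "\<exists>(K :: nat set) M. finite K \<and> (\<forall>X\<in>carrier_mat d d. \<forall>r<d'. \<forall>s<d'.
    \<Phi> X $$ (r, s) = (\<Sum>k\<in>K. \<Sum>p<d. \<Sum>q<d. M k r p * X $$ (p, q) * cnj (M k s q)))"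
proof -
  \<comment> \<open>The unnormalised maximally entangled vector of two systems of dimension
    \<open>d\<close>. Applying the map to one half of its projection \<open>X0\<close> gives the
    Choi matrix, whose blocks are the images of the matrix units.\<close>
  define a :: "nat \<Rightarrow> complex" where "a i = of_bool (i div d = i mod d)" for i
  define X0 where "X0 = mat (d * d) (d * d) (\<lambda>(i, j). a i * a j)"
  have "psd (d * d) X0"
  proof (rule psdI_form)
    fix u
    have "(\<Sum>i<d * d. \<Sum>j<d * d. cnj (u i) * mfun X0 i j * u j) = cnj (\<Sum>i<d * d. a i * u i) * (\<Sum>i<d * d. a i * u i)"
      unfolding sum_product cnj_sum by (intro sum.cong refl) (simp add: mfun_def X0_def a_def)
    also have "\<dots> = complex_of_real ((cmod (\<Sum>i<d * d. a i * u i))\<^sup>2)" by (rule cnj_mult_self)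
    finally show "0 \<le> (\<Sum>i<d * d. \<Sum>j<d * d. cnj (u i) * mfun X0 i j * u j)"
      by (simp only: less_eq_complex_def Re_complex_of_real Im_complex_of_real) simp
  qed (simp add: X0_def)
  then have psd: "psd (d * d') (local_map d d 1 d' \<Phi> X0)"
    using cp by (simp add: completely_positive_def)
  define C where "C = local_map d d 1 d' \<Phi> X0"
  have CC: "C $$ (p * d' + r, q * d' + s) = \<Phi> (mat_unit d p q) $$ (r, s)" if "p < d" "q < d" "r < d'" "s < d'" for p q r s
  proof -
    have "mat d d (\<lambda>(k, l). X0 $$ (p * d + k, q * d + l)) = mat_unit d p q"
      using that by (intro eq_matI) (auto simp: X0_def a_def mat_unit_def pair_index_less)
    then show ?thesis
      using that pair_index_less[of p d r d'] pair_index_less[of q d s d'] by (simp add: C_def local_map_def)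
  qed
  obtain K :: "nat set" and v where K: "finite K"
    and v': "\<forall>i\<in>{..<d * d'}. \<forall>j\<in>{..<d * d'}. mfun C i j = (\<Sum>k\<in>K. v k i * cnj (v k j))"
    using psd_imp_psd_on[OF psd[folded C_def]] unfolding psd_on_def by blast
  have v: "\<Phi> (mat_unit d p q) $$ (r, s) = (\<Sum>k\<in>K. v k (p * d' + r) * cnj (v k (q * d' + s)))"
    if "p < d" "q < d" "r < d'" "s < d'" for p q r s
    using v' CC[OF that] that pair_index_less[of p d r d'] pair_index_less[of q d s d'] by (simp add: mfun_def)
  have lin: "linear_mat_map d d' \<Phi>" using cp by (simp add: completely_positive_def)
  define M where "M k r p = v k (p * d' + r)" for k r p
  have "\<Phi> X $$ (r, s) = (\<Sum>k\<in>K. \<Sum>p<d. \<Sum>q<d. M k r p * X $$ (p, q) * cnj (M k s q))"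
    if "X \<in> carrier_mat d d" "r < d'" "s < d'" for X r s
  proof -
    have "\<Phi> X $$ (r, s) = (\<Sum>p<d. \<Sum>q<d. \<Sum>k\<in>K. M k r p * X $$ (p, q) * cnj (M k s q))"
      unfolding linear_mat_map_expand[OF lin that]
      by (intro sum.cong refl) (use that in \<open>simp add: v M_def sum_distrib_left mult_ac\<close>)
    also have "\<dots> = (\<Sum>k\<in>K. \<Sum>p<d. \<Sum>q<d. M k r p * X $$ (p, q) * cnj (M k s q))"
      by (subst (2) sum.swap, subst (1) sum.swap, rule refl)
    finally show ?thesis .
  qed
  with K show ?thesis by blast
qed

text \<open>The isometry condition runs over all pairs of an outcome and one of its Kraus operators:
  refining outcomes to such pairs yields an instrument of the kind treated in
  \<open>cmi_instrument_le\<close>.\<close>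

definition kraus ::
  "nat \<Rightarrow> nat \<Rightarrow> nat \<Rightarrow> (nat \<Rightarrow> complex mat \<Rightarrow> complex mat) \<Rightarrow> (nat \<Rightarrow> nat set) \<Rightarrow> (nat \<Rightarrow> nat \<Rightarrow> nat \<Rightarrow> nat \<Rightarrow> complex) \<Rightarrow> bool" where
  "kraus d d' m \<Phi> K M \<longleftrightarrow>
     (\<forall>i<m. finite (K i)) \<and>
     (\<forall>i<m. \<forall>X\<in>carrier_mat d d. \<forall>r<d'. \<forall>s<d'.
        \<Phi> i X $$ (r, s) = (\<Sum>k\<in>K i. \<Sum>p<d. \<Sum>q<d. M i k r p * X $$ (p, q) * cnj (M i k s q))) \<and>
     (\<forall>a<d. \<forall>b<d. (\<Sum>z\<in>Sigma {..<m} K. \<Sum>r<d'. cnj (M (fst z) (snd z) r a) * M (fst z) (snd z) r b) = of_bool (a = b))"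

lemma instrument_kraus:
  assumes ins: "instrument d d' m \<Phi>"
  shows "\<exists>K M. kraus d d' m \<Phi> K M"
proof -
  define P where "P i KM \<longleftrightarrow> finite (fst KM) \<and> (\<forall>X\<in>carrier_mat d d. \<forall>r<d'. \<forall>s<d'.
    \<Phi> i X $$ (r, s) = (\<Sum>k\<in>fst KM. \<Sum>p<d. \<Sum>q<d. snd KM k r p * X $$ (p, q) * cnj (snd KM k s q)))"
    for i :: nat and KM :: "nat set \<times> (nat \<Rightarrow> nat \<Rightarrow> nat \<Rightarrow> complex)"
  have "\<forall>i\<in>{..<m}. \<exists>KM. P i KM"
  proof
    fix i assume "i \<in> {..<m}"
    then have cp: "completely_positive d d' (\<Phi> i)" using ins by (simp add: instrument_def)
    obtain K :: "nat set" and M where "finite K" "\<forall>X\<in>carrier_mat d d. \<forall>r<d'. \<forall>s<d'.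
      \<Phi> i X $$ (r, s) = (\<Sum>k\<in>K. \<Sum>p<d. \<Sum>q<d. M k r p * X $$ (p, q) * cnj (M k s q))"
      using completely_positive_kraus[OF cp] by blast
    then have "P i (K, M)" by (simp add: P_def)
    then show "\<exists>KM. P i KM" ..
  qed
  from bchoice[OF this] obtain f where f: "\<forall>i\<in>{..<m}. P i (f i)" ..
  define K where "K i = fst (f i)" for i
  define M where "M i = snd (f i)" for i
  have fK: "finite (K i)" if "i < m" for i using f that unfolding P_def K_def by blast
  have kr: "\<Phi> i X $$ (r, s) = (\<Sum>k\<in>K i. \<Sum>p<d. \<Sum>q<d. M i k r p * X $$ (p, q) * cnj (M i k s q))"
    if "i < m" "X \<in> carrier_mat d d" "r < d'" "s < d'" for i X r s
    using f that unfolding P_def K_def M_def by blast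
  have iso: "(\<Sum>z\<in>Sigma {..<m} K. \<Sum>r<d'. cnj (M (fst z) (snd z) r a) * M (fst z) (snd z) r b) = of_bool (a = b)"
    if ab: "a < d" "b < d" for a b
  proof -
    \<comment> \<open>Trace preservation on the matrix unit with transposed indices yields the entry
      \<open>(a, b)\<close> of the sum of the products M^* M.\<close>
    let ?E = "mat_unit d b a"
    have E: "?E \<in> carrier_mat d d" by (simp add: mat_unit_def)
    have tr: "(\<Sum>i<m. mtrace (\<Phi> i ?E)) = mtrace ?E" using ins E by (simp add: instrument_def)
    have "mtrace ?E = (\<Sum>i<d. of_bool (i = b) * of_bool (i = a))"
      unfolding mtrace_def by (intro sum.cong) (auto simp: mat_unit_def)
    also have "\<dots> = of_bool (a = b)" using ab by (subst sum_of_bool_left) auto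
    finally have 1: "mtrace ?E = of_bool (a = b)" .
    have "mtrace (\<Phi> i ?E) = (\<Sum>k\<in>K i. \<Sum>r<d'. cnj (M i k r a) * M i k r b)" if i: "i < m" for i
    proof -
      have c: "\<Phi> i ?E \<in> carrier_mat d' d'"
        using ins i E by (simp add: instrument_def completely_positive_def linear_mat_map_def)
      have "mtrace (\<Phi> i ?E) = (\<Sum>r<d'. \<Sum>k\<in>K i. \<Sum>p<d. \<Sum>q<d. M i k r p * ?E $$ (p, q) * cnj (M i k r q))"
        unfolding mtrace_def using c kr[OF i E] by (intro sum.cong) auto
      also have "\<dots> = (\<Sum>r<d'. \<Sum>k\<in>K i. \<Sum>p<d. of_bool (p = b) * (\<Sum>q<d. of_bool (q = a) * (M i k r p * cnj (M i k r q))))"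
        unfolding sum_distrib_left by (intro sum.cong refl) (auto simp: mat_unit_def of_bool_def)
      also have "\<dots> = (\<Sum>r<d'. \<Sum>k\<in>K i. \<Sum>q<d. of_bool (q = a) * (M i k r b * cnj (M i k r q)))"
        by (intro sum.cong[OF refl] sum_of_bool_left) (use ab in auto)
      also have "\<dots> = (\<Sum>r<d'. \<Sum>k\<in>K i. M i k r b * cnj (M i k r a))"
        by (rule sum.cong[OF refl], rule sum.cong[OF refl], rule sum_of_bool_left) (use ab in auto)
      also have "\<dots> = (\<Sum>k\<in>K i. \<Sum>r<d'. cnj (M i k r a) * M i k r b)"
        by (subst sum.swap) (simp add: mult.commute)
      finally show ?thesis .
    qed
    then have "(\<Sum>i<m. \<Sum>k\<in>K i. \<Sum>r<d'. cnj (M i k r a) * M i k r b) = of_bool (a = b)"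
      using tr 1 by simp
    then show ?thesis using fK by (subst sum_Sigma) auto
  qed
  have "kraus d d' m \<Phi> K M" unfolding kraus_def using fK kr iso by blast
  then show ?thesis by blast
qed

section \<open>LOCC monotonicity\<close>

text \<open>The link between a flattened matrix and an extension with nested indices:
  \<open>X\<close> is the reduced operator of \<open>\<sigma>\<close> on the first two
  systems.\<close>

definition marg :: "nat \<Rightarrow> nat \<Rightarrow> 'e set \<Rightarrow> complex mat \<Rightarrow> (nat \<times> (nat \<times> 'e) \<Rightarrow> nat \<times> (nat \<times> 'e) \<Rightarrow> complex) \<Rightarrow> bool" where
  "marg a b E X \<sigma> \<longleftrightarrow> X \<in> carrier_mat (a * b) (a * b) \<and>
     (\<forall>i<a. \<forall>j<b. \<forall>i'<a. \<forall>j'<b. X $$ (i * b + j, i' * b + j') = (\<Sum>e\<in>E. \<sigma> (i, (j, e)) (i', (j', e))))"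

text \<open>The invariant of the induction over protocols. It transforms each extension separately,
  so no infimum intervenes, and keeps extensions on index sets of type \<open>nat\<close> because a
  definition cannot quantify over types.\<close>

definition locc_mono :: "nat \<Rightarrow> nat \<Rightarrow> nat \<Rightarrow> nat \<Rightarrow> (complex mat \<Rightarrow> complex mat) \<Rightarrow> bool" where
  "locc_mono a b a' b' \<Lambda> \<longleftrightarrow> (\<forall>X (E :: nat set) \<sigma>. finite E \<longrightarrow> psd_on ({..<a} \<times> ({..<b} \<times> E)) \<sigma> \<longrightarrow> marg a b E X \<sigma> \<longrightarrow>
     (\<exists>(E' :: nat set) \<sigma>'. finite E' \<and> psd_on ({..<a'} \<times> ({..<b'} \<times> E')) \<sigma>' \<and> marg a' b' E' (\<Lambda> X) \<sigma>' \<and>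
        otr ({..<a'} \<times> ({..<b'} \<times> E')) \<sigma>' = otr ({..<a} \<times> ({..<b} \<times> E)) \<sigma> \<and>
        cmi {..<a'} {..<b'} E' \<sigma>' \<le> cmi {..<a} {..<b} E \<sigma>))"

text \<open>The direct sum with a label in the extension, brought back to type \<open>nat\<close> by
  \<open>prod_encode\<close>.\<close>

lemma merge_extensions:
  fixes E :: "nat \<Rightarrow> nat set"
  assumes fin: "finite M" "\<And>m. m \<in> M \<Longrightarrow> finite (E m)"
    and psd: "\<And>m. m \<in> M \<Longrightarrow> psd_on ({..<a :: nat} \<times> ({..<b :: nat} \<times> E m)) (\<sigma> m)"
  shows "\<exists>(E' :: nat set) \<sigma>'. finite E' \<and> psd_on ({..<a} \<times> ({..<b} \<times> E')) \<sigma>' \<and>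
    otr ({..<a} \<times> ({..<b} \<times> E')) \<sigma>' = (\<Sum>m\<in>M. otr ({..<a} \<times> ({..<b} \<times> E m)) (\<sigma> m)) \<and>
    cmi {..<a} {..<b} E' \<sigma>' = (\<Sum>m\<in>M. cmi {..<a} {..<b} (E m) (\<sigma> m)) \<and>
    (\<forall>i j i' j'. (\<Sum>e\<in>E'. \<sigma>' (i, (j, e)) (i', (j', e))) = (\<Sum>m\<in>M. \<Sum>e\<in>E m. \<sigma> m (i, (j, e)) (i', (j', e))))"
proof -
  define E' where "E' = prod_encode ` Sigma M E"
  define \<sigma>' where "\<sigma>' = relabel (\<lambda>i. i) (\<lambda>i. i) prod_decode (dsum \<sigma>)"
  have fS: "finite (Sigma M E)" using fin by auto
  have bd: "bij_betw prod_decode E' (Sigma M E)"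
    unfolding E'_def by (rule bij_betw_byWitness[where f'=prod_encode]) auto
  have bi: "bij_betw (\<lambda>i. i) S S" for S :: "nat set" by (simp add: bij_betw_def)
  have pd: "psd_on ({..<a} \<times> ({..<b} \<times> Sigma M E)) (dsum \<sigma>)"
    by (rule psd_on_dsum[OF fin(1) psd])
  have "(\<Sum>e\<in>E'. \<sigma>' (i, (j, e)) (i', (j', e))) = (\<Sum>m\<in>M. \<Sum>e\<in>E m. \<sigma> m (i, (j, e)) (i', (j', e)))" for i j i' j'
  proof -
    have "(\<Sum>e\<in>E'. \<sigma>' (i, (j, e)) (i', (j', e))) = (\<Sum>z\<in>Sigma M E. dsum \<sigma> (i, (j, z)) (i', (j', z)))"
      unfolding \<sigma>'_def relabel_def
      using sum.reindex_bij_betw[OF bd, of "\<lambda>z. dsum \<sigma> (i, (j, z)) (i', (j', z))"] by simp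
    also have "\<dots> = (\<Sum>m\<in>M. \<Sum>e\<in>E m. \<sigma> m (i, (j, e)) (i', (j', e)))"
      using fin by (subst sum_Sigma) (auto simp: dsum_def)
    finally show ?thesis .
  qed
  moreover have "otr ({..<a} \<times> ({..<b} \<times> E')) \<sigma>' = (\<Sum>m\<in>M. otr ({..<a} \<times> ({..<b} \<times> E m)) (\<sigma> m))"
    unfolding \<sigma>'_def otr_relabel[OF bi bi bd] by (rule otr_dsum) (use fin in auto)
  moreover have "cmi {..<a} {..<b} E' \<sigma>' = (\<Sum>m\<in>M. cmi {..<a} {..<b} (E m) (\<sigma> m))"
    unfolding \<sigma>'_def cmi_relabel[OF bi bi bd finite_lessThan finite_lessThan fS pd]
    by (rule cmi_dsum) (use fin psd in auto)
  moreover have "psd_on ({..<a} \<times> ({..<b} \<times> E')) \<sigma>'"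
    unfolding \<sigma>'_def by (rule psd_on_relabel[OF bi bi bd pd])
  moreover have "finite E'" using fS by (simp add: E'_def)
  ultimately show ?thesis by blast
qed

text \<open>The part of a round common to both parties. Besides the outcome \<open>i\<close>, the
  extension also records the Kraus operator \<open>k\<close>, which neither party learns; this is
  legitimate because an extension may hold anything.\<close>

lemma locc_combine:
  fixes E :: "nat set" and K :: "nat \<Rightarrow> nat set"
  assumes IH: "\<And>i. i < m \<Longrightarrow> locc_mono a1 b1 a' b' (\<Lambda> i)"
    and E: "finite E" and K: "\<And>i. i < m \<Longrightarrow> finite (K i)"
    and psd: "\<And>i k. i < m \<Longrightarrow> k \<in> K i \<Longrightarrow> psd_on ({..<a1} \<times> ({..<b1} \<times> E)) (\<tau> i k)"
    and Y: "\<And>i. i < m \<Longrightarrow> Y i \<in> carrier_mat (a1 * b1) (a1 * b1)"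
    and Ye: "\<And>i x y x' y'. i < m \<Longrightarrow> x < a1 \<Longrightarrow> y < b1 \<Longrightarrow> x' < a1 \<Longrightarrow> y' < b1 \<Longrightarrow>
       Y i $$ (x * b1 + y, x' * b1 + y') = (\<Sum>k\<in>K i. \<Sum>e\<in>E. \<tau> i k (x, (y, e)) (x', (y', e)))"
    and tr: "(\<Sum>i<m. \<Sum>k\<in>K i. otr ({..<a1} \<times> ({..<b1} \<times> E)) (\<tau> i k)) = T"
    and le: "(\<Sum>i<m. \<Sum>k\<in>K i. cmi {..<a1} {..<b1} E (\<tau> i k)) \<le> C"
  shows "\<exists>(E' :: nat set) \<sigma>'. finite E' \<and> psd_on ({..<a'} \<times> ({..<b'} \<times> E')) \<sigma>' \<and>
    marg a' b' E' (mat_sum (a' * b') m (\<lambda>i. \<Lambda> i (Y i))) \<sigma>' \<and>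
    otr ({..<a'} \<times> ({..<b'} \<times> E')) \<sigma>' = T \<and>
    cmi {..<a'} {..<b'} E' \<sigma>' \<le> C"
proof -
  define P where "P i F \<longleftrightarrow> finite (fst F) \<and> psd_on ({..<a'} \<times> ({..<b'} \<times> fst F)) (snd F) \<and> marg a' b' (fst F) (\<Lambda> i (Y i)) (snd F) \<and>
      otr ({..<a'} \<times> ({..<b'} \<times> fst F)) (snd F) = (\<Sum>k\<in>K i. otr ({..<a1} \<times> ({..<b1} \<times> E)) (\<tau> i k)) \<and>
      cmi {..<a'} {..<b'} (fst F) (snd F) \<le> (\<Sum>k\<in>K i. cmi {..<a1} {..<b1} E (\<tau> i k))"
    for i and F :: "nat set \<times> (nat \<times> (nat \<times> nat) \<Rightarrow> nat \<times> (nat \<times> nat) \<Rightarrow> complex)"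
  have "\<forall>i\<in>{..<m}. \<exists>F. P i F"
  proof
    fix i assume "i \<in> {..<m}"
    then have i: "i < m" by simp
    \<comment> \<open>Merging over \<open>k\<close> first: only the sum over the Kraus operators of
      outcome \<open>i\<close> is an extension of \<open>Y i\<close>, the input of the remaining
      protocol.\<close>
    obtain E1 :: "nat set" and \<omega> where E1: "finite E1" "psd_on ({..<a1} \<times> ({..<b1} \<times> E1)) \<omega>"
      "otr ({..<a1} \<times> ({..<b1} \<times> E1)) \<omega> = (\<Sum>k\<in>K i. otr ({..<a1} \<times> ({..<b1} \<times> E)) (\<tau> i k))"
      "cmi {..<a1} {..<b1} E1 \<omega> = (\<Sum>k\<in>K i. cmi {..<a1} {..<b1} E (\<tau> i k))"
      "\<forall>x y x' y'. (\<Sum>e\<in>E1. \<omega> (x, (y, e)) (x', (y', e))) = (\<Sum>k\<in>K i. \<Sum>e\<in>E. \<tau> i k (x, (y, e)) (x', (y', e)))"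
      using merge_extensions[of "K i" "\<lambda>_. E" a1 b1 "\<tau> i"] K[OF i] E psd[OF i] by auto
    have "marg a1 b1 E1 (Y i) \<omega>"
      unfolding marg_def using Y[OF i] Ye[OF i] E1(5) by simp
    with IH[OF i] E1(1,2) obtain E2 :: "nat set" and \<sigma>2 where
      "finite E2" "psd_on ({..<a'} \<times> ({..<b'} \<times> E2)) \<sigma>2" "marg a' b' E2 (\<Lambda> i (Y i)) \<sigma>2"
      "otr ({..<a'} \<times> ({..<b'} \<times> E2)) \<sigma>2 = otr ({..<a1} \<times> ({..<b1} \<times> E1)) \<omega>"
      "cmi {..<a'} {..<b'} E2 \<sigma>2 \<le> cmi {..<a1} {..<b1} E1 \<omega>"
      unfolding locc_mono_def by blast
    then have "P i (E2, \<sigma>2)" using E1 by (simp add: P_def)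
    then show "\<exists>F. P i F" ..
  qed
  from bchoice[OF this] obtain F where F: "\<forall>i\<in>{..<m}. P i (F i)" ..
  then have F': "\<And>i. i \<in> {..<m} \<Longrightarrow> P i (F i)" by blast
  have f1: "finite (fst (F i))" and f2: "psd_on ({..<a'} \<times> ({..<b'} \<times> fst (F i))) (snd (F i))"
    and f3: "marg a' b' (fst (F i)) (\<Lambda> i (Y i)) (snd (F i))"
    and f4: "otr ({..<a'} \<times> ({..<b'} \<times> fst (F i))) (snd (F i)) = (\<Sum>k\<in>K i. otr ({..<a1} \<times> ({..<b1} \<times> E)) (\<tau> i k))"
    and f5: "cmi {..<a'} {..<b'} (fst (F i)) (snd (F i)) \<le> (\<Sum>k\<in>K i. cmi {..<a1} {..<b1} E (\<tau> i k))"
    if "i \<in> {..<m}" for i using F'[OF that] unfolding P_def by blast+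
  \<comment> \<open>Merging over \<open>i\<close> afterwards keeps the outcome in the extension
    although \<open>mat_sum\<close> discards it.\<close>
  obtain E' :: "nat set" and \<sigma>' where E': "finite E'" "psd_on ({..<a'} \<times> ({..<b'} \<times> E')) \<sigma>'"
      "otr ({..<a'} \<times> ({..<b'} \<times> E')) \<sigma>' = (\<Sum>i<m. otr ({..<a'} \<times> ({..<b'} \<times> fst (F i))) (snd (F i)))"
      "cmi {..<a'} {..<b'} E' \<sigma>' = (\<Sum>i<m. cmi {..<a'} {..<b'} (fst (F i)) (snd (F i)))"
      "\<forall>x y x' y'. (\<Sum>e\<in>E'. \<sigma>' (x, (y, e)) (x', (y', e))) = (\<Sum>i<m. \<Sum>e\<in>fst (F i). snd (F i) (x, (y, e)) (x', (y', e)))"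
    using merge_extensions[of "{..<m}" "\<lambda>i. fst (F i)" a' b' "\<lambda>i. snd (F i)"] f1 f2 by auto
  have "marg a' b' E' (mat_sum (a' * b') m (\<lambda>i. \<Lambda> i (Y i))) \<sigma>'"
    unfolding marg_def
  proof (intro conjI allI impI)
    show "mat_sum (a' * b') m (\<lambda>i. \<Lambda> i (Y i)) \<in> carrier_mat (a' * b') (a' * b')" by (simp add: mat_sum_def)
    fix x y x' y' assume "x < a'" "y < b'" "x' < a'" "y' < b'"
    then have "mat_sum (a' * b') m (\<lambda>i. \<Lambda> i (Y i)) $$ (x * b' + y, x' * b' + y') = (\<Sum>i<m. \<Lambda> i (Y i) $$ (x * b' + y, x' * b' + y'))"
      by (simp add: mat_sum_def pair_index_less)
    also have "\<dots> = (\<Sum>i<m. \<Sum>e\<in>fst (F i). snd (F i) (x, (y, e)) (x', (y', e)))"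
      using f3 \<open>x < a'\<close> \<open>y < b'\<close> \<open>x' < a'\<close> \<open>y' < b'\<close> by (intro sum.cong) (auto simp: marg_def)
    finally show "mat_sum (a' * b') m (\<lambda>i. \<Lambda> i (Y i)) $$ (x * b' + y, x' * b' + y') = (\<Sum>e\<in>E'. \<sigma>' (x, (y, e)) (x', (y', e)))"
      using E'(5) by simp
  qed
  moreover have "otr ({..<a'} \<times> ({..<b'} \<times> E')) \<sigma>' = T"
    unfolding E'(3) tr[symmetric] using f4 by simp
  moreover have "cmi {..<a'} {..<b'} E' \<sigma>' \<le> C"
    unfolding E'(4) using f5 by (intro order_trans[OF sum_mono le]) auto
  ultimately show ?thesis using E'(1,2) by blast
qed
lemma otr_swp: "otr (B \<times> (A \<times> E)) (swp \<sigma>) = otr (A \<times> (B \<times> E)) \<sigma>"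
  unfolding otr_def using sum.reindex_bij_betw[OF bij_betw_swp, of "\<lambda>z. Re (\<sigma> z z)" B A E] by (simp add: swp_def)

lemma locc_imp_mono: "locc a b a' b' \<Lambda> \<Longrightarrow> locc_mono a b a' b' \<Lambda>"
proof (induction rule: locc.induct)
  case (stop a b)
  then show ?case unfolding locc_mono_def by blast
next
  case (step_A a a1 m \<Phi> b a' b' \<Lambda>)
  obtain K M where KM: "kraus a a1 m \<Phi> K M"
    using instrument_kraus[OF step_A.hyps(1)] by blast
  have K: "\<And>i. i < m \<Longrightarrow> finite (K i)"
    and kr: "\<And>i X r s. i < m \<Longrightarrow> X \<in> carrier_mat a a \<Longrightarrow> r < a1 \<Longrightarrow> s < a1 \<Longrightarrow>
       \<Phi> i X $$ (r, s) = (\<Sum>k\<in>K i. \<Sum>p<a. \<Sum>q<a. M i k r p * X $$ (p, q) * cnj (M i k s q))"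
    and iso: "\<And>x y. x < a \<Longrightarrow> y < a \<Longrightarrow>
       (\<Sum>z\<in>Sigma {..<m} K. \<Sum>r<a1. cnj (M (fst z) (snd z) r x) * M (fst z) (snd z) r y) = of_bool (x = y)"
    using KM unfolding kraus_def by blast+
  have fS: "finite (Sigma {..<m} K)" using K by auto
  show ?case
    unfolding locc_mono_def
  proof (intro allI impI)
    fix X and E :: "nat set" and \<sigma>
    assume E: "finite E" and psd: "psd_on ({..<a} \<times> ({..<b} \<times> E)) \<sigma>" and mg: "marg a b E X \<sigma>"
    define \<tau> where "\<tau> i k = conj_fst {..<a} (M i k) \<sigma>" for i k
    define Y where "Y i = local_map 1 a b a1 (\<Phi> i) X" for i
    have fBE: "finite ({..<b} \<times> E)" using E by simp
    have Ye: "Y i $$ (x * b + y, x' * b + y') = (\<Sum>k\<in>K i. \<Sum>e\<in>E. \<tau> i k (x, (y, e)) (x', (y', e)))"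
      if i: "i < m" and xy: "x < a1" "y < b" "x' < a1" "y' < b" for i x y x' y'
    proof -
      have "Y i $$ (x * b + y, x' * b + y') = \<Phi> i (mat a a (\<lambda>(k, l). X $$ (k * b + y, l * b + y'))) $$ (x, x')"
        using xy pair_index_less[of x a1 y b] pair_index_less[of x' a1 y' b] by (simp add: Y_def local_map_def)
      also have "\<dots> = (\<Sum>k\<in>K i. \<Sum>p<a. \<Sum>q<a. M i k x p * (\<Sum>e\<in>E. \<sigma> (p, (y, e)) (q, (y', e))) * cnj (M i k x' q))"
        using mg xy by (subst kr[OF i]) (auto simp: marg_def intro!: sum.cong)
      also have "\<dots> = (\<Sum>k\<in>K i. \<Sum>p<a. \<Sum>q<a. \<Sum>e\<in>E. M i k x p * \<sigma> (p, (y, e)) (q, (y', e)) * cnj (M i k x' q))"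
        by (simp add: sum_distrib_left sum_distrib_right)
      also have "\<dots> = (\<Sum>k\<in>K i. \<Sum>e\<in>E. \<tau> i k (x, (y, e)) (x', (y', e)))"
        unfolding \<tau>_def conj_fst_def fst_conv snd_conv
        by (rule sum.cong[OF refl], subst (2) sum.swap, subst (1) sum.swap, rule refl)
      finally show ?thesis .
    qed
    have tr: "(\<Sum>i<m. \<Sum>k\<in>K i. otr ({..<a1} \<times> ({..<b} \<times> E)) (\<tau> i k)) = otr ({..<a} \<times> ({..<b} \<times> E)) \<sigma>"
    proof -
      have "(\<Sum>z\<in>Sigma {..<m} K. otr ({..<a1} \<times> ({..<b} \<times> E)) (conj_fst {..<a} (M (fst z) (snd z)) \<sigma>)) = otr ({..<a} \<times> ({..<b} \<times> E)) \<sigma>"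
        by (rule otr_instrument) (use iso in auto)
      then show ?thesis using K by (subst (asm) sum_Sigma) (auto simp: \<tau>_def)
    qed
    have le: "(\<Sum>i<m. \<Sum>k\<in>K i. cmi {..<a1} {..<b} E (\<tau> i k)) \<le> cmi {..<a} {..<b} E \<sigma>"
    proof -
      have "(\<Sum>z\<in>Sigma {..<m} K. cmi {..<a1} {..<b} E (conj_fst {..<a} (M (fst z) (snd z)) \<sigma>)) \<le> cmi {..<a} {..<b} E \<sigma>"
        by (rule cmi_instrument_le[OF _ _ E _ fS psd]) (use iso in auto)
      then show ?thesis using K by (subst (asm) sum_Sigma) (auto simp: \<tau>_def)
    qed
    show "\<exists>(E' :: nat set) \<sigma>'. finite E' \<and> psd_on ({..<a'} \<times> ({..<b'} \<times> E')) \<sigma>' \<and>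
        marg a' b' E' (mat_sum (a' * b') m (\<lambda>i. \<Lambda> i (local_map 1 a b a1 (\<Phi> i) X))) \<sigma>' \<and>
        otr ({..<a'} \<times> ({..<b'} \<times> E')) \<sigma>' = otr ({..<a} \<times> ({..<b} \<times> E)) \<sigma> \<and>
        cmi {..<a'} {..<b'} E' \<sigma>' \<le> cmi {..<a} {..<b} E \<sigma>"
      unfolding Y_def[symmetric]
    proof (rule locc_combine[OF _ E K _ _ Ye tr le])
      show "locc_mono a1 b a' b' (\<Lambda> i)" if "i < m" for i using step_A that by blast
      show "psd_on ({..<a1} \<times> ({..<b} \<times> E)) (\<tau> i k)" for i k
        unfolding \<tau>_def by (rule psd_on_conj_fst[OF _ fBE psd]) simp
      show "Y i \<in> carrier_mat (a1 * b) (a1 * b)" for i by (simp add: Y_def local_map_def)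
    qed
  qed
next
  case (step_B b b1 m \<Phi> a a' b' \<Lambda>)
  obtain K M where KM: "kraus b b1 m \<Phi> K M"
    using instrument_kraus[OF step_B.hyps(1)] by blast
  have K: "\<And>i. i < m \<Longrightarrow> finite (K i)"
    and kr: "\<And>i X r s. i < m \<Longrightarrow> X \<in> carrier_mat b b \<Longrightarrow> r < b1 \<Longrightarrow> s < b1 \<Longrightarrow>
       \<Phi> i X $$ (r, s) = (\<Sum>k\<in>K i. \<Sum>p<b. \<Sum>q<b. M i k r p * X $$ (p, q) * cnj (M i k s q))"
    and iso: "\<And>x y. x < b \<Longrightarrow> y < b \<Longrightarrow>
       (\<Sum>z\<in>Sigma {..<m} K. \<Sum>r<b1. cnj (M (fst z) (snd z) r x) * M (fst z) (snd z) r y) = of_bool (x = y)"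
    using KM unfolding kraus_def by blast+
  have fS: "finite (Sigma {..<m} K)" using K by auto
  show ?case
    unfolding locc_mono_def
  proof (intro allI impI)
    fix X and E :: "nat set" and \<sigma>
    assume E: "finite E" and psd: "psd_on ({..<a} \<times> ({..<b} \<times> E)) \<sigma>" and mg: "marg a b E X \<sigma>"
    \<comment> \<open>An instrument of the second party acts on the first factor once the systems
      are exchanged, and \<open>cmi\<close> is symmetric under the exchange.\<close>
    define \<tau> where "\<tau> i k = swp (conj_fst {..<b} (M i k) (swp \<sigma>))" for i k
    define Y where "Y i = local_map a b 1 b1 (\<Phi> i) X" for i
    have fAE: "finite ({..<a} \<times> E)" using E by simp
    have psdc: "psd_on ({..<b1} \<times> ({..<a} \<times> E)) (conj_fst {..<b} (M i k) (swp \<sigma>))" for i k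
      by (rule psd_on_conj_fst[OF _ fAE psd_on_swp[OF psd]]) simp
    have Ye: "Y i $$ (x * b1 + y, x' * b1 + y') = (\<Sum>k\<in>K i. \<Sum>e\<in>E. \<tau> i k (x, (y, e)) (x', (y', e)))"
      if i: "i < m" and xy: "x < a" "y < b1" "x' < a" "y' < b1" for i x y x' y'
    proof -
      have "Y i $$ (x * b1 + y, x' * b1 + y') = \<Phi> i (mat b b (\<lambda>(k, l). X $$ (x * b + k, x' * b + l))) $$ (y, y')"
        using xy pair_index_less[of x a y b1] pair_index_less[of x' a y' b1] by (simp add: Y_def local_map_def)
      also have "\<dots> = (\<Sum>k\<in>K i. \<Sum>p<b. \<Sum>q<b. M i k y p * (\<Sum>e\<in>E. \<sigma> (x, (p, e)) (x', (q, e))) * cnj (M i k y' q))"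
        using mg xy by (subst kr[OF i]) (auto simp: marg_def intro!: sum.cong)
      also have "\<dots> = (\<Sum>k\<in>K i. \<Sum>p<b. \<Sum>q<b. \<Sum>e\<in>E. M i k y p * \<sigma> (x, (p, e)) (x', (q, e)) * cnj (M i k y' q))"
        by (simp add: sum_distrib_left sum_distrib_right)
      also have "\<dots> = (\<Sum>k\<in>K i. \<Sum>e\<in>E. \<tau> i k (x, (y, e)) (x', (y', e)))"
        unfolding \<tau>_def conj_fst_def swp_def fst_conv snd_conv
        by (rule sum.cong[OF refl], subst (2) sum.swap, subst (1) sum.swap, rule refl)
      finally show ?thesis .
    qed
    have tr: "(\<Sum>i<m. \<Sum>k\<in>K i. otr ({..<a} \<times> ({..<b1} \<times> E)) (\<tau> i k)) = otr ({..<a} \<times> ({..<b} \<times> E)) \<sigma>"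
    proof -
      have "(\<Sum>z\<in>Sigma {..<m} K. otr ({..<b1} \<times> ({..<a} \<times> E)) (conj_fst {..<b} (M (fst z) (snd z)) (swp \<sigma>))) = otr ({..<b} \<times> ({..<a} \<times> E)) (swp \<sigma>)"
        by (rule otr_instrument) (use iso in auto)
      then show ?thesis using K by (subst (asm) sum_Sigma) (auto simp: \<tau>_def otr_swp)
    qed
    have le: "(\<Sum>i<m. \<Sum>k\<in>K i. cmi {..<a} {..<b1} E (\<tau> i k)) \<le> cmi {..<a} {..<b} E \<sigma>"
    proof -
      have "(\<Sum>z\<in>Sigma {..<m} K. cmi {..<b1} {..<a} E (conj_fst {..<b} (M (fst z) (snd z)) (swp \<sigma>))) \<le> cmi {..<b} {..<a} E (swp \<sigma>)"
        by (rule cmi_instrument_le[OF _ _ E _ fS psd_on_swp[OF psd]]) (use iso in auto)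
      then show ?thesis
        using K by (subst (asm) sum_Sigma) (auto simp: \<tau>_def cmi_swp[OF _ _ E psdc] cmi_swp[OF _ _ E psd])
    qed
    show "\<exists>(E' :: nat set) \<sigma>'. finite E' \<and> psd_on ({..<a'} \<times> ({..<b'} \<times> E')) \<sigma>' \<and>
        marg a' b' E' (mat_sum (a' * b') m (\<lambda>i. \<Lambda> i (local_map a b 1 b1 (\<Phi> i) X))) \<sigma>' \<and>
        otr ({..<a'} \<times> ({..<b'} \<times> E')) \<sigma>' = otr ({..<a} \<times> ({..<b} \<times> E)) \<sigma> \<and>
        cmi {..<a'} {..<b'} E' \<sigma>' \<le> cmi {..<a} {..<b} E \<sigma>"
      unfolding Y_def[symmetric]
    proof (rule locc_combine[OF _ E K _ _ Ye tr le])
      show "locc_mono a b1 a' b' (\<Lambda> i)" if "i < m" for i using step_B that by blast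
      show "psd_on ({..<a} \<times> ({..<b1} \<times> E)) (\<tau> i k)" for i k
        unfolding \<tau>_def by (rule psd_on_swp[OF psdc])
      show "Y i \<in> carrier_mat (a * b1) (a * b1)" for i by (simp add: Y_def local_map_def)
    qed
  qed
qed

section \<open>The rate of distillation\<close>

lemma marg_ptrace:
  assumes "X \<in> carrier_mat (a * b * c) (a * b * c)"
  shows "marg a b {..<c} (ptrace (a * b) c 1 X) (tri b c X)"
  using pair_index_less[of _ a _ b] by (auto simp: marg_def ptrace_def tri_def)

lemma ent_point: "ent {x} (\<lambda>_ _. 1) = 0"
proof -
  have "diag_on {x} (\<lambda>_ _. 1) {0 :: nat} (\<lambda>_. 1) (\<lambda>_ _. 1)" by (simp add: diag_on_def orthonormal_on_def)
  from ent_eq[OF this] show ?thesis by simp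
qed

lemma pair_index_div: "(j :: nat) < c \<Longrightarrow> (i * c + j) div c = i"
  by simp

text \<open>The tensor power of a given extension extends the tensor power of the state. Its value
  is additive without further trace factors because a density operator has trace 1.\<close>

lemma copies_extension:
  assumes den: "density_operator (a * b * c) \<sigma>"
  shows "\<exists>(E :: nat set) \<tau>. finite E \<and> psd_on ({..<a ^ n} \<times> ({..<b ^ n} \<times> E)) \<tau> \<and>
    marg (a ^ n) (b ^ n) E (copies a b (ptrace (a * b) c 1 \<sigma>) n) \<tau> \<and>
    otr ({..<a ^ n} \<times> ({..<b ^ n} \<times> E)) \<tau> = 1 \<and>
    cmi {..<a ^ n} {..<b ^ n} E \<tau> = real n * cmi {..<a} {..<b} {..<c} (tri b c \<sigma>)"
proof (induction n)
  case 0
  let ?\<tau> = "\<lambda>(_ :: nat \<times> (nat \<times> nat)) (_ :: nat \<times> (nat \<times> nat)). 1 :: complex"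
  have s: "{..<Suc 0} = {0}" by auto
  have "cmi {0} {0} {0} ?\<tau> = 0"
    by (simp add: cmi_def ptr_def swp_def ent_point)
  moreover have "psd_on ({0} \<times> ({0} \<times> {0})) ?\<tau>"
    by (rule psd_onI[of "{0 :: nat}" _ _ "\<lambda>_ _. 1"]) auto
  moreover have "otr ({0} \<times> ({0} \<times> {0})) ?\<tau> = 1" by (simp add: otr_def)
  moreover have "marg 1 1 {0} (1\<^sub>m 1) ?\<tau>" by (simp add: marg_def)
  ultimately show ?case
    by (intro exI[of _ "{0}"] exI[of _ ?\<tau>]) (simp add: s)
next
  case (Suc n)
  let ?\<rho> = "ptrace (a * b) c 1 \<sigma>" and ?A = "a ^ n" and ?B = "b ^ n"
  let ?t = "tri b c \<sigma>"
  have psd: "psd (a * b * c) \<sigma>" using den by (simp add: density_operator_def)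
  note pt = psd_on_tri[OF psd]
  have mr: "marg a b {..<c} ?\<rho> ?t" by (rule marg_ptrace) (use psd in \<open>simp add: psd_def\<close>)
  obtain E :: "nat set" and \<tau> where E: "finite E" and pE: "psd_on ({..<?A} \<times> ({..<?B} \<times> E)) \<tau>"
    and mE: "marg ?A ?B E (copies a b ?\<rho> n) \<tau>"
    and tE: "otr ({..<?A} \<times> ({..<?B} \<times> E)) \<tau> = 1"
    and cE: "cmi {..<?A} {..<?B} E \<tau> = real n * cmi {..<a} {..<b} {..<c} ?t"
    using Suc.IH by blast
  define E' where "E' = prod_encode ` ({..<c} \<times> E)"
  define f where "f = (\<lambda>i. (i div ?A, i mod ?A))"
  define g where "g = (\<lambda>i. (i div ?B, i mod ?B))"
  have bf: "bij_betw f {..<a * ?A} ({..<a} \<times> {..<?A})" unfolding f_def by (rule bij_betw_div_mod)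
  have bg: "bij_betw g {..<b * ?B} ({..<b} \<times> {..<?B})" unfolding g_def by (rule bij_betw_div_mod)
  have bh: "bij_betw prod_decode E' ({..<c} \<times> E)"
    unfolding E'_def by (rule bij_betw_byWitness[where f'=prod_encode]) auto
  define \<tau>' where "\<tau>' = relabel f g prod_decode (ten ?t \<tau>)"
  have pten: "psd_on (({..<a} \<times> {..<?A}) \<times> (({..<b} \<times> {..<?B}) \<times> ({..<c} \<times> E))) (ten ?t \<tau>)"
    by (rule psd_on_ten[OF pt pE])
  have "finite E'" using E by (simp add: E'_def)
  moreover have "psd_on ({..<a * ?A} \<times> ({..<b * ?B} \<times> E')) \<tau>'"
    unfolding \<tau>'_def by (rule psd_on_relabel[OF bf bg bh pten])
  moreover have "otr ({..<a * ?A} \<times> ({..<b * ?B} \<times> E')) \<tau>' = 1"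
    unfolding \<tau>'_def otr_relabel[OF bf bg bh]
    using otr_ten[OF _ _ _ _ _ E pt pE] otr_tri[OF den] tE by simp
  moreover have "cmi {..<a * ?A} {..<b * ?B} E' \<tau>' = real (Suc n) * cmi {..<a} {..<b} {..<c} ?t"
  proof -
    have "cmi {..<a * ?A} {..<b * ?B} E' \<tau>' = cmi ({..<a} \<times> {..<?A}) ({..<b} \<times> {..<?B}) ({..<c} \<times> E) (ten ?t \<tau>)"
      unfolding \<tau>'_def by (rule cmi_relabel[OF bf bg bh _ _ _ pten]) (use E in auto)
    also have "\<dots> = cmi {..<a} {..<b} {..<c} ?t * 1 + 1 * (real n * cmi {..<a} {..<b} {..<c} ?t)"
      using cmi_ten[OF _ _ _ _ _ E pt pE] unfolding tE cE otr_tri[OF den] by simp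
    finally show ?thesis by (simp add: algebra_simps)
  qed
  moreover have "marg (a * ?A) (b * ?B) E' (copies a b ?\<rho> (Suc n)) \<tau>'"
    unfolding marg_def
  proof (intro conjI allI impI)
    show "copies a b ?\<rho> (Suc n) \<in> carrier_mat (a * ?A * (b * ?B)) (a * ?A * (b * ?B))"
      by (simp add: bip_tensor_def Let_def)
    fix i j i' j' assume ij: "i < a * ?A" "j < b * ?B" "i' < a * ?A" "j' < b * ?B"
    note d = div_mod_bounds[OF ij(1)] div_mod_bounds[OF ij(2)] div_mod_bounds[OF ij(3)] div_mod_bounds[OF ij(4)]
    have "copies a b ?\<rho> (Suc n) $$ (i * (b * ?B) + j, i' * (b * ?B) + j')
        = ?\<rho> $$ (i div ?A * b + j div ?B, i' div ?A * b + j' div ?B) *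
          copies a b ?\<rho> n $$ (i mod ?A * ?B + j mod ?B, i' mod ?A * ?B + j' mod ?B)"
      using ij pair_index_less[OF ij(1,2)] pair_index_less[OF ij(3,4)]
      by (simp add: bip_tensor_def Let_def pair_index_div[OF ij(2)] pair_index_div[OF ij(4)])
    also have "?\<rho> $$ (i div ?A * b + j div ?B, i' div ?A * b + j' div ?B)
        = (\<Sum>e<c. ?t (i div ?A, (j div ?B, e)) (i' div ?A, (j' div ?B, e)))"
      using mr d unfolding marg_def by blast
    also have "copies a b ?\<rho> n $$ (i mod ?A * ?B + j mod ?B, i' mod ?A * ?B + j' mod ?B)
        = (\<Sum>e\<in>E. \<tau> (i mod ?A, (j mod ?B, e)) (i' mod ?A, (j' mod ?B, e)))"
      using mE d unfolding marg_def by blast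
    also have "(\<Sum>e<c. ?t (i div ?A, (j div ?B, e)) (i' div ?A, (j' div ?B, e))) *
          (\<Sum>e\<in>E. \<tau> (i mod ?A, (j mod ?B, e)) (i' mod ?A, (j' mod ?B, e)))
        = (\<Sum>z\<in>{..<c} \<times> E. ten ?t \<tau> (f i, (g j, z)) (f i', (g j', z)))"
      by (simp add: sum_product sum_Times ten_def f_def g_def)
    also have "\<dots> = (\<Sum>e\<in>E'. \<tau>' (i, (j, e)) (i', (j', e)))"
      using sum.reindex_bij_betw[OF bh, of "\<lambda>z. ten ?t \<tau> (f i, (g j, z)) (f i', (g j', z))"]
      by (simp add: \<tau>'_def relabel_def)
    finally show "copies a b ?\<rho> (Suc n) $$ (i * (b * ?B) + j, i' * (b * ?B) + j') = \<dots>" .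
  qed
  ultimately show ?case unfolding power_Suc by blast
qed

text \<open>The value of I(A;B|E) for the copies bounds the value of the protocol's output, and that
  in turn bounds the coherent information of the output. The error enters only through the overlap
  with the target.\<close>

lemma log_rank_le:
  assumes den: "density_operator (a * b * c) \<sigma>" and locc: "locc (a ^ n) (b ^ n) s s \<Lambda>" and s: "1 \<le> s"
  defines "\<epsilon> \<equiv> trace_norm (\<Lambda> (copies a b (ptrace (a * b) c 1 \<sigma>) n) - rank_one (max_entangled_vec s))"
  shows "(1 - 2 * \<epsilon>) * ln (real s) - 1 \<le> real n * (cmi {..<a} {..<b} {..<c} (tri b c \<sigma>) / 2)"
proof -
  let ?S = "{..<s}"
  define \<omega> where "\<omega> = \<Lambda> (copies a b (ptrace (a * b) c 1 \<sigma>) n)"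
  obtain E0 :: "nat set" and \<tau> where E0: "finite E0" "psd_on ({..<a ^ n} \<times> ({..<b ^ n} \<times> E0)) \<tau>"
    "marg (a ^ n) (b ^ n) E0 (copies a b (ptrace (a * b) c 1 \<sigma>) n) \<tau>"
    "otr ({..<a ^ n} \<times> ({..<b ^ n} \<times> E0)) \<tau> = 1"
    "cmi {..<a ^ n} {..<b ^ n} E0 \<tau> = real n * cmi {..<a} {..<b} {..<c} (tri b c \<sigma>)"
    using copies_extension[OF den, of n] by blast
  obtain E :: "nat set" and \<sigma>' where E: "finite E" and psd: "psd_on (?S \<times> (?S \<times> E)) \<sigma>'"
    and mg: "marg s s E \<omega> \<sigma>'" and tr: "otr (?S \<times> (?S \<times> E)) \<sigma>' = 1"
    and le: "cmi ?S ?S E \<sigma>' \<le> real n * cmi {..<a} {..<b} {..<c} (tri b c \<sigma>)"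
    using locc_imp_mono[OF locc] E0 unfolding locc_mono_def \<omega>_def by metis
  define R where "R = (\<lambda>x y. \<Sum>e\<in>E. \<sigma>' (fst x, (snd x, e)) (fst y, (snd y, e)))"
  have psdR: "psd_on (?S \<times> ?S) R"
  proof -
    have "psd_on (?S \<times> ?S) (\<lambda>x y. \<sigma>' (fst x, (snd x, e)) (fst y, (snd y, e)))" if "e \<in> E" for e
      using psd_on_reindex[OF psd, of "?S \<times> ?S" "\<lambda>x. (fst x, (snd x, e))"] that by auto
    then show ?thesis unfolding R_def by (rule psd_on_sum[OF E])
  qed
  have trR: "otr (?S \<times> ?S) R = 1"
    using tr by (simp add: otr_def R_def sum_Times)
  define F where "F = Re (\<Sum>i<s. \<Sum>j<s. R (i, i) (j, j)) / real s"
  have "(2 * F - 1) * ln (real s) - 1 \<le> - cent ?S ?S R"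
    by (rule cent_le_of_overlap[OF s psdR trR F_def])
  also have "\<dots> \<le> cmi ?S ?S E \<sigma>' / 2"
    using cmi_ge_coherent_information[OF _ _ E psd] by (simp add: R_def)
  also have "\<dots> \<le> real n * (cmi {..<a} {..<b} {..<c} (tri b c \<sigma>) / 2)" using le by simp
  finally have 1: "(2 * F - 1) * ln (real s) - 1 \<le> real n * (cmi {..<a} {..<b} {..<c} (tri b c \<sigma>) / 2)" .
  define D where "D = \<omega> - rank_one (max_entangled_vec s)"
  define u where "u i = max_entangled_vec s $ i" for i
  define h where "h i = (i div s, i mod s)" for i
  define w where "w x = of_bool (fst x = snd x) * complex_of_real (1 / sqrt (real s))" for x :: "nat \<times> nat"
  have bh: "bij_betw h {..<s * s} (?S \<times> ?S)" unfolding h_def by (rule bij_betw_div_mod)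
  have uw: "u i = w (h i)" if "i < s * s" for i
    using that by (simp add: u_def w_def h_def max_entangled_vec_def)
  have rc: "rank_one (max_entangled_vec s) \<in> carrier_mat (s * s) (s * s)"
    by (simp add: rank_one_def max_entangled_vec_def)
  have Dc: "D \<in> carrier_mat (s * s) (s * s)" using rc unfolding D_def by (rule minus_carrier_mat)
  have De: "mfun D i j = R (h i) (h j) - u i * cnj (u j)" if "i < s * s" "j < s * s" for i j
  proof -
    have "\<omega> $$ (i div s * s + i mod s, j div s * s + j mod s) = R (h i) (h j)"
      using mg div_mod_bounds[OF that(1)] div_mod_bounds[OF that(2)] unfolding marg_def R_def h_def fst_conv snd_conv by blast
    then show ?thesis
      using that rc by (simp add: D_def mfun_def rank_one_def u_def max_entangled_vec_def)
  qed
  have nu: "(\<Sum>i<s * s. cnj (u i) * u i) = 1"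
  proof -
    have "(\<Sum>i<s * s. cnj (u i) * u i) = (\<Sum>i<s * s. cnj (w (h i)) * w (h i))"
      by (intro sum.cong) (auto simp: uw)
    also have "\<dots> = (\<Sum>x\<in>?S \<times> ?S. cnj (w x) * w x)"
      by (rule sum.reindex_bij_betw[OF bh])
    finally show ?thesis unfolding w_def max_entangled_norm[OF s] .
  qed
  have hD: "hermitian_on {..<s * s} (mfun D)"
    unfolding hermitian_on_def
  proof (intro ballI)
    fix i j assume ij: "i \<in> {..<s * s}" "j \<in> {..<s * s}"
    then have "R (h j) (h i) = cnj (R (h i) (h j))"
      using psd_on_hermitian[OF psdR] bij_betwE[OF bh] unfolding hermitian_on_def by blast
    then show "mfun D j i = cnj (mfun D i j)" using ij by (simp add: De)
  qed
  \<comment> \<open>The expectation of the error operator in the target vector is F - 1, so the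
    trace norm bounds the missing overlap.\<close>
  have "(\<Sum>i<s * s. \<Sum>j<s * s. cnj (u i) * mfun D i j * u j)
      = (\<Sum>i<s * s. \<Sum>j<s * s. cnj (w (h i)) * R (h i) (h j) * w (h j)) - (\<Sum>i<s * s. \<Sum>j<s * s. (cnj (u i) * u i) * (cnj (u j) * u j))"
    unfolding sum_subtractf[symmetric] by (intro sum.cong refl) (simp add: De uw algebra_simps)
  also have "(\<Sum>i<s * s. \<Sum>j<s * s. (cnj (u i) * u i) * (cnj (u j) * u j)) = 1"
    unfolding sum_product[symmetric] nu by simp
  also have "(\<Sum>i<s * s. \<Sum>j<s * s. cnj (w (h i)) * R (h i) (h j) * w (h j))
      = (\<Sum>x\<in>?S \<times> ?S. \<Sum>y\<in>?S \<times> ?S. cnj (w x) * R x y * w y)"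
    unfolding sum.reindex_bij_betw[OF bh, of "\<lambda>y. cnj (w (h _)) * R (h _) y * w y"]
    by (rule sum.reindex_bij_betw[OF bh, of "\<lambda>x. \<Sum>y\<in>?S \<times> ?S. cnj (w x) * R x y * w y"])
  also have "\<dots> = (\<Sum>i<s. \<Sum>j<s. R (i, i) (j, j)) / of_nat s"
    unfolding w_def by (rule max_entangled_form[OF s])
  finally have "Re (\<Sum>i<s * s. \<Sum>j<s * s. cnj (u i) * mfun D i j * u j) = F - 1"
    by (simp add: F_def Re_divide_of_nat)
  with trace_norm_ge[OF Dc hD nu] have "1 - \<epsilon> \<le> F"
    by (simp add: \<epsilon>_def D_def \<omega>_def)
  then have "(1 - 2 * \<epsilon>) * ln (real s) \<le> (2 * F - 1) * ln (real s)"
    using s by (intro mult_right_mono) auto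
  with 1 show ?thesis by linarith
qed

lemma limsup_rate_le:
  fixes s :: "nat \<Rightarrow> nat" and \<epsilon> :: "nat \<Rightarrow> real" and c :: real
  assumes \<epsilon>: "\<epsilon> \<longlonglongrightarrow> 0" and le: "\<And>n. n \<ge> 1 \<Longrightarrow> (1 - 2 * \<epsilon> n) * ln (real (s n)) - 1 \<le> real n * c"
  shows "limsup (\<lambda>n. ereal (log 2 (real (s n)) / real n)) \<le> ereal (c / ln 2)"
proof -
  define g where "g n = (c + 1 / real n) / (1 - 2 * \<epsilon> n) / ln 2" for n
  have "g \<longlonglongrightarrow> (c + 0) / (1 - 2 * 0) / ln 2"
    unfolding g_def by (intro tendsto_intros \<epsilon> lim_1_over_n) auto
  then have g: "(\<lambda>n. ereal (g n)) \<longlonglongrightarrow> ereal (c / ln 2)" by simp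
  \<comment> \<open>Division by 1 - 2 \<epsilon> preserves the inequality only once this factor is
    positive.\<close>
  have "\<forall>\<^sub>F n in sequentially. \<epsilon> n < 1 / 2" using \<epsilon> by (rule order_tendstoD) simp
  moreover have "\<forall>\<^sub>F n :: nat in sequentially. n \<ge> 1" by (rule eventually_ge_at_top)
  ultimately have "\<forall>\<^sub>F n in sequentially. ereal (log 2 (real (s n)) / real n) \<le> ereal (g n)"
  proof eventually_elim
    case (elim n)
    then have n: "real n > 0" and d: "1 - 2 * \<epsilon> n > 0" by simp_all
    have "(1 - 2 * \<epsilon> n) * ln (real (s n)) \<le> real n * (c + 1 / real n)"
      using le[OF elim(2)] n by (simp add: algebra_simps)
    then have "ln (real (s n)) \<le> real n * (c + 1 / real n) / (1 - 2 * \<epsilon> n)"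
      using d by (simp add: pos_le_divide_eq mult.commute)
    then have "ln (real (s n)) / real n \<le> (c + 1 / real n) / (1 - 2 * \<epsilon> n)"
      using n by (simp add: pos_divide_le_eq mult.commute)
    then have "ln (real (s n)) / real n / ln 2 \<le> g n"
      unfolding g_def by (intro divide_right_mono) simp_all
    then show ?case by (simp add: log_def mult.commute)
  qed
  then have "limsup (\<lambda>n. ereal (log 2 (real (s n)) / real n)) \<le> limsup (\<lambda>n. ereal (g n))"
    by (rule Limsup_mono)
  also have "\<dots> = ereal (c / ln 2)" by (rule lim_imp_Limsup[OF _ g]) simp
  finally show ?thesis .
qed

theorem proposition10:
  fixes dA dB :: nat and \<rho> :: "complex mat"
  assumes "density_operator (dA * dB) \<rho>"
  shows "distillable_entanglement dA dB \<rho> \<le> squashed_entanglement dA dB \<rho>"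
  unfolding distillable_entanglement_def squashed_entanglement_def
\<comment> \<open>One sequence of protocols is compared with one extension, so neither the supremum
  nor the infimum has to be attained.\<close>
proof (intro Sup_least Inf_greatest)
  fix x y
  assume "x \<in> {limsup (\<lambda>n. ereal (log 2 (real (s n)) / real n)) | s \<Lambda>.
            (\<forall>n\<ge>1. s n \<ge> 1 \<and> locc (dA ^ n) (dB ^ n) (s n) (s n) (\<Lambda> n)) \<and>
            (\<lambda>n. trace_norm (\<Lambda> n (copies dA dB \<rho> n) - rank_one (max_entangled_vec (s n))))
              \<longlonglongrightarrow> 0}"
    and "y \<in> {ereal (1 / 2 * cond_mutual_info dA dB dE \<sigma>) | dE \<sigma>.
            density_operator (dA * dB * dE) \<sigma> \<and> ptrace (dA * dB) dE 1 \<sigma> = \<rho>}"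
  then obtain s \<Lambda> dE \<sigma> where
    x: "x = limsup (\<lambda>n. ereal (log 2 (real (s n)) / real n))"
    and locc: "\<And>n. n \<ge> 1 \<Longrightarrow> s n \<ge> 1 \<and> locc (dA ^ n) (dB ^ n) (s n) (s n) (\<Lambda> n)"
    and lim: "(\<lambda>n. trace_norm (\<Lambda> n (copies dA dB \<rho> n) - rank_one (max_entangled_vec (s n)))) \<longlonglongrightarrow> 0"
    and y: "y = ereal (1 / 2 * cond_mutual_info dA dB dE \<sigma>)"
    and den: "density_operator (dA * dB * dE) \<sigma>" and pt: "ptrace (dA * dB) dE 1 \<sigma> = \<rho>"
    by blast
  let ?c = "cmi {..<dA} {..<dB} {..<dE} (tri dB dE \<sigma>) / 2"
  have "x \<le> ereal (?c / ln 2)"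
    unfolding x by (rule limsup_rate_le[OF lim]) (use log_rank_le[OF den] locc pt in blast)
  also have "?c / ln 2 = 1 / 2 * cond_mutual_info dA dB dE \<sigma>"
    using den by (simp add: cond_mutual_info_eq density_operator_def)
  finally show "x \<le> y" unfolding y .
qed

end
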